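(* Let $n\ge 1$ be an integer and let $f\in\mathcal{B}$ be a meromorphic function on $\mathbb{C}$ whose $n$-th order $\rho=\rho_n(f)$ satisfies $0<\rho<\infty$. Suppose that $\infty$ is not an asymptotic value of $f$ and that there exists $M\in\mathbb{N}$, $M\geq 1$, such that the multiplicity of all poles of $f$, except possibly finitely many, is at most $M$. Let $\gamma>0$ and let $h(t)=t^{2}\left(\log^{n}\frac{1}{t}\right)^{\gamma}$ for $t\in(0,\delta_n]$, where $\delta_n=1/\exp^{n}(\gamma)$. If $\gamma<2/(M\rho)$, then $\mu_h(I(f))=0$.
   Context: Notation: $\log^{k}$ and $\exp^{k}$ denote the $k$-th iterates of $\log$ and $\exp$; $\log_+ x=\max\{\log x,0\}$ and $\log_+^{k}$ is its $k$-th iterate. For a meromorphic function $f$ on $\mathbb{C}$ with Nevanlinna characteristic $T(r,f)$, the $n$-th order is $$\rho_n(f)=\limsup_{r\to\infty}\frac{\log_+^{n+1}T(r,f)}{\log r}.$$ The class $\mathcal{B}$ (Eremenko–Lyubich class) consists of the meromorphic functions $f$ for which the set of finite singularities of the inverse $f^{-1}$ (i.e. the finite critical values and finite asymptotic values, and their finite limit points) is bounded. A value $a\in\mathbb{C}\cup\{\infty\}$ is an asymptotic value of $f$ if there is a curve tending to $\infty$ along which $f$ tends to $a$. $f^{k}$ denotes the $k$-th iterate of $f$, and the escaping set is $I(f)=\{z\in\mathbb{C}: f^{k}(z)\to\infty \text{ as } k\to\infty\}$ (in particular all iterates $f^k(z)$ are defined and finite). A gauge function is a continuous increasing function $h:(0,\alpha]\to(0,\infty)$,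 $\alpha>0$, with $\lim_{t\to0}h(t)=0$ (put $h(0)=0$). For $A\subset\mathbb{C}$, a $\delta$-cover of $A$ is a sequence $(A_j)_{j\in\mathbb{N}}$ of subsets of $\mathbb{C}$ with $A\subset\bigcup_j A_j$ and $\operatorname{diam}(A_j)\le\delta$ for all $j$ (Euclidean diameter). The Hausdorff measure with respect to $h$ is $$\mu_h(A)=\lim_{\delta\to0}\inf\Big\{\sum_{j=1}^\infty h(\operatorname{diam}A_j): (A_j)_{j\in\mathbb{N}}\text{ a }\delta\text{-cover of }A\Big\}.$$ *)

theory Defs
  imports "HOL-Complex_Analysis.Complex_Analysis"
begin

text \<open>
  A meromorphic function on the plane is a function \<open>f\<close> with \<open>f nicely_meromorphic_on UNIV\<close>:
  it is continuous (hence holomorphic) off its poles and has the junk value \<open>0\<close> at its poles.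
  All definitions below treat the poles explicitly, as points where \<open>f\<close> takes the value infinity.
\<close>

text \<open>Explicitly \<open>0\<close> for nonpositive arguments, because \<open>ln x = ln \<bar>x\<bar>\<close> in the library.\<close>

definition log_plus :: "real \<Rightarrow> real" where
  "log_plus x = (if x > 0 then max (ln x) 0 else 0)"

definition pole_mult :: "(complex \<Rightarrow> complex) \<Rightarrow> complex \<Rightarrow> nat" where
  "pole_mult f z = nat (- zorder f z)"

definition pole_count :: "(complex \<Rightarrow> complex) \<Rightarrow> real \<Rightarrow> nat" where
  "pole_count f r = (\<Sum>z\<in>{z \<in> cball 0 r. is_pole f z}. pole_mult f z)"

definition nevanlinna_N :: "(complex \<Rightarrow> complex) \<Rightarrow> real \<Rightarrow> real" where
  "nevanlinna_N f r =
     integral {0..r} (\<lambda>t. (real (pole_count f t) - real (pole_count f 0)) / t)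
     + real (pole_count f 0) * ln r"

definition nevanlinna_m :: "(complex \<Rightarrow> complex) \<Rightarrow> real \<Rightarrow> real" where
  "nevanlinna_m f r =
     1 / (2 * pi) * integral {0..2 * pi} (\<lambda>\<theta>. log_plus (norm (f (rcis r \<theta>))))"

definition nevanlinna_T :: "(complex \<Rightarrow> complex) \<Rightarrow> real \<Rightarrow> real" where
  "nevanlinna_T f r = nevanlinna_m f r + nevanlinna_N f r"

definition nth_order :: "nat \<Rightarrow> (complex \<Rightarrow> complex) \<Rightarrow> ereal" where
  "nth_order n f =
     Limsup at_top (\<lambda>r::real. ereal ((log_plus ^^ (n + 1)) (nevanlinna_T f r) / ln r))"

definition curve_to_infinity :: "(real \<Rightarrow> complex) \<Rightarrow> bool" where
  "curve_to_infinity c \<longleftrightarrow> continuous_on {0..} c \<and> filterlim c at_infinity at_top"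

definition finite_asymptotic_value :: "(complex \<Rightarrow> complex) \<Rightarrow> complex \<Rightarrow> bool" where
  "finite_asymptotic_value f a \<longleftrightarrow>
     (\<exists>c. curve_to_infinity c \<and> (\<forall>\<^sub>F t in at_top. \<not> is_pole f (c t)) \<and>
          ((\<lambda>t. f (c t)) \<longlongrightarrow> a) at_top)"

text \<open>The curve may pass through poles, where \<open>f\<close> takes the value infinity.\<close>

definition infinite_asymptotic_value :: "(complex \<Rightarrow> complex) \<Rightarrow> bool" where
  "infinite_asymptotic_value f \<longleftrightarrow>
     (\<exists>c. curve_to_infinity c \<and>
          (\<forall>R. \<forall>\<^sub>F t in at_top. is_pole f (c t) \<or> norm (f (c t)) > R))"

definition finite_critical_value :: "(complex \<Rightarrow> complex) \<Rightarrow> complex \<Rightarrow> bool" where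
  "finite_critical_value f w \<longleftrightarrow> (\<exists>z. \<not> is_pole f z \<and> deriv f z = 0 \<and> f z = w)"

definition finite_inverse_singularities :: "(complex \<Rightarrow> complex) \<Rightarrow> complex set" where
  "finite_inverse_singularities f =
     closure {w. finite_critical_value f w \<or> finite_asymptotic_value f w}"

definition class_B :: "(complex \<Rightarrow> complex) set" where
  "class_B = {f. f nicely_meromorphic_on UNIV \<and> bounded (finite_inverse_singularities f)}"

definition escaping_set :: "(complex \<Rightarrow> complex) \<Rightarrow> complex set" where
  "escaping_set f =
     {z. (\<forall>k. \<not> is_pole f ((f ^^ k) z)) \<and> filterlim (\<lambda>k. (f ^^ k) z) at_infinity sequentially}"

text \<open>Boundedness is required explicitly because \<open>diameter\<close> is unspecified on unbounded sets.\<close>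

definition delta_cover :: "real \<Rightarrow> complex set \<Rightarrow> (nat \<Rightarrow> complex set) \<Rightarrow> bool" where
  "delta_cover \<delta> A B \<longleftrightarrow>
     A \<subseteq> (\<Union>j. B j) \<and> (\<forall>j. bounded (B j) \<and> diameter (B j) \<le> \<delta>)"

text \<open>
  A gauge function on \<open>{0<..\<alpha>}\<close> is represented by any total function that agrees with it there
  and vanishes at \<open>0\<close>; values beyond \<open>\<alpha>\<close> do not influence the limit.
\<close>

definition hausdorff_measure :: "(real \<Rightarrow> real) \<Rightarrow> complex set \<Rightarrow> ennreal" where
  "hausdorff_measure h A =
     Lim (at_right 0) (\<lambda>\<delta>. INF B \<in> {B. delta_cover \<delta> A B}. \<Sum>j. ennreal (h (diameter (B j))))"

end

theory Submission
  imports Defs "HOL-Real_Asymp.Real_Asymp"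
begin

text \<open>
  Let \<open>R\<close> bound the finite singularities of the inverse. Since infinity is not an asymptotic
  value, every component of the preimage of \<open>|w| > R\<close> contains exactly one pole \<open>a\<close>, of
  multiplicity \<open>m\<close> say, and is the image of an injective map \<open>\<Psi>\<close> on a disc with \<open>\<Psi> 0 = a\<close> and
  \<open>f (\<Psi> u) = u ^ -m\<close>. Bloch's theorem, applied to \<open>\<Psi>\<close> and to its logarithm, replaces Koebe's
  theorems: it gives a size \<open>s a\<close> that bounds \<open>\<Psi>'\<close> on a smaller disc, and pairwise disjoint discs
  of radius comparable to \<open>s a\<close> within a bounded multiple of \<open>|a|\<close> from the origin. So the sum of
  \<open>(s a)\<^sup>2\<close> over the poles with \<open>|a| \<le> t\<close> is at most a constant times \<open>t\<^sup>2\<close>.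

  A point whose whole orbit stays large is coded by the poles \<open>a_k\<close> near which the orbit passes,
  and the points with the same first \<open>l + 1\<close> code letters form a set of diameter at most
  \<open>s a_0\<close> times the product of \<open>c * s a_k / |a_k| ^ (1 + 1/M)\<close> over \<open>k = 1, ..., l\<close>. The gauge
  of these bounds factors, because \<open>exp\<^sup>n x * exp\<^sup>n y \<le> exp\<^sup>n (x * y)\<close>, and the order
  of \<open>f\<close> bounds the number of poles, so that the sum over one letter is less than \<open>1/2\<close> if only
  poles far from the origin are admitted, provided that \<open>\<gamma> < 2 / (M * \<rho>)\<close>.
\<close>

section \<open>Lifting through the function\<close>

text \<open>The exponent 1 + 1/M stems from inverting u^-m: the chart composed with w^(-1/m) has
  derivative of order |w|^(-1-1/m), and m <= M off finitely many poles. The threshold for \<gamma>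
  can be read off from one annulus |a| ~ t: the squared sizes sum to at most a multiple of t^2, so
  the squared contraction factors sum to a multiple of t^(-2/M), while the n-fold logarithm
  contributes t^(\<tau> \<gamma>) with \<tau> slightly above \<rho>. Over dyadic t this converges if
  \<tau> \<gamma> < 2/M. The obstacle is the logarithmic factor of the gauge: it belongs to a whole
  word and not to a letter, and tiny tracts, whose sizes have no lower bound, make it large; so each
  letter needs its own bound for that factor. Exceptional poles (the origin, high multiplicity) are
  harmless, because the part of their tracts that an orbit of large points could visit is bounded.
  Escaping points reach the set of permanently large orbits after finitely many steps, and preimages
  of null sets are null.\<close>

lemma tendsto_of_avoiding_spheres:
  fixes c :: "real \<Rightarrow> 'a::euclidean_space"
  assumes cont: "continuous_on {0..} c"
    and ninf: "\<not> filterlim c at_infinity at_top"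
    and avoid: "\<And>z. (\<And>e. e > 0 \<Longrightarrow> \<exists>\<^sub>F t in at_top. dist (c t) z < e) \<Longrightarrow>
                  \<exists>e0>0. \<forall>e. 0 < e \<longrightarrow> e < e0 \<longrightarrow> (\<forall>\<^sub>F t in at_top. dist (c t) z \<noteq> e)"
  obtains z where "(c \<longlongrightarrow> z) at_top"
proof -
  obtain K where K: "\<exists>\<^sub>F t in at_top. norm (c t) \<le> K"
  proof -
    have "\<not> (\<forall>r>0. \<forall>\<^sub>F x in at_top. r \<le> norm (c x))"
      using ninf filterlim_at_infinity[of 0 c at_top] by auto
    then obtain r where "\<not> (\<forall>\<^sub>F x in at_top. r \<le> norm (c x))" by auto
    then have "\<exists>\<^sub>F x in at_top. \<not> (r \<le> norm (c x))" by (simp add: frequently_def)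
    then have "\<exists>\<^sub>F x in at_top. norm (c x) \<le> r" by (rule frequently_elim1) auto
    then show ?thesis using that by blast
  qed
  have "\<forall>n::nat. \<exists>t\<ge>real n. norm (c t) \<le> K"
    using K by (auto simp: frequently_def eventually_at_top_linorder)
  then obtain s where s: "\<And>n::nat. s n \<ge> real n" "\<And>n. norm (c (s n)) \<le> K" by metis
  have "\<forall>n. (c \<circ> s) n \<in> cball 0 K" using s by auto
  then obtain z r where r: "strict_mono r" "(c \<circ> s \<circ> r) \<longlonglongrightarrow> z"
    using compact_cball[of 0 K] unfolding compact_def by metis
  have sr: "s (r n) \<ge> real n" for n
    using s(1)[of "r n"] seq_suble[OF r(1), of n] by linarith
  have freq: "\<exists>\<^sub>F t in at_top. dist (c t) z < e" if "e > 0" for e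
  proof -
    obtain N where N: "\<And>n. n \<ge> N \<Longrightarrow> dist ((c \<circ> s \<circ> r) n) z < e"
      using r(2) \<open>e > 0\<close> unfolding lim_sequentially by metis
    have "\<exists>t\<ge>T. dist (c t) z < e" for T
    proof -
      obtain n :: nat where n: "real n \<ge> T" "n \<ge> N"
        by (metis linorder_le_cases nat_le_real_less of_nat_le_iff order_trans real_arch_simple)
      show ?thesis using N[OF n(2)] sr[of n] n(1) by (intro exI[of _ "s (r n)"]) auto
    qed
    then show ?thesis by (force simp: frequently_def eventually_at_top_linorder)
  qed
  from avoid[OF freq] obtain e0 where e0: "e0 > 0"
    "\<And>e. 0 < e \<Longrightarrow> e < e0 \<Longrightarrow> \<forall>\<^sub>F t in at_top. dist (c t) z \<noteq> e" by metis
  \<comment> \<open>Past the time after which the curve misses a small sphere around the cluster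
    point, a visit to the ball inside is final, by the intermediate value theorem.\<close>
  have "(c \<longlongrightarrow> z) at_top"
  proof (rule tendstoI)
    fix e' :: real assume "e' > 0"
    define e where "e = min e' (e0/2)"
    have e: "0 < e" "e < e0" "e \<le> e'" using \<open>e' > 0\<close> e0(1) by (auto simp: e_def)
    obtain T where T: "\<And>t. t \<ge> T \<Longrightarrow> dist (c t) z \<noteq> e"
      using e0(2)[OF e(1,2)] by (auto simp: eventually_at_top_linorder)
    have "\<exists>t\<ge>max 0 T. dist (c t) z < e"
      using freq[OF e(1)] unfolding frequently_def eventually_at_top_linorder by metis
    then obtain t0 where t0: "t0 \<ge> max 0 T" "dist (c t0) z < e" by blast
    have "dist (c t) z < e" if "t \<ge> t0" for t
    proof (rule ccontr)
      assume "\<not> dist (c t) z < e"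
      moreover have "continuous_on {t0..t} (\<lambda>t. dist (c t) z)"
        by (intro continuous_intros continuous_on_subset[OF cont]) (use t0 in auto)
      ultimately obtain x where "x \<ge> t0" "dist (c x) z = e"
        using IVT'[of "\<lambda>t. dist (c t) z" t0 e t] t0 \<open>t \<ge> t0\<close> by force
      then show False using T[of x] t0(1) by auto
    qed
    then show "\<forall>\<^sub>F t in at_top. dist (c t) z < e'"
      using e(3) unfolding eventually_at_top_linorder by (meson less_le_trans)
  qed
  then show ?thesis using that by blast
qed

text \<open>\<open>f_0\<close> keeps the origin out of every tract whose pole is not 0
  (\<open>tract_map_nonzero\<close>), so that the charts have logarithms. It also holds when 0 is a
  pole, since \<open>f\<close> takes the value 0 there.\<close>

locale tracts =
  fixes f :: "complex \<Rightarrow> complex" and R :: real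
  assumes mero: "f nicely_meromorphic_on UNIV"
    and R_pos: "R > 0"
    and critical: "\<And>z. \<not> is_pole f z \<Longrightarrow> deriv f z = 0 \<Longrightarrow> norm (f z) \<le> R"
    and asymptotic: "\<And>w. finite_asymptotic_value f w \<Longrightarrow> norm w \<le> R"
    and not_infinite_asymptotic: "\<not> infinite_asymptotic_value f"
    and f_0: "norm (f 0) \<le> R"
begin

text \<open>A branch of the inverse of \<open>f\<close> composed with \<open>Q\<close>. With
  \<open>Q\<close> as a parameter the same notion serves the unit disc, where the continuation is
  done, and the half-plane, where \<open>Q\<close> is \<open>exp\<close>.\<close>

definition lifts :: "complex set \<Rightarrow> (complex \<Rightarrow> complex) \<Rightarrow> (complex \<Rightarrow> complex) \<Rightarrow> bool" where
  "lifts X Q g \<longleftrightarrow> g holomorphic_on X \<and> (\<forall>u\<in>X. \<not> is_pole f (g u) \<and> f (g u) = Q u)"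

lemma analytic: "\<not> is_pole f z \<Longrightarrow> f analytic_on {z}"
  using nicely_meromorphic_on_imp_analytic_at[OF mero] by auto

lemma sparse_poles: "{z. is_pole f z} sparse_in UNIV"
  using mero unfolding nicely_meromorphic_on_def
  by (meson meromorphic_on_isolated_singularity meromorphic_on_meromorphic_at not_islimpt_poles
      sparse_in_open open_UNIV)

lemma closed_poles: "closed {z. is_pole f z}"
  by (rule sparse_in_UNIV_imp_closed[OF sparse_poles])

lemma open_nonpoles: "open {z. \<not> is_pole f z}"
  using closed_poles by (simp add: open_closed Compl_eq)

lemma holomorphic: "f holomorphic_on {z. \<not> is_pole f z}"
  by (metis (no_types, lifting) analytic analytic_imp_holomorphic analytic_on_analytic_at mem_Collect_eq)

lemma isCont_f: "\<not> is_pole f z \<Longrightarrow> isCont f z"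
  using analytic analytic_at_imp_isCont by blast

lemma isolated_pole:
  assumes "is_pole f a"
  obtains e where "e > 0" "\<And>z. z \<in> cball a e \<Longrightarrow> z \<noteq> a \<Longrightarrow> \<not> is_pole f z"
proof -
  have "\<not> a islimpt {z. is_pole f z}"
    using sparse_poles by (simp add: sparse_in_def)
      (metis UNIV_I islimpt_subset open_UNIV sparse_in_open sparse_poles subset_refl)
  then obtain e where "e > 0" "\<And>z. z \<in> ball a e \<Longrightarrow> z \<noteq> a \<Longrightarrow> \<not> is_pole f z"
    unfolding islimpt_approachable by (auto simp: dist_commute)
  then show ?thesis by (intro that[of "e/2"]) auto
qed

lemma local_inverse:
  assumes "\<not> is_pole f z" "norm (f z) > R"
  obtains e \<eta> k where "e > 0" "\<eta> > 0" "k holomorphic_on ball (f z) \<eta>" "k (f z) = z"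
    "\<And>w. w \<in> ball (f z) \<eta> \<Longrightarrow> \<not> is_pole f (k w) \<and> f (k w) = w"
    "\<And>x. x \<in> ball z e \<Longrightarrow> f x \<in> ball (f z) \<eta> \<Longrightarrow> k (f x) = x"
    "inj_on f (ball z e)" "\<And>x. x \<in> ball z e \<Longrightarrow> \<not> is_pole f x"
proof -
  have d: "deriv f z \<noteq> 0" using critical assms by force
  obtain e where e: "e > 0" "ball z e \<subseteq> {z. \<not> is_pole f z}" "open (f ` ball z e)" "inj_on f (ball z e)"
    using has_complex_derivative_locally_invertible[OF holomorphic _ open_nonpoles d] assms by auto
  have hol: "f holomorphic_on ball z e" using holomorphic e(2) holomorphic_on_subset by blast
  obtain k where k: "k holomorphic_on f ` ball z e" "\<And>x. x \<in> ball z e \<Longrightarrow> k (f x) = x"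
    using holomorphic_has_inverse[OF hol open_ball e(4)] by metis
  obtain \<eta> where \<eta>: "\<eta> > 0" "ball (f z) \<eta> \<subseteq> f ` ball z e"
    using e(1,3) open_contains_ball by (metis centre_in_ball image_eqI)
  show ?thesis
  proof (rule that[of e \<eta> k])
    show "k holomorphic_on ball (f z) \<eta>" using k(1) \<eta>(2) holomorphic_on_subset by blast
    show "k (f z) = z" using k(2) e(1) by simp
    fix w assume "w \<in> ball (f z) \<eta>"
    then obtain x where "x \<in> ball z e" "w = f x" using \<eta>(2) by blast
    then show "\<not> is_pole f (k w) \<and> f (k w) = w" using k(2) e(2) by auto
  qed (use e \<eta> k in auto)
qed

lemma locally_injective:
  assumes "\<not> is_pole f z" "norm (f z) > R"
  obtains e where "e > 0" "inj_on f (ball z e)" "\<And>x. x \<in> ball z e \<Longrightarrow> \<not> is_pole f x"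
  by (rule local_inverse[OF assms]) (rule that)

lemma lift_unique:
  assumes X: "connected X" and g: "continuous_on X g" "continuous_on X g'"
    and f: "\<And>u. u \<in> X \<Longrightarrow> \<not> is_pole f (g u) \<and> norm (f (g u)) > R \<and> f (g' u) = f (g u)"
    and u0: "u0 \<in> X" "g u0 = g' u0" and u: "u \<in> X"
  shows "g u = g' u"
proof -
  define E where "E = {u\<in>X. g u = g' u}"
  have "closedin (top_of_set X) E"
  proof -
    have "E = {u\<in>X. g u - g' u = 0}" by (auto simp: E_def)
    moreover have "continuous_on X (\<lambda>u. g u - g' u)" by (intro continuous_intros g)
    ultimately show ?thesis using continuous_closedin_preimage_constant[of X "\<lambda>u. g u - g' u" 0] by simp
  qed
  moreover have "openin (top_of_set X) E"
  proof (subst openin_subopen, safe)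
    fix x assume "x \<in> E"
    then have x: "x \<in> X" "g x = g' x" by (auto simp: E_def)
    obtain e where e: "e > 0" "inj_on f (ball (g x) e)"
      using locally_injective f[OF x(1)] by blast
    define T where "T = (X \<inter> g -` ball (g x) e) \<inter> (X \<inter> g' -` ball (g x) e)"
    have "openin (top_of_set X) T" unfolding T_def
      using g by (intro openin_Int continuous_openin_preimage_gen) auto
    moreover have "x \<in> T" using x e by (auto simp: T_def)
    moreover have "T \<subseteq> E"
    proof
      fix y assume y: "y \<in> T"
      then have "g y \<in> ball (g x) e" "g' y \<in> ball (g x) e" "f (g y) = f (g' y)" "y \<in> X"
        using f by (auto simp: T_def)
      then show "y \<in> E" using e(2) by (auto simp: E_def inj_on_def)
    qed
    ultimately show "\<exists>T. openin (top_of_set X) T \<and> x \<in> T \<and> T \<subseteq> E" by blast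
  qed
  ultimately have "E = {} \<or> E = X" using X unfolding connected_clopen by blast
  then show ?thesis using u0 u by (auto simp: E_def)
qed

lemma lifts_unique:
  assumes "lifts X Q g" "lifts Y Q' g'" "connected Z" "Z \<subseteq> X" "Z \<subseteq> Y"
    "\<And>u. u \<in> Z \<Longrightarrow> Q' u = Q u" "\<And>u. u \<in> Z \<Longrightarrow> norm (Q u) > R"
    "u0 \<in> Z" "g u0 = g' u0" "u \<in> Z"
  shows "g u = g' u"
proof (rule lift_unique[of Z g g' u0])
  show "continuous_on Z g" "continuous_on Z g'"
    using assms unfolding lifts_def by (meson continuous_on_subset holomorphic_on_imp_continuous_on)+
  show "\<not> is_pole f (g u) \<and> norm (f (g u)) > R \<and> f (g' u) = f (g u)" if "u \<in> Z" for u
    using assms that unfolding lifts_def by (metis subset_iff)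
qed (use assms in auto)

text \<open>If the curve tended to infinity, \<open>w\<close> would be an asymptotic value of
  modulus above \<open>R\<close>. So there is a finite cluster point, and it is a preimage of
  \<open>w\<close>. The curve eventually misses small spheres around it, because \<open>f\<close> is
  injective nearby and hence stays away from \<open>w\<close> on them.\<close>

lemma curve_limit:
  fixes c :: "real \<Rightarrow> complex"
  assumes c: "continuous_on {0..} c" and np: "\<forall>\<^sub>F t in at_top. \<not> is_pole f (c t)"
    and lim: "((\<lambda>t. f (c t)) \<longlongrightarrow> w) at_top" and w: "norm w > R"
  obtains z where "(c \<longlongrightarrow> z) at_top" "\<not> is_pole f z" "f z = w"
proof -
  have ninf: "\<not> filterlim c at_infinity at_top"
  proof
    assume *: "filterlim c at_infinity at_top"
    have "finite_asymptotic_value f w"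
      unfolding finite_asymptotic_value_def curve_to_infinity_def
      by (intro exI[of _ c] conjI c * np lim)
    then show False using asymptotic w by force
  qed
  have cluster: "\<not> is_pole f z \<and> f z = w"
    if fr: "\<And>e. e > 0 \<Longrightarrow> \<exists>\<^sub>F t in at_top. dist (c t) z < e" for z
  proof -
    have bd: "\<exists>\<^sub>F t in at_top. dist (c t) z < e \<and> \<not> is_pole f (c t) \<and> dist (f (c t)) w < d" if "e > 0" "d > 0" for e d
      using fr[OF \<open>e > 0\<close>]
    proof (rule frequently_rev_mp)
      show "\<forall>\<^sub>F t in at_top. dist (c t) z < e \<longrightarrow>
              dist (c t) z < e \<and> \<not> is_pole f (c t) \<and> dist (f (c t)) w < d"
        using np tendstoD[OF lim \<open>d > 0\<close>] by eventually_elim auto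
    qed
    have np: "\<not> is_pole f z"
    proof
      assume "is_pole f z"
      then have "\<forall>\<^sub>F x in at z. norm (f x) \<ge> norm w + 1"
        unfolding is_pole_def using w R_pos by (auto simp: filterlim_at_infinity[of 0])
      then obtain d where d: "d > 0" "\<And>x. x \<noteq> z \<Longrightarrow> dist x z < d \<Longrightarrow> norm (f x) \<ge> norm w + 1"
        by (auto simp: eventually_at)
      have "\<exists>t. dist (c t) z < d \<and> \<not> is_pole f (c t) \<and> dist (f (c t)) w < 1"
        using bd[OF d(1), of 1] by (auto dest: frequently_ex)
      then obtain t where t: "dist (c t) z < d" "\<not> is_pole f (c t)" "dist (f (c t)) w < 1" by blast
      then have "norm (f (c t)) \<ge> norm w + 1" using d(2)[of "c t"] \<open>is_pole f z\<close> by auto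
      then show False using t(3) norm_triangle_ineq2[of "f (c t)" w] by (auto simp: dist_norm)
    qed
    moreover have "f z = w"
    proof (rule ccontr)
      assume "f z \<noteq> w"
      define d where "d = dist (f z) w / 2"
      have d: "d > 0" using \<open>f z \<noteq> w\<close> by (simp add: d_def)
      obtain e where e: "e > 0" "\<And>x. dist x z < e \<Longrightarrow> dist (f x) (f z) < d"
        using isCont_f[OF np] d unfolding continuous_at_eps_delta by metis
      obtain t where "dist (c t) z < e" "dist (f (c t)) w < d"
        using bd[OF e(1) d] by (auto dest: frequently_ex)
      then have "dist (f z) w < d + d"
        using e(2)[of "c t"] dist_triangle_le[of "f z" "f (c t)" w] by (smt (verit) dist_commute dist_triangle)
      then show False by (simp add: d_def)
    qed
    ultimately show ?thesis by simp
  qed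
  obtain z where z: "(c \<longlongrightarrow> z) at_top"
  proof (rule tendsto_of_avoiding_spheres[OF c ninf])
    fix z assume "\<And>e. e > 0 \<Longrightarrow> \<exists>\<^sub>F t in at_top. dist (c t) z < e"
    then have z: "\<not> is_pole f z" "f z = w" using cluster by auto
    obtain e0 where e0: "e0 > 0" "inj_on f (ball z e0)" "\<And>x. x \<in> ball z e0 \<Longrightarrow> \<not> is_pole f x"
      using locally_injective[of z] z w by blast
    show "\<exists>e0>0. \<forall>e. 0 < e \<longrightarrow> e < e0 \<longrightarrow> (\<forall>\<^sub>F t in at_top. dist (c t) z \<noteq> e)"
    proof (intro exI[of _ e0] conjI allI impI)
      fix e assume e: "0 < e" "e < e0"
      have "closed (f ` sphere z e)"
        using e0(3) e by (intro compact_imp_closed compact_continuous_image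
            continuous_at_imp_continuous_on ballI isCont_f) auto
      moreover have "w \<notin> f ` sphere z e"
      proof
        assume "w \<in> f ` sphere z e"
        then obtain x where "x \<in> sphere z e" "f x = f z" using z by auto
        then show False using inj_onD[OF e0(2), of x z] e e0(1) by auto
      qed
      ultimately have "open (- f ` sphere z e)" "w \<in> - f ` sphere z e" by auto
      from topological_tendstoD[OF lim this] show "\<forall>\<^sub>F t in at_top. dist (c t) z \<noteq> e"
        by eventually_elim (auto simp: dist_commute)
    qed (use e0 in auto)
  qed blast
  have "\<not> is_pole f z \<and> f z = w"
    by (rule cluster) (intro eventually_frequently tendstoD[OF z], auto)
  then show ?thesis using that z by blast
qed

text \<open>The analogue for the value infinity, which is not an asymptotic value: cluster points
  are now poles, and small spheres around a pole are missed because \<open>f\<close> is bounded on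
  them.\<close>

lemma curve_limit_pole:
  fixes c :: "real \<Rightarrow> complex"
  assumes c: "continuous_on {0..} c" and lim: "filterlim (\<lambda>t. f (c t)) at_infinity at_top"
  obtains a where "(c \<longlongrightarrow> a) at_top" "is_pole f a"
proof -
  have big: "\<forall>\<^sub>F t in at_top. norm (f (c t)) > K" for K
    using filterlim_at_infinity_imp_norm_at_top[OF lim] by (simp add: filterlim_at_top_dense)
  have ninf: "\<not> filterlim c at_infinity at_top"
  proof
    assume *: "filterlim c at_infinity at_top"
    have **: "\<forall>\<^sub>F t in at_top. is_pole f (c t) \<or> norm (f (c t)) > K" for K
      using big[of K] by eventually_elim auto
    have "infinite_asymptotic_value f"
      unfolding infinite_asymptotic_value_def curve_to_infinity_def
      by (intro exI[of _ c] conjI allI c * **)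
    then show False using not_infinite_asymptotic by simp
  qed
  have cluster: "is_pole f z"
    if fr: "\<And>e. e > 0 \<Longrightarrow> \<exists>\<^sub>F t in at_top. dist (c t) z < e" for z
  proof (rule ccontr)
    assume np: "\<not> is_pole f z"
    obtain e where e: "e > 0" "\<And>x. dist x z < e \<Longrightarrow> dist (f x) (f z) < 1"
      using isCont_f[OF np] unfolding continuous_at_eps_delta by (metis zero_less_one)
    have "\<exists>\<^sub>F t in at_top. dist (c t) z < e \<and> norm (f (c t)) > norm (f z) + 1"
      using fr[OF e(1)]
    proof (rule frequently_rev_mp)
      show "\<forall>\<^sub>F t in at_top. dist (c t) z < e \<longrightarrow> dist (c t) z < e \<and> norm (f (c t)) > norm (f z) + 1"
        using big[of "norm (f z) + 1"] by eventually_elim auto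
    qed
    then obtain t where "dist (c t) z < e" "norm (f (c t)) > norm (f z) + 1" by (auto dest: frequently_ex)
    then show False using e(2)[of "c t"] norm_triangle_ineq2[of "f (c t)" "f z"] by (auto simp: dist_norm)
  qed
  obtain z where z: "(c \<longlongrightarrow> z) at_top"
  proof (rule tendsto_of_avoiding_spheres[OF c ninf])
    fix z assume "\<And>e. e > 0 \<Longrightarrow> \<exists>\<^sub>F t in at_top. dist (c t) z < e"
    then have z: "is_pole f z" using cluster by auto
    obtain e0 where e0: "e0 > 0" "\<And>x. x \<in> cball z e0 \<Longrightarrow> x \<noteq> z \<Longrightarrow> \<not> is_pole f x"
      using isolated_pole[OF z] by metis
    show "\<exists>e0>0. \<forall>e. 0 < e \<longrightarrow> e < e0 \<longrightarrow> (\<forall>\<^sub>F t in at_top. dist (c t) z \<noteq> e)"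
    proof (intro exI[of _ e0] conjI allI impI)
      fix e assume e: "0 < e" "e < e0"
      have "compact (f ` sphere z e)"
        using e0(2) e by (intro compact_continuous_image
            continuous_at_imp_continuous_on ballI isCont_f) (auto simp: dist_commute)
      then have "bounded (f ` sphere z e)" by (rule compact_imp_bounded)
      then obtain K where K: "\<And>x. x \<in> sphere z e \<Longrightarrow> norm (f x) \<le> K"
        unfolding bounded_iff by blast
      from big[of K] show "\<forall>\<^sub>F t in at_top. dist (c t) z \<noteq> e"
        by eventually_elim (use K in \<open>force simp: dist_commute\<close>)
    qed (use e0 in auto)
  qed blast
  have "is_pole f z"
    by (rule cluster) (intro eventually_frequently tendstoD[OF z], auto)
  then show ?thesis using that z by blast
qed


text \<open>The lift along the radius ending at \<open>b\<close> converges by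
  \<open>curve_limit\<close>, and the local inverse of \<open>f\<close> at the limit continues it
  across \<open>b\<close>.\<close>

lemma lift_extend_at_boundary_point:
  assumes Q: "Q holomorphic_on ball 0 1" and QR: "\<And>u. u \<in> ball 0 1 \<Longrightarrow> norm (Q u) > R"
    and t: "0 < t" "t < 1" and g: "lifts (ball 0 t) Q g" and b: "b \<in> sphere 0 t"
  obtains \<epsilon> K where "\<epsilon> > 0" "ball b \<epsilon> \<subseteq> ball 0 1" "lifts (ball b \<epsilon>) Q K"
    "\<And>u. u \<in> ball b \<epsilon> \<inter> ball 0 t \<Longrightarrow> K u = g u"
proof -
  have nb: "norm b = t" using b by simp
  \<comment> \<open>The radius from 0 to \<open>b\<close>, parametrised by [0, infinity) as
    \<open>curve_limit\<close> requires.\<close>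
  define p where "p s = complex_of_real (s / (1 + s)) * b" for s :: real
  have p_in: "p s \<in> ball 0 t" if "s \<ge> 0" for s
  proof -
    have "norm (p s) = s / (1 + s) * t" using that nb
      by (simp only: p_def norm_mult norm_of_real) (simp add: abs_of_nonneg)
    also have "\<dots> < 1 * t" using that t by (intro mult_strict_right_mono) (auto simp: field_simps)
    finally show ?thesis by simp
  qed
  have p_cont: "continuous_on {0..} p" unfolding p_def
    by (intro continuous_intros) auto
  have "((\<lambda>s::real. s / (1 + s)) \<longlongrightarrow> 1) at_top" by real_asymp
  then have "((\<lambda>s. complex_of_real (s / (1 + s)) * b) \<longlongrightarrow> complex_of_real 1 * b) at_top"
    by (intro tendsto_intros)
  then have p_lim: "(p \<longlongrightarrow> b) at_top" unfolding p_def[abs_def] by simp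
  have b1: "b \<in> ball 0 1" using nb t by simp
  have Qb: "isCont Q b" using Q b1 open_ball
    by (metis analytic_at analytic_at_imp_isCont)
  define c where "c s = g (p s)" for s
  have g_cont: "continuous_on (ball 0 t) g"
    using g by (simp add: lifts_def holomorphic_on_imp_continuous_on)
  have c: "continuous_on {0..} c" unfolding c_def
    by (rule continuous_on_compose2[OF g_cont p_cont]) (use p_in in auto)
  have cf: "\<not> is_pole f (c s) \<and> f (c s) = Q (p s)" if "s \<ge> 0" for s
    using g p_in[OF that] by (simp add: lifts_def c_def)
  have ev: "\<forall>\<^sub>F s::real in at_top. s \<ge> 0" by (rule eventually_ge_at_top)
  have "((\<lambda>s. Q (p s)) \<longlongrightarrow> Q b) at_top" by (rule isCont_tendsto_compose[OF Qb p_lim])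
  then have lim: "((\<lambda>s. f (c s)) \<longlongrightarrow> Q b) at_top"
    by (rule Lim_transform_eventually) (use ev in eventually_elim, simp add: cf)
  have np: "\<forall>\<^sub>F s in at_top. \<not> is_pole f (c s)" using ev by eventually_elim (simp add: cf)
  obtain z where z: "(c \<longlongrightarrow> z) at_top" "\<not> is_pole f z" "f z = Q b"
    by (rule curve_limit[OF c np lim QR[OF b1]])
  have "norm (f z) > R" using z QR b1 by simp
  from local_inverse[OF z(2) this] obtain e \<eta> k where k: "e > 0" "\<eta> > 0"
    "k holomorphic_on ball (f z) \<eta>" "k (f z) = z"
    "\<And>w. w \<in> ball (f z) \<eta> \<Longrightarrow> \<not> is_pole f (k w) \<and> f (k w) = w"
    "\<And>x. x \<in> ball z e \<Longrightarrow> f x \<in> ball (f z) \<eta> \<Longrightarrow> k (f x) = x"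
    by metis
  obtain \<epsilon>1 where \<epsilon>1: "\<epsilon>1 > 0" "\<And>u. dist u b < \<epsilon>1 \<Longrightarrow> dist (Q u) (Q b) < \<eta>"
    using Qb k(2) unfolding continuous_at_eps_delta by metis
  define \<epsilon> where "\<epsilon> = min \<epsilon>1 (1 - t)"
  have \<epsilon>: "\<epsilon> > 0" using \<epsilon>1 t by (simp add: \<epsilon>_def)
  have sub: "ball b \<epsilon> \<subseteq> ball 0 1"
    using nb min.cobounded2[of \<epsilon>1 "1 - t"] by (simp add: ball_subset_ball_iff flip: \<epsilon>_def)
  have Qin: "Q u \<in> ball (f z) \<eta>" if "u \<in> ball b \<epsilon>" for u
    using \<epsilon>1(2)[of u] that z by (simp add: \<epsilon>_def dist_commute)
  have K: "lifts (ball b \<epsilon>) Q (\<lambda>u. k (Q u))"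
    unfolding lifts_def
  proof (intro conjI ballI)
    have "Q ` ball b \<epsilon> \<subseteq> ball (f z) \<eta>" using Qin by blast
    then show "(\<lambda>u. k (Q u)) holomorphic_on ball b \<epsilon>"
      using holomorphic_on_compose_gen[OF holomorphic_on_subset[OF Q sub] k(3)] by (simp add: o_def)
  qed (use k(5) Qin in auto)
  have "\<forall>\<^sub>F s in at_top. s \<ge> 0 \<and> dist (p s) b < \<epsilon> \<and> dist (c s) z < e"
    using ev tendstoD[OF p_lim \<epsilon>] tendstoD[OF z(1) k(1)] by eventually_elim auto
  then obtain s where s: "s \<ge> 0" "dist (p s) b < \<epsilon>" "dist (c s) z < e"
    by (auto dest: eventually_happens)
  have ps: "p s \<in> ball b \<epsilon> \<inter> ball 0 t" using s(2) p_in[OF s(1)] by (simp add: dist_commute)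
  have "k (Q (p s)) = g (p s)"
    using k(6)[of "c s"] s(3) cf[OF s(1)] Qin[of "p s"] ps by (simp add: dist_commute c_def)
  moreover have "k (Q u) = g u" if "u \<in> ball b \<epsilon> \<inter> ball 0 t" for u
    by (rule lifts_unique[OF K g, of "ball b \<epsilon> \<inter> ball 0 t" "p s"])
       (use that ps calculation sub QR in \<open>auto intro!: convex_connected convex_Int\<close>)
  ultimately show ?thesis using that[OF \<epsilon> sub K] by blast
qed

text \<open>Compactness of the closed disc turns the local extensions across its boundary into one
  extension to a larger disc, once they are known to agree on overlaps.\<close>

lemma lift_extend:
  assumes Q: "Q holomorphic_on ball 0 1" and QR: "\<And>u. u \<in> ball 0 1 \<Longrightarrow> norm (Q u) > R"
    and t: "0 < t" "t < 1" and g: "lifts (ball 0 t) Q g"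
  obtains t' g' where "t' > t" "t' \<le> 1" "lifts (ball 0 t') Q g'" "g' 0 = g 0"
proof -
  have "\<forall>b\<in>sphere 0 t. \<exists>\<epsilon> K. \<epsilon> > 0 \<and> ball b \<epsilon> \<subseteq> ball 0 1 \<and> lifts (ball b \<epsilon>) Q K \<and>
      (\<forall>u \<in> ball b \<epsilon> \<inter> ball 0 t. K u = g u)"
    using lift_extend_at_boundary_point[OF Q QR t g] by metis
  then obtain \<epsilon> K where "\<forall>b\<in>sphere 0 t. \<epsilon> b > 0 \<and> ball b (\<epsilon> b) \<subseteq> ball 0 1 \<and> lifts (ball b (\<epsilon> b)) Q (K b) \<and>
      (\<forall>u \<in> ball b (\<epsilon> b) \<inter> ball 0 t. K b u = g u)" unfolding bchoice_iff by blast
  then have \<epsilon>: "\<epsilon> b > 0" "ball b (\<epsilon> b) \<subseteq> ball 0 1" "lifts (ball b (\<epsilon> b)) Q (K b)"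
    "\<And>u. u \<in> ball b (\<epsilon> b) \<inter> ball 0 t \<Longrightarrow> K b u = g u" if "b \<in> sphere 0 t" for b
    using that by blast+
  have agree: "K b u = K b' u"
    if b: "b \<in> sphere 0 t" "b' \<in> sphere 0 t" and u: "u \<in> ball b (\<epsilon> b)" "u \<in> ball b' (\<epsilon> b')" for b b' u
  proof (cases "b = b'")
    case False
    define d where "d = dist b b'"
    have d: "d > 0" "d < \<epsilon> b + \<epsilon> b'" using False u dist_triangle[of b b' u]
      by (auto simp: d_def dist_commute)
    \<comment> \<open>Dividing the chord from \<open>b\<close> to \<open>b'\<close> in the ratio of
      the two radii gives a point of both balls. It lies in the open disc, where both extensions
      equal \<open>g\<close>.\<close>
    obtain l where l: "0 < l" "l < 1" "l * d < \<epsilon> b" "(1 - l) * d < \<epsilon> b'"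
    proof
      define l where "l = \<epsilon> b / (\<epsilon> b + \<epsilon> b')"
      have e: "\<epsilon> b > 0" "\<epsilon> b' > 0" using \<epsilon>(1) b by auto
      show "0 < l" "l < 1" using e by (auto simp: l_def field_simps)
      show "l * d < \<epsilon> b" using mult_strict_left_mono[OF d(2) \<open>0 < l\<close>] e by (simp add: l_def)
      have "1 - l = \<epsilon> b' / (\<epsilon> b + \<epsilon> b')" using e by (simp add: l_def field_simps)
      then show "(1 - l) * d < \<epsilon> b'"
        using mult_strict_left_mono[OF d(2), of "1 - l"] \<open>l < 1\<close> e by simp
    qed
    define p where "p = (1 - l) *\<^sub>R b + l *\<^sub>R b'"
    have "p \<in> open_segment b b'" using l False by (auto simp: in_segment p_def)
    from dist_decreases_open_segment[OF this, of 0] have pt: "p \<in> ball 0 t" using b by auto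
    have "b - p = l *\<^sub>R (b - b')" "b' - p = (1 - l) *\<^sub>R (b' - b)"
      by (simp_all add: p_def algebra_simps)
    then have pb: "p \<in> ball b (\<epsilon> b)" "p \<in> ball b' (\<epsilon> b')"
      using l by (auto simp: dist_norm d_def norm_minus_commute)
    have Kp: "K b p = K b' p" using \<epsilon>(4) b pb pt by simp
    have Qv: "norm (Q v) > R" if "v \<in> ball b (\<epsilon> b) \<inter> ball b' (\<epsilon> b')" for v
      using QR \<epsilon>(2)[OF b(1)] that by blast
    show ?thesis
    proof (rule lifts_unique[OF \<epsilon>(3)[OF b(1)] \<epsilon>(3)[OF b(2)] _ _ _ _ Qv _ Kp])
      show "connected (ball b (\<epsilon> b) \<inter> ball b' (\<epsilon> b'))"
        by (intro convex_connected convex_Int convex_ball)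
    qed (use pb u in auto)
  qed simp
  define G where "G u = (if u \<in> ball 0 t then g u
      else K (SOME b. b \<in> sphere 0 t \<and> u \<in> ball b (\<epsilon> b)) u)" for u
  have GK: "G u = K b u" if b: "b \<in> sphere 0 t" "u \<in> ball b (\<epsilon> b)" for b u
  proof (cases "u \<in> ball 0 t")
    case True then show ?thesis using \<epsilon>(4)[OF b(1)] b by (simp add: G_def)
  next
    case False
    define b' where "b' = (SOME b. b \<in> sphere 0 t \<and> u \<in> ball b (\<epsilon> b))"
    have "b' \<in> sphere 0 t \<and> u \<in> ball b' (\<epsilon> b')"
      unfolding b'_def by (rule someI[of _ b]) (use b in blast)
    then have "K b' u = K b u" using agree b by blast
    then show ?thesis using False unfolding G_def b'_def by argo
  qed
  define S where "S = ball 0 t \<union> (\<Union>b\<in>sphere 0 t. ball b (\<epsilon> b))"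
  have "open S" by (auto simp: S_def)
  have "cball 0 t \<subseteq> S"
  proof
    fix u :: complex assume "u \<in> cball 0 t"
    then show "u \<in> S" using \<epsilon>(1)[of u] by (cases "norm u = t") (auto simp: S_def intro!: bexI[of _ u])
  qed
  then obtain d where d: "d > 0" "(\<Union>x\<in>cball 0 t. ball x d) \<subseteq> S"
    using compact_subset_open_imp_ball_epsilon_subset[OF compact_cball \<open>open S\<close>] by metis
  define t' where "t' = min 1 (t + d)"
  have t': "t' > t" "t' \<le> 1" using t d by (auto simp: t'_def)
  have sub: "ball 0 t' \<subseteq> S"
  proof
    fix u :: complex assume u: "u \<in> ball 0 t'"
    show "u \<in> S"
    proof (cases "norm u < t")
      case False
      then have nu: "norm u \<ge> t" "norm u < t + d" "norm u > 0" using u t by (auto simp: t'_def)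
      define x where "x = (t / norm u) *\<^sub>R u"
      have x: "x \<in> cball 0 t" using nu t by (simp add: x_def)
      have "u - x = (1 - t / norm u) *\<^sub>R u" by (simp add: x_def algebra_simps)
      then have "norm (u - x) = \<bar>1 - t / norm u\<bar> * norm u" by (simp only: norm_scaleR)
      also have "\<dots> = norm u - t" using nu by (simp add: abs_of_nonneg left_diff_distrib)
      finally have "u \<in> ball x d" using nu by (simp add: dist_norm norm_minus_commute)
      then show ?thesis using d(2) x by blast
    qed (auto simp: S_def)
  qed
  have "lifts (ball 0 t') Q G"
    unfolding lifts_def
  proof (intro conjI)
    have "G holomorphic_on S"
      unfolding S_def
    proof (rule holomorphic_on_Un)
      show "G holomorphic_on ball 0 t"
        by (rule holomorphic_transform[of g]) (use g in \<open>auto simp: lifts_def G_def\<close>)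
      show "G holomorphic_on (\<Union>b\<in>sphere 0 t. ball b (\<epsilon> b))"
      proof (rule holomorphic_on_UN_open)
        fix b :: complex assume b: "b \<in> sphere 0 t"
        show "G holomorphic_on ball b (\<epsilon> b)"
          by (rule holomorphic_transform[of "K b"]) (use \<epsilon>(3)[OF b] GK[OF b] in \<open>auto simp: lifts_def\<close>)
      qed auto
    qed auto
    then show "G holomorphic_on ball 0 t'" using sub holomorphic_on_subset by blast
    show "\<forall>u\<in>ball 0 t'. \<not> is_pole f (G u) \<and> f (G u) = Q u"
    proof
      fix u :: complex assume "u \<in> ball 0 t'"
      then have "u \<in> S" using sub by blast
      then consider "u \<in> ball 0 t" | b :: complex where "b \<in> sphere 0 t" "u \<in> ball b (\<epsilon> b)" by (auto simp: S_def)
      then show "\<not> is_pole f (G u) \<and> f (G u) = Q u"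
      proof cases
        case 1 then show ?thesis using g by (auto simp: G_def lifts_def)
      next
        case 2 then show ?thesis using GK[OF 2] \<epsilon>(3)[OF 2(1)] by (auto simp: lifts_def)
      qed
    qed
  qed
  moreover have "G 0 = g 0" using t by (simp add: G_def)
  ultimately show ?thesis using that t' by blast
qed

text \<open>Lifts on smaller concentric discs fit together on the disc of supremal radius, and
  \<open>lift_extend\<close> excludes a supremum below 1.\<close>

lemma lift_disc:
  assumes Q: "Q holomorphic_on ball 0 1" and QR: "\<And>u. u \<in> ball 0 1 \<Longrightarrow> norm (Q u) > R"
    and z: "\<not> is_pole f z" "f z = Q 0"
  obtains g where "lifts (ball 0 1) Q g" "g 0 = z"
proof -
  define T where "T = {t. 0 < t \<and> t \<le> 1 \<and> (\<exists>g. lifts (ball 0 t) Q g \<and> g 0 = z)}"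
  have "\<exists>t. t \<in> T"
  proof -
    have "norm (f z) > R" using z QR[of 0] by simp
    from local_inverse[OF z(1) this] obtain \<eta> k where k: "\<eta> > 0"
      "k holomorphic_on ball (f z) \<eta>" "k (f z) = z"
      "\<And>w. w \<in> ball (f z) \<eta> \<Longrightarrow> \<not> is_pole f (k w) \<and> f (k w) = w"
      by metis
    have "isCont Q 0" using Q by (metis analytic_at analytic_at_imp_isCont centre_in_ball open_ball zero_less_one)
    then obtain e where e: "e > 0" "\<And>u. dist u 0 < e \<Longrightarrow> dist (Q u) (Q 0) < \<eta>"
      using k(1) unfolding continuous_at_eps_delta by metis
    define t where "t = min e 1"
    have Qin: "Q u \<in> ball (f z) \<eta>" if "u \<in> ball 0 t" for u
      using e(2)[of u] that z by (simp add: t_def dist_commute)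
    have "Q holomorphic_on ball 0 t" using Q by (rule holomorphic_on_subset) (auto simp: t_def)
    moreover have "Q ` ball 0 t \<subseteq> ball (f z) \<eta>" using Qin by blast
    ultimately have "(\<lambda>u. k (Q u)) holomorphic_on ball 0 t"
      using holomorphic_on_compose_gen[OF _ k(2), of Q "ball 0 t"] by (simp add: o_def)
    then have "lifts (ball 0 t) Q (\<lambda>u. k (Q u))" using k(4) Qin by (auto simp: lifts_def)
    moreover have "k (Q 0) = z" using k(3) z(2) by simp
    ultimately have "t \<in> T" using e(1) by (auto simp: T_def t_def)
    then show ?thesis ..
  qed
  then have ne: "T \<noteq> {}" by auto
  have bdd: "bdd_above T" by (auto simp: T_def)
  define t where "t = Sup T"
  have t: "0 < t" "t \<le> 1"
  proof -
    from ne obtain x where x: "x \<in> T" by auto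
    then show "0 < t" using cSup_upper[OF x bdd] by (auto simp: T_def t_def)
    show "t \<le> 1" unfolding t_def by (rule cSup_least[OF ne]) (auto simp: T_def)
  qed
  have "\<exists>s g. norm u < t \<longrightarrow> norm u < s \<and> s \<le> t \<and> lifts (ball 0 s) Q g \<and> g 0 = z" for u :: complex
  proof (cases "norm u < t")
    case nu: True
    obtain s where s: "s \<in> T" "norm u < s"
      by (rule less_cSupE[OF nu[unfolded t_def] ne])
    have "s \<le> t" unfolding t_def by (rule cSup_upper[OF s(1) bdd])
    moreover obtain g where "lifts (ball 0 s) Q g" "g 0 = z" using s(1) unfolding T_def by blast
    ultimately show ?thesis using s(2) by blast
  qed simp
  then have "\<forall>u::complex. \<exists>s g. norm u < t \<longrightarrow> norm u < s \<and> s \<le> t \<and> lifts (ball 0 s) Q g \<and> g 0 = z" by simp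
  then obtain s g where sg: "\<And>u::complex. norm u < t \<Longrightarrow> norm u < s u \<and> s u \<le> t \<and> lifts (ball 0 (s u)) Q (g u) \<and> g u 0 = z"
    unfolding choice_iff by blast
  define G where "G u = g u u" for u
  have G: "G v = g u v" if "norm u < t" "norm v < s u" for u v
  proof -
    have v: "norm v < t" using sg[OF that(1)] that(2) by simp
    show ?thesis unfolding G_def
      by (rule lifts_unique[of "ball 0 (s v)" Q "g v" "ball 0 (s u)" Q "g u" "ball 0 (s v) \<inter> ball 0 (s u)" 0])
        (use sg[OF that(1)] sg[OF v] that QR t in \<open>auto intro!: convex_connected convex_Int le_less_trans[OF norm_ge_zero]\<close>)
  qed
  have L: "lifts (ball 0 t) Q G" unfolding lifts_def
  proof (intro conjI ballI)
    have "G holomorphic_on (\<Union>u\<in>ball 0 t. ball 0 (s u))"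
    proof (rule holomorphic_on_UN_open)
      fix u :: complex assume u: "u \<in> ball 0 t"
      show "G holomorphic_on ball 0 (s u)"
        by (rule holomorphic_transform[of "g u"]) (use sg[of u] G[of u] u in \<open>auto simp: lifts_def\<close>)
    qed auto
    moreover have "ball (0::complex) t \<subseteq> (\<Union>u\<in>ball 0 t. ball 0 (s u))"
    proof
      fix v :: complex assume "v \<in> ball 0 t"
      then show "v \<in> (\<Union>u\<in>ball 0 t. ball 0 (s u))" using sg[of v] by (intro UN_I[of v]) auto
    qed
    ultimately show "G holomorphic_on ball 0 t" using holomorphic_on_subset by blast
    fix u :: complex assume u: "u \<in> ball 0 t"
    then show "\<not> is_pole f (G u)" "f (G u) = Q u" using sg[of u] by (auto simp: G_def lifts_def)
  qed
  have G0: "G 0 = z" using sg[of 0] t by (simp add: G_def)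
  have "t = 1"
  proof (rule ccontr)
    assume "t \<noteq> 1"
    then obtain t' g' where t': "t' > t" "t' \<le> 1" "lifts (ball 0 t') Q g'" "g' 0 = G 0"
      using lift_extend[OF Q QR t(1) _ L] t by (metis order_le_less)
    then have "t' \<in> T" using t G0 by (auto simp: T_def)
    then show False using cSup_upper[OF _ bdd, of t'] t' by (simp add: t_def)
  qed
  then show ?thesis using that L G0 by blast
qed

end

section \<open>Charts of the tracts\<close>

lemma exp_diff_period:
  fixes x y :: complex
  assumes "exp x = exp y"
  obtains k :: int where "x = y + 2 * of_int k * of_real pi * \<i>"
proof -
  from assms obtain k :: int where "x = y + (of_int (2 * k) * pi) * \<i>" by (auto simp: exp_eq)
  then show ?thesis using that[of k] by simp
qed

context tracts begin

definition halfplane :: "complex set" where "halfplane = {\<zeta>. Re \<zeta> > ln R}"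

text \<open>This is R^(-1/m), the radius for which u^-m maps the punctured disc onto |w| >
  R.\<close>

definition rad :: "nat \<Rightarrow> real" where "rad m = exp (- ln R / m)"

abbreviation radius :: "complex \<Rightarrow> real" where "radius a \<equiv> rad (pole_mult f a)"

text \<open>\<open>\<Psi>\<close> inverts an m-th root of 1/f on the tract around \<open>a\<close>.
  It is determined only up to a rotation of \<open>u\<close> by an m-th root of unity, hence the
  choice in \<open>tract_map\<close>.\<close>

definition chart :: "complex \<Rightarrow> (complex \<Rightarrow> complex) \<Rightarrow> bool" where
  "chart a \<Psi> \<longleftrightarrow> is_pole f a \<and> pole_mult f a \<ge> 1 \<and> \<Psi> 0 = a \<and>
     \<Psi> holomorphic_on ball 0 (radius a) \<and> inj_on \<Psi> (ball 0 (radius a)) \<and>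
     (\<forall>u\<in>ball 0 (radius a) - {0}. \<not> is_pole f (\<Psi> u) \<and> f (\<Psi> u) * u ^ pole_mult f a = 1)"

lemma rad_pos [simp]: "rad m > 0"
  by (simp add: rad_def)

lemma convex_halfplane: "convex halfplane"
  by (simp add: halfplane_def convex_halfspace_Re_gt)

lemma halfplane_norm_exp: "\<zeta> \<in> halfplane \<Longrightarrow> norm (exp \<zeta>) > R"
  using R_pos by (simp add: halfplane_def) (metis exp_less_cancel_iff exp_ln)

text \<open>The half-plane is conformally a disc, so \<open>lift_disc\<close> applies after a change
  of variable.\<close>

lemma lift_halfplane:
  assumes z: "\<not> is_pole f z" "f z = exp \<zeta>0" and \<zeta>0: "\<zeta>0 \<in> halfplane"
  obtains G where "lifts halfplane exp G" "G \<zeta>0 = z"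
proof -
  define \<alpha> where "\<alpha> = Re \<zeta>0 - ln R"
  have \<alpha>: "\<alpha> > 0" using \<zeta>0 by (simp add: \<alpha>_def halfplane_def)
  \<comment> \<open>The Moebius map of the unit disc onto the half-plane that takes 0 to
    \<open>\<zeta>0\<close>, whose distance from the boundary is \<open>\<alpha>\<close>. The
    inverse map is \<open>W\<close> below.\<close>
  define M where "M u = \<zeta>0 + 2 * of_real \<alpha> * (u / (1 - u))" for u :: complex
  have Mh: "M u \<in> halfplane" if "u \<in> ball 0 1" for u
  proof -
    have u: "norm u < 1" using that by simp
    then have ne: "1 - u \<noteq> 0" by auto
    have "(norm u)\<^sup>2 < 1" using u by (simp add: power_less_one_iff)
    then have n2: "(Re u)\<^sup>2 + (Im u)\<^sup>2 < 1" by (simp add: cmod_power2)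
    have p: "(1 - Re u)\<^sup>2 + (Im u)\<^sup>2 > 0"
      using ne by (simp add: complex_eq_iff sum_power2_gt_zero_iff)
    have "Re (u / (1 - u)) = (Re u * (1 - Re u) - (Im u)\<^sup>2) / ((1 - Re u)\<^sup>2 + (Im u)\<^sup>2)"
      by (simp add: Re_divide power2_eq_square)
    also have "\<dots> > - 1 / 2"
      using p n2 by (simp add: divide_simps power2_eq_square algebra_simps)
    finally have "\<alpha> * (2 * Re (u / (1 - u))) > \<alpha> * (- 1)"
      using \<alpha> by (intro mult_strict_left_mono) auto
    moreover have "Re (M u) = Re \<zeta>0 + \<alpha> * (2 * Re (u / (1 - u)))"
      unfolding M_def by (simp del: times_divide_eq_right)
    ultimately show ?thesis by (simp add: halfplane_def \<alpha>_def)
  qed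
  have "(\<lambda>u. exp (M u)) holomorphic_on ball 0 1"
    unfolding M_def by (intro holomorphic_intros) auto
  moreover have "norm (exp (M u)) > R" if "u \<in> ball 0 1" for u
    using Mh[OF that] halfplane_norm_exp by blast
  moreover have "f z = exp (M 0)" using z by (simp add: M_def)
  ultimately obtain g where g: "lifts (ball 0 1) (\<lambda>u. exp (M u)) g" "g 0 = z"
    using lift_disc[of "\<lambda>u. exp (M u)" z] z(1) by blast
  define W where "W \<zeta> = (\<zeta> - \<zeta>0) / (\<zeta> - \<zeta>0 + 2 * of_real \<alpha>)" for \<zeta>
  have den: "\<zeta> - \<zeta>0 + 2 * of_real \<alpha> \<noteq> 0" if "\<zeta> \<in> halfplane" for \<zeta>
  proof
    assume "\<zeta> - \<zeta>0 + 2 * of_real \<alpha> = 0"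
    then have "Re (\<zeta> - \<zeta>0 + 2 * of_real \<alpha>) = 0" by simp
    then show False using that \<alpha> by (simp add: halfplane_def \<alpha>_def)
  qed
  have W1: "W \<zeta> \<in> ball 0 1" if "\<zeta> \<in> halfplane" for \<zeta>
  proof -
    have "Re (\<zeta> - \<zeta>0) > - \<alpha>" using that by (simp add: halfplane_def \<alpha>_def)
    then have "\<alpha> * (Re (\<zeta> - \<zeta>0) + \<alpha>) > 0" using \<alpha> by simp
    then have "(norm (\<zeta> - \<zeta>0))\<^sup>2 < (norm (\<zeta> - \<zeta>0 + 2 * of_real \<alpha>))\<^sup>2"
      unfolding cmod_power2 by (simp add: power2_eq_square algebra_simps)
    then have "norm (\<zeta> - \<zeta>0) < norm (\<zeta> - \<zeta>0 + 2 * of_real \<alpha>)"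
      by (rule power2_less_imp_less) simp
    then show ?thesis using den[OF that] by (simp add: W_def norm_divide)
  qed
  have MW: "M (W \<zeta>) = \<zeta>" if "\<zeta> \<in> halfplane" for \<zeta>
  proof -
    have "1 - W \<zeta> = 2 * of_real \<alpha> / (\<zeta> - \<zeta>0 + 2 * of_real \<alpha>)"
      using den[OF that] by (simp add: W_def field_simps)
    then have "W \<zeta> / (1 - W \<zeta>) = (\<zeta> - \<zeta>0) / (2 * of_real \<alpha>)"
      using den[OF that] \<alpha> by (simp add: W_def)
    then show ?thesis using \<alpha> by (simp add: M_def)
  qed
  have "lifts halfplane exp (\<lambda>\<zeta>. g (W \<zeta>))"
    unfolding lifts_def
  proof (intro conjI ballI)
    have "W holomorphic_on halfplane" unfolding W_def
      by (intro holomorphic_intros) (use den in auto)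
    moreover have "W ` halfplane \<subseteq> ball 0 1" using W1 by blast
    ultimately show "(\<lambda>\<zeta>. g (W \<zeta>)) holomorphic_on halfplane"
      using holomorphic_on_compose_gen[of W halfplane g "ball 0 1"] g by (simp add: o_def lifts_def)
  next
    fix \<zeta> assume h: "\<zeta> \<in> halfplane"
    show "\<not> is_pole f (g (W \<zeta>))" "f (g (W \<zeta>)) = exp \<zeta>"
      using g(1) W1[OF h] MW[OF h] by (auto simp: lifts_def)
  qed
  moreover have "g (W \<zeta>0) = z" using g by (simp add: W_def)
  ultimately show ?thesis using that by blast
qed

text \<open>Write f = g / (z - a)^m with g = exp L zero-free. Then \<open>\<phi>\<close> = (z - a)
  exp(-L/m) is an m-th root of 1/f with a simple zero at \<open>a\<close>, and \<open>\<psi>\<close>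
  is its local inverse.\<close>

lemma pole_coordinate:
  assumes a: "is_pole f a"
  obtains e d \<psi> where "pole_mult f a \<ge> 1" "e > 0" "d > 0" "\<psi> holomorphic_on ball 0 d" "\<psi> 0 = a"
    "inj_on \<psi> (ball 0 d)"
    "\<And>u. u \<in> ball 0 d \<Longrightarrow> u \<noteq> 0 \<Longrightarrow> \<not> is_pole f (\<psi> u) \<and> f (\<psi> u) * u ^ pole_mult f a = 1"
    "\<And>z. z \<in> ball a e \<Longrightarrow> \<exists>u\<in>ball 0 d. z = \<psi> u"
proof -
  define m where "m = pole_mult f a"
  obtain e0 where e0: "e0 > 0" "\<And>z. z \<in> cball a e0 \<Longrightarrow> z \<noteq> a \<Longrightarrow> \<not> is_pole f z"
    using isolated_pole[OF a] by blast
  have "f holomorphic_on ball a e0 - {a}"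
    using holomorphic by (rule holomorphic_on_subset) (use e0(2) in auto)
  from zorder_exist_pole[OF this open_ball _ a] e0(1)
  obtain r where r: "zorder f a < 0" "zor_poly f a a \<noteq> 0" "r > 0" "cball a r \<subseteq> ball a e0"
    "zor_poly f a holomorphic_on cball a r"
    "\<And>w. w \<in> cball a r - {a} \<Longrightarrow> f w = zor_poly f a w / (w - a) ^ nat (- zorder f a) \<and> zor_poly f a w \<noteq> 0"
    by auto
  have m: "m \<ge> 1" using r(1) by (simp add: m_def pole_mult_def)
  define g where "g = zor_poly f a"
  have g0: "g w \<noteq> 0" if "w \<in> ball a r" for w
    using r(2) r(6)[of w] that by (cases "w = a") (auto simp: g_def)
  have fg: "f w * (w - a) ^ m = g w" if "w \<in> ball a r" "w \<noteq> a" for w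
    using r(6)[of w] that by (simp add: g_def m_def pole_mult_def)
  have g_hol: "g holomorphic_on ball a r"
    unfolding g_def using r(5) by (rule holomorphic_on_subset) auto
  obtain L where L: "L holomorphic_on ball a r" "\<And>w. w \<in> ball a r \<Longrightarrow> g w = exp (L w)"
    using contractible_imp_holomorphic_log[OF g_hol convex_imp_contractible[OF convex_ball]] g0 by blast
  define \<phi> where "\<phi> w = (w - a) * exp (- L w / of_nat m)" for w
  have \<phi>_hol: "\<phi> holomorphic_on ball a r"
    unfolding \<phi>_def by (intro holomorphic_intros L) (use m in auto)
  have \<phi>m: "f w * \<phi> w ^ m = 1" if "w \<in> ball a r" "w \<noteq> a" for w
  proof -
    have "exp (- L w / of_nat m) ^ m = exp (- L w)"
      using m by (simp flip: exp_of_nat_mult)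
    then have "f w * \<phi> w ^ m = g w * exp (- L w)"
      using fg[OF that] by (simp add: \<phi>_def power_mult_distrib mult.assoc[symmetric])
    then show ?thesis using L(2)[OF that(1)] by (simp flip: exp_add)
  qed
  have aL: "L field_differentiable at a"
    using L(1) r(3) holomorphic_on_imp_differentiable_at by auto
  have "(\<phi> has_field_derivative exp (- L a / of_nat m)) (at a)"
    unfolding \<phi>_def using aL[THEN field_differentiable_derivI]
    by (auto intro!: derivative_eq_intros) (use m in auto)
  then have "deriv \<phi> a \<noteq> 0" using DERIV_imp_deriv by fastforce
  then obtain r' where r': "r' > 0" "ball a r' \<subseteq> ball a r" "open (\<phi> ` ball a r')" "inj_on \<phi> (ball a r')"
    using has_complex_derivative_locally_invertible[OF \<phi>_hol _ open_ball, of a] r(3) by auto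
  obtain \<psi> where \<psi>: "\<psi> holomorphic_on \<phi> ` ball a r'" "\<And>w. w \<in> ball a r' \<Longrightarrow> \<psi> (\<phi> w) = w"
    using holomorphic_has_inverse[OF holomorphic_on_subset[OF \<phi>_hol r'(2)] open_ball r'(4)] by metis
  have "0 \<in> \<phi> ` ball a r'" using r'(1) by (auto simp: \<phi>_def intro!: image_eqI[of _ _ a])
  then obtain d where d: "d > 0" "ball 0 d \<subseteq> \<phi> ` ball a r'"
    using r'(3) open_contains_ball by metis
  have "isCont \<phi> a" using \<phi>_hol r(3) by (meson analytic_at analytic_at_imp_isCont centre_in_ball open_ball)
  moreover have \<phi>a: "\<phi> a = 0" by (simp add: \<phi>_def)
  ultimately obtain e1 where e1: "e1 > 0" "\<And>w. dist w a < e1 \<Longrightarrow> dist (\<phi> w) 0 < d"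
    using d(1) unfolding continuous_at_eps_delta by metis
  have \<psi>0: "\<psi> 0 = a" using \<psi>(2)[of a] r'(1) \<phi>a by simp
  show ?thesis
  proof (rule that[of "min e1 r'" d \<psi>])
    show "pole_mult f a \<ge> 1" using m by (simp add: m_def)
    show "\<psi> holomorphic_on ball 0 d" using \<psi>(1) d(2) holomorphic_on_subset by blast
    show "inj_on \<psi> (ball 0 d)"
    proof (rule inj_onI)
      fix x y assume xy: "x \<in> ball 0 d" "y \<in> ball 0 d" "\<psi> x = \<psi> y"
      from xy d(2) obtain x' y' where "x = \<phi> x'" "y = \<phi> y'" "x' \<in> ball a r'" "y' \<in> ball a r'" by blast
      then show "x = y" using \<psi>(2) xy(3) by simp
    qed
    show "\<not> is_pole f (\<psi> u) \<and> f (\<psi> u) * u ^ pole_mult f a = 1" if u: "u \<in> ball 0 d" "u \<noteq> 0" for u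
    proof -
      from u d(2) obtain w where w: "u = \<phi> w" "w \<in> ball a r'" by blast
      then have "w \<noteq> a" using u \<phi>a by auto
      moreover have "w \<in> ball a r" using w(2) r'(2) by blast
      moreover have "w \<in> cball a e0" using \<open>w \<in> ball a r\<close> r(4) by (meson ball_subset_cball subsetD)
      ultimately show ?thesis using e0(2)[of w] \<phi>m[of w] w \<psi>(2) by (simp add: m_def)
    qed
    show "\<exists>u\<in>ball 0 d. z = \<psi> u" if z: "z \<in> ball a (min e1 r')" for z
      using e1(2)[of z] \<psi>(2)[of z] z by (intro bexI[of _ "\<phi> z"]) (auto simp: dist_commute)
  qed (use d e1 r' \<psi>0 in auto)
qed

end

lemma holomorphic_on_compose_into:
  assumes "p holomorphic_on A" "q holomorphic_on B" "\<And>x. x \<in> A \<Longrightarrow> p x \<in> B"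
  shows "(\<lambda>x. q (p x)) holomorphic_on A"
  using holomorphic_on_compose_gen[OF assms(1,2)] assms(3) by (auto simp: o_def)

context tracts begin

lemma exp_in_ball_rad:
  assumes "m \<ge> 1"
  shows "exp (- \<zeta> / of_nat m) \<in> ball 0 (rad m) \<longleftrightarrow> \<zeta> \<in> halfplane"
  using assms by (simp add: halfplane_def rad_def divide_less_cancel)

lemma exp_minus_Ln_div:
  assumes "m \<ge> 1" "u \<noteq> 0"
  shows "exp (- (- of_nat m * Ln u) / of_nat m) = u"
  using assms by simp

lemma minus_Ln_in_halfplane:
  assumes "m \<ge> 1" "u \<noteq> 0" "u \<in> ball 0 (rad m)"
  shows "- of_nat m * Ln u \<in> halfplane"
  using exp_in_ball_rad[OF assms(1), of "- of_nat m * Ln u"] assms(3)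
  by (simp only: exp_minus_Ln_div[OF assms(1,2)])

lemma lifts_exp_shift:
  fixes k :: int
  assumes "lifts halfplane exp G"
  shows "lifts halfplane exp (\<lambda>\<zeta>. G (\<zeta> + 2 * of_int k * of_real pi * \<i>))"
  unfolding lifts_def
proof (intro conjI ballI)
  define s :: complex where "s = 2 * of_int k * of_real pi * \<i>"
  have s: "\<zeta> + s \<in> halfplane" if "\<zeta> \<in> halfplane" for \<zeta>
    using that by (simp add: halfplane_def s_def)
  have es: "exp (\<zeta> + s) = exp \<zeta>" for \<zeta>
  proof -
    have "s = of_int (2 * k) * (of_real pi * \<i>)" by (simp add: s_def)
    then have "exp s = 1" using exp_integer_2pi[of "of_int k"] by (simp add: s_def mult_ac)
    then show ?thesis by (simp add: exp_add)
  qed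
  show "(\<lambda>\<zeta>. G (\<zeta> + s)) holomorphic_on halfplane"
  proof (rule holomorphic_on_compose_into[of "\<lambda>\<zeta>. \<zeta> + s" _ G])
    show "G holomorphic_on halfplane" using assms by (simp add: lifts_def)
  qed (use s in \<open>auto intro!: holomorphic_intros\<close>)
  fix \<zeta> assume "\<zeta> \<in> halfplane"
  then show "\<not> is_pole f (G (\<zeta> + s))" "f (G (\<zeta> + s)) = exp \<zeta>"
    using assms s es unfolding lifts_def by metis+
qed

lemma lifts_exp_unique:
  assumes "lifts halfplane exp G" "lifts halfplane exp G'" "\<zeta>0 \<in> halfplane" "G \<zeta>0 = G' \<zeta>0" "\<zeta> \<in> halfplane"
  shows "G \<zeta> = G' \<zeta>"
  by (rule lifts_unique[OF assms(1,2) convex_connected[OF convex_halfplane] _ _ _ _ assms(3,4,5)])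
    (auto dest: halfplane_norm_exp)

text \<open>With u = exp(-\<zeta>/m) the identity f(\<Psi> u) = u^-m reads f = exp \<zeta>. So
  charts can be compared through the uniqueness of lifts of \<open>exp\<close>.\<close>

lemma chart_lift:
  assumes "chart a \<Psi>"
  shows "lifts halfplane exp (\<lambda>\<zeta>. \<Psi> (exp (- \<zeta> / of_nat (pole_mult f a))))"
  unfolding lifts_def
proof (intro conjI ballI)
  define m where "m = pole_mult f a"
  have m: "m \<ge> 1" using assms by (simp add: chart_def m_def)
  show "(\<lambda>\<zeta>. \<Psi> (exp (- \<zeta> / of_nat m))) holomorphic_on halfplane"
  proof (rule holomorphic_on_compose_into[of "\<lambda>\<zeta>. exp (- \<zeta> / of_nat m)" _ \<Psi>])
    show "(\<lambda>\<zeta>. exp (- \<zeta> / of_nat m)) holomorphic_on halfplane"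
      using m by (intro holomorphic_intros) auto
    show "\<Psi> holomorphic_on ball 0 (rad m)" using assms by (simp add: chart_def m_def)
  qed (simp only: exp_in_ball_rad[OF m])
  fix \<zeta> assume h: "\<zeta> \<in> halfplane"
  let ?u = "exp (- \<zeta> / of_nat m)"
  have c: "\<not> is_pole f (\<Psi> ?u) \<and> f (\<Psi> ?u) * ?u ^ m = 1"
    using assms h exp_in_ball_rad[OF m, of \<zeta>] unfolding chart_def m_def by (auto simp del: mem_ball)
  have "?u ^ m = exp (- \<zeta>)" using m by (simp flip: exp_of_nat_mult)
  then show "\<not> is_pole f (\<Psi> ?u)" "f (\<Psi> ?u) = exp \<zeta>"
    using c by (auto simp: exp_minus field_simps)
qed

lemma chart_tendsto:
  assumes "chart a \<Psi>"
  shows "((\<lambda>t. \<Psi> (exp (- (\<zeta> + complex_of_real t) / of_nat (pole_mult f a)))) \<longlongrightarrow> a) at_top"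
proof -
  define m where "m = pole_mult f a"
  have m: "real m > 0" using assms by (simp add: chart_def m_def)
  have "((\<lambda>t. exp (- (Re \<zeta> + t) / real m)) \<longlongrightarrow> 0) at_top"
    using m by real_asymp
  then have "((\<lambda>t. norm (exp (- (\<zeta> + complex_of_real t) / of_nat m))) \<longlongrightarrow> 0) at_top" by simp
  then have "((\<lambda>t. exp (- (\<zeta> + complex_of_real t) / of_nat m)) \<longlongrightarrow> 0) at_top"
    by (rule tendsto_norm_zero_cancel)
  moreover have "isCont \<Psi> 0"
    using assms unfolding chart_def
    by (meson analytic_at analytic_at_imp_isCont centre_in_ball open_ball rad_pos)
  ultimately have "((\<lambda>t. \<Psi> (exp (- (\<zeta> + complex_of_real t) / of_nat m))) \<longlongrightarrow> \<Psi> 0) at_top"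
    by (rule isCont_tendsto_compose[rotated])
  then show ?thesis using assms by (simp add: chart_def m_def)
qed

text \<open>Both charts are lifts of \<open>exp\<close> in the logarithmic coordinate, and lifts
  that meet differ by the translation by a period of \<open>exp\<close>. Letting the real part tend
  to infinity shows that the poles coincide.\<close>

lemma charts_meet_punctured:
  assumes c: "chart a \<Psi>" "chart a' \<Psi>'"
    and u: "u \<in> ball 0 (radius a) - {0}" "u' \<in> ball 0 (radius a') - {0}"
    and eq: "\<Psi> u = \<Psi>' u'"
  shows "a = a' \<and> \<Psi> ` (ball 0 (radius a) - {0}) \<subseteq> \<Psi>' ` (ball 0 (radius a') - {0})"
proof -
  define m where "m = pole_mult f a"
  define m' where "m' = pole_mult f a'"
  have m: "m \<ge> 1" "m' \<ge> 1" using c by (auto simp: chart_def m_def m'_def)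
  define G where "G \<zeta> = \<Psi> (exp (- \<zeta> / of_nat m))" for \<zeta>
  define G' where "G' \<zeta> = \<Psi>' (exp (- \<zeta> / of_nat m'))" for \<zeta>
  have G: "lifts halfplane exp G" "lifts halfplane exp G'"
    using chart_lift c by (simp_all add: G_def[abs_def] G'_def[abs_def] m_def m'_def)
  define \<zeta> where "\<zeta> = - of_nat m * Ln u"
  define \<zeta>' where "\<zeta>' = - of_nat m' * Ln u'"
  have h: "\<zeta> \<in> halfplane" "\<zeta>' \<in> halfplane"
    using minus_Ln_in_halfplane m u by (auto simp: \<zeta>_def \<zeta>'_def m_def m'_def)
  have Gz: "G \<zeta> = G' \<zeta>'"
    using exp_minus_Ln_div m u eq unfolding G_def G'_def \<zeta>_def \<zeta>'_def by (metis DiffD2 singletonI)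
  moreover have "f (G \<zeta>) = exp \<zeta>" "f (G' \<zeta>') = exp \<zeta>'" using G h by (auto simp: lifts_def)
  ultimately have "exp \<zeta>' = exp \<zeta>" by metis
  then obtain k :: int where k: "\<zeta>' = \<zeta> + 2 * of_int k * of_real pi * \<i>" by (rule exp_diff_period)
  define s :: complex where "s = 2 * of_int k * of_real pi * \<i>"
  have GG: "G v = G' (v + s)" if "v \<in> halfplane" for v
    using lifts_exp_unique[OF G(1) lifts_exp_shift[OF G(2), of k] h(1) _ that] Gz k by (simp add: s_def)
  have "((\<lambda>t. G (\<zeta> + complex_of_real t)) \<longlongrightarrow> a) at_top"
    using chart_tendsto[OF c(1), of \<zeta>] by (simp add: G_def m_def)
  moreover have "((\<lambda>t. G' (\<zeta> + s + complex_of_real t)) \<longlongrightarrow> a') at_top"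
    using chart_tendsto[OF c(2), of "\<zeta> + s"] by (simp add: G'_def m'_def)
  moreover have "\<forall>\<^sub>F t in at_top. G' (\<zeta> + s + complex_of_real t) = G (\<zeta> + complex_of_real t)"
    using eventually_ge_at_top[of "0::real"]
  proof eventually_elim
    case (elim t)
    then have "\<zeta> + complex_of_real t \<in> halfplane" using h(1) by (simp add: halfplane_def)
    then show ?case using GG by (simp add: add_ac)
  qed
  ultimately have aa: "a = a'"
    using tendsto_unique[OF trivial_limit_at_top_linorder] Lim_transform_eventually by metis
  have "\<Psi> v \<in> \<Psi>' ` (ball 0 (rad m') - {0})" if v: "v \<in> ball 0 (rad m) - {0}" for v
  proof -
    define w where "w = - of_nat m * Ln v"
    have w: "w \<in> halfplane" using minus_Ln_in_halfplane m v by (auto simp: w_def)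
    have "\<Psi> v = G w" using exp_minus_Ln_div[of m v] m v by (simp add: G_def w_def)
    also have "\<dots> = \<Psi>' (exp (- (w + s) / of_nat m'))" using GG[OF w] by (simp add: G'_def)
    finally have "\<Psi> v = \<Psi>' (exp (- (w + s) / of_nat m'))" .
    moreover have "w + s \<in> halfplane" using w by (simp add: halfplane_def s_def)
    then have "exp (- (w + s) / of_nat m') \<in> ball 0 (rad m') - {0}"
      using exp_in_ball_rad[OF m(2), of "w + s"] by simp
    ultimately show ?thesis by blast
  qed
  then show ?thesis using aa unfolding m_def m'_def by blast
qed

lemma chart_image_open:
  assumes "chart a \<Psi>" "0 < d" "d \<le> radius a"
  shows "open (\<Psi> ` ball 0 d)"
proof (rule open_mapping_thm3)
  have sub: "ball 0 d \<subseteq> ball (0::complex) (radius a)" using assms by auto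
  show "\<Psi> holomorphic_on ball 0 d" "inj_on \<Psi> (ball 0 d)"
    using assms sub unfolding chart_def by (meson holomorphic_on_subset inj_on_subset)+
qed auto

text \<open>Both images are neighbourhoods of \<open>a\<close>, so they share a point other than
  \<open>a\<close>, to which \<open>charts_meet_punctured\<close> applies.\<close>

lemma charts_same_image:
  assumes c: "chart a \<Psi>" "chart a \<Psi>'"
  shows "\<Psi> ` (ball 0 (radius a) - {0}) \<subseteq> \<Psi>' ` (ball 0 (radius a) - {0})"
proof -
  let ?B = "ball (0::complex) (radius a)"
  have "open (\<Psi> ` ?B \<inter> \<Psi>' ` ?B)"
    using chart_image_open[OF c(1) rad_pos order_refl] chart_image_open[OF c(2) rad_pos order_refl] by blast
  moreover have "a \<in> \<Psi> ` ?B \<inter> \<Psi>' ` ?B"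
    using c unfolding chart_def by (metis IntI centre_in_ball image_eqI rad_pos)
  ultimately obtain e where e: "e > 0" "ball a e \<subseteq> \<Psi> ` ?B \<inter> \<Psi>' ` ?B"
    using open_contains_ball by metis
  define b where "b = a + of_real (e / 2)"
  have "dist a b < e" using e(1) by (simp add: b_def dist_norm)
  then have b: "b \<noteq> a" "b \<in> \<Psi> ` ?B \<inter> \<Psi>' ` ?B"
    using e by (auto simp: b_def)
  then obtain u u' where "u \<in> ?B" "u' \<in> ?B" "b = \<Psi> u" "b = \<Psi>' u'" by blast
  moreover have "u \<noteq> 0" "u' \<noteq> 0" using calculation b(1) c by (auto simp: chart_def)
  ultimately show ?thesis using charts_meet_punctured[OF c, of u u'] by blast
qed

lemma charts_disjoint:
  assumes c: "chart a \<Psi>" "chart a' \<Psi>'"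
    and u: "u \<in> ball 0 (radius a)" "u' \<in> ball 0 (radius a')" "\<Psi> u = \<Psi>' u'"
  shows "a = a'"
proof (cases "u = 0 \<or> u' = 0")
  case True
  then have "is_pole f (\<Psi> u)" using c u(3) by (auto simp: chart_def)
  then have "u = 0" "u' = 0" using c u unfolding chart_def by (metis Diff_iff singletonD)+
  then show ?thesis using c u(3) by (simp add: chart_def)
next
  case False then show ?thesis using charts_meet_punctured[OF c, of u u'] u by blast
qed

text \<open>The branch of the inverse at \<open>z\<close> lifts \<open>exp\<close> on the
  half-plane. Along a horizontal ray \<open>f\<close> tends to infinity on it, so its limit there
  exists and is a pole \<open>a\<close>. Comparison with the normal form of \<open>f\<close> at
  \<open>a\<close> shows that the lift has period 2 pi i m, so it descends to the variable u =
  exp(-\<zeta>/m).\<close>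

lemma exists_chart:
  assumes z: "\<not> is_pole f z" "norm (f z) > R"
  shows "\<exists>a \<Psi>. chart a \<Psi> \<and> z \<in> \<Psi> ` (ball 0 (radius a) - {0})"
proof -
  define \<zeta>0 where "\<zeta>0 = Ln (f z)"
  have fz: "f z \<noteq> 0" using z R_pos by auto
  have \<zeta>0: "\<zeta>0 \<in> halfplane" using z R_pos fz by (simp add: \<zeta>0_def halfplane_def)
  obtain G where G: "lifts halfplane exp G" "G \<zeta>0 = z"
    using lift_halfplane[OF z(1) _ \<zeta>0] fz by (auto simp: \<zeta>0_def)
  have ray: "\<zeta>0 + complex_of_real t \<in> halfplane" if "t \<ge> 0" for t
    using \<zeta>0 that by (simp add: halfplane_def)
  have fG: "\<not> is_pole f (G v) \<and> f (G v) = exp v" if "v \<in> halfplane" for v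
    using G that by (simp add: lifts_def)
  have G_cont: "continuous_on halfplane G"
    using G(1) by (simp add: lifts_def holomorphic_on_imp_continuous_on)
  have cont: "continuous_on {0..} (\<lambda>t. G (\<zeta>0 + complex_of_real t))"
    by (rule continuous_on_compose2[OF G_cont]) (use ray in \<open>auto intro!: continuous_intros\<close>)
  have inf: "filterlim (\<lambda>t. f (G (\<zeta>0 + complex_of_real t))) at_infinity at_top"
  proof (rule filterlim_norm_at_top_imp_at_infinity)
    have "filterlim (\<lambda>t. exp (Re \<zeta>0 + t)) at_top at_top" by real_asymp
    then show "filterlim (\<lambda>t. norm (f (G (\<zeta>0 + complex_of_real t)))) at_top at_top"
    proof (rule filterlim_mono_eventually[OF _ order_refl order_refl])
      show "\<forall>\<^sub>F t in at_top. exp (Re \<zeta>0 + t) = norm (f (G (\<zeta>0 + complex_of_real t)))"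
        using eventually_ge_at_top[of "0::real"] by eventually_elim (simp add: fG ray)
    qed
  qed
  obtain a where a: "((\<lambda>t. G (\<zeta>0 + complex_of_real t)) \<longlongrightarrow> a) at_top" "is_pole f a"
    by (rule curve_limit_pole[OF cont inf])
  define m where "m = pole_mult f a"
  obtain e d \<psi>0 where p: "m \<ge> 1" "e > 0" "d > 0" "\<psi>0 holomorphic_on ball 0 d" "\<psi>0 0 = a"
    "inj_on \<psi>0 (ball 0 d)"
    "\<And>u. u \<in> ball 0 d \<Longrightarrow> u \<noteq> 0 \<Longrightarrow> \<not> is_pole f (\<psi>0 u) \<and> f (\<psi>0 u) * u ^ m = 1"
    "\<And>z. z \<in> ball a e \<Longrightarrow> \<exists>u\<in>ball 0 d. z = \<psi>0 u"
    using pole_coordinate[OF a(2)] unfolding m_def by metis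
  \<comment> \<open>To the right of this abscissa \<open>\<zeta>\<close> is in the half-plane and
    exp(-\<zeta>/m) in the disc on which \<open>\<psi>0\<close> is defined.\<close>
  define X where "X = max (ln R) (- real m * ln d)"
  define H where "H = {\<zeta>. Re \<zeta> > X}"
  have HX: "H \<subseteq> halfplane" by (auto simp: H_def halfplane_def X_def)
  have Hd: "exp (- \<zeta> / of_nat m) \<in> ball 0 d" if "\<zeta> \<in> H" for \<zeta>
  proof -
    have "- Re \<zeta> < real m * ln d" using that by (simp add: H_def X_def)
    then have "- Re \<zeta> / real m < ln d" using p(1) by (simp add: field_simps)
    then have "exp (- Re \<zeta> / real m) < exp (ln d)" by (simp only: exp_less_cancel_iff)
    then show ?thesis using p(3) by simp
  qed
  have "\<forall>\<^sub>F t in at_top. t \<ge> 0 \<and> t > X - Re \<zeta>0 \<and> dist (G (\<zeta>0 + complex_of_real t)) a < e"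
    using eventually_ge_at_top[of "0::real"] eventually_gt_at_top[of "X - Re \<zeta>0"] tendstoD[OF a(1) p(2)]
    by eventually_elim auto
  then obtain t where t: "t \<ge> 0" "t > X - Re \<zeta>0" "dist (G (\<zeta>0 + complex_of_real t)) a < e"
    using eventually_happens' [OF trivial_limit_at_top_linorder] by blast
  define \<zeta>1 where "\<zeta>1 = \<zeta>0 + complex_of_real t"
  have \<zeta>1: "\<zeta>1 \<in> H" "\<zeta>1 \<in> halfplane" using t ray by (auto simp: \<zeta>1_def H_def)
  obtain u1 where u1: "u1 \<in> ball 0 d" "G \<zeta>1 = \<psi>0 u1"
    using p(8)[of "G \<zeta>1"] t(3) by (auto simp: \<zeta>1_def dist_commute)
  have "u1 \<noteq> 0" using fG[OF \<zeta>1(2)] u1(2) p(5) a(2) by auto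
  then have u1m: "exp \<zeta>1 * u1 ^ m = 1" using p(7)[OF u1(1)] u1(2) fG[OF \<zeta>1(2)] by auto
  \<comment> \<open>\<open>u1\<close> and exp(-\<open>\<zeta>1\<close>/m) have the same m-th power.
    Their quotient \<open>\<omega>\<close> is absorbed into the local coordinate, which makes the
    two lifts agree at \<open>\<zeta>1\<close>.\<close>
  define \<omega> where "\<omega> = u1 * exp (\<zeta>1 / of_nat m)"
  have "exp (\<zeta>1 / of_nat m) ^ m = exp \<zeta>1" using p(1) by (simp flip: exp_of_nat_mult)
  then have \<omega>m: "\<omega> ^ m = 1" using u1m by (simp add: \<omega>_def power_mult_distrib mult.commute)
  then have "norm \<omega> ^ m = 1" by (metis norm_one norm_power)
  then have \<omega>1: "norm \<omega> = 1" using p(1) power_eq_imp_eq_base[of "norm \<omega>" m 1] by auto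
  define \<psi> where "\<psi> u = \<psi>0 (\<omega> * u)" for u
  have \<psi>_hol: "\<psi> holomorphic_on ball 0 d"
    unfolding \<psi>_def
    by (rule holomorphic_on_compose_into[of "\<lambda>u. \<omega> * u", OF _ p(4)])
      (use \<omega>1 in \<open>auto simp: norm_mult intro!: holomorphic_intros\<close>)
  have \<psi>_inj: "inj_on \<psi> (ball 0 d)"
  proof (rule inj_onI)
    fix x y assume "x \<in> ball 0 d" "y \<in> ball 0 d" "\<psi> x = \<psi> y"
    then have "\<omega> * x = \<omega> * y" using inj_onD[OF p(6), of "\<omega> * x" "\<omega> * y"] \<omega>1 by (simp add: \<psi>_def norm_mult)
    then show "x = y" using \<omega>1 by auto
  qed
  have \<psi>f: "\<not> is_pole f (\<psi> u) \<and> f (\<psi> u) * u ^ m = 1" if "u \<in> ball 0 d" "u \<noteq> 0" for u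
  proof -
    have "\<omega> \<noteq> 0" using \<omega>1 by auto
    then show ?thesis
      using p(7)[of "\<omega> * u"] that \<omega>1 \<omega>m by (auto simp: \<psi>_def norm_mult power_mult_distrib)
  qed
  have \<psi>_lift: "lifts H exp (\<lambda>\<zeta>. \<psi> (exp (- \<zeta> / of_nat m)))"
    unfolding lifts_def
  proof (intro conjI ballI)
    show "(\<lambda>\<zeta>. \<psi> (exp (- \<zeta> / of_nat m))) holomorphic_on H"
    proof (rule holomorphic_on_compose_into[of "\<lambda>\<zeta>. exp (- \<zeta> / of_nat m)", OF _ \<psi>_hol])
      show "(\<lambda>\<zeta>. exp (- \<zeta> / of_nat m)) holomorphic_on H"
        using p(1) by (intro holomorphic_intros) auto
    qed (rule Hd)
    fix \<zeta> assume \<zeta>: "\<zeta> \<in> H"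
    have c: "\<not> is_pole f (\<psi> (exp (- \<zeta> / of_nat m))) \<and> f (\<psi> (exp (- \<zeta> / of_nat m))) * exp (- \<zeta> / of_nat m) ^ m = 1"
      by (rule \<psi>f[OF Hd[OF \<zeta>] exp_not_eq_zero])
    have "exp (- \<zeta> / of_nat m) ^ m = exp (- \<zeta>)" using p(1) by (simp flip: exp_of_nat_mult)
    then show "\<not> is_pole f (\<psi> (exp (- \<zeta> / of_nat m)))" "f (\<psi> (exp (- \<zeta> / of_nat m))) = exp \<zeta>"
      using c by (auto simp: exp_minus field_simps)
  qed
  have "\<psi> (exp (- \<zeta>1 / of_nat m)) = \<psi>0 u1"
    by (simp add: \<psi>_def \<omega>_def mult.assoc flip: exp_add)
  then have at1: "G \<zeta>1 = \<psi> (exp (- \<zeta>1 / of_nat m))" using u1 by simp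
  have GH: "G \<zeta> = \<psi> (exp (- \<zeta> / of_nat m))" if "\<zeta> \<in> H" for \<zeta>
  proof (rule lifts_unique[OF G(1) \<psi>_lift _ HX order_refl _ _ \<zeta>1(1) at1 that])
    show "connected H" unfolding H_def by (intro convex_connected convex_halfspace_Re_gt)
    show "norm (exp u) > R" if "u \<in> H" for u using that HX halfplane_norm_exp by blast
  qed auto
  \<comment> \<open>On \<open>H\<close> this is the periodicity of the exponential; uniqueness of
    lifts carries it over to the whole half-plane.\<close>
  have period: "G (\<zeta> + 2 * of_int (int m * k) * of_real pi * \<i>) = G \<zeta>" if "\<zeta> \<in> halfplane" for \<zeta> and k :: int
  proof (rule lifts_exp_unique[OF lifts_exp_shift[OF G(1)] G(1) \<zeta>1(2) _ that])
    have 1: "\<zeta>1 + 2 * of_int (int m * k) * of_real pi * \<i> \<in> H" using \<zeta>1(1) by (simp add: H_def)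
    have "exp (- (\<zeta>1 + 2 * of_int (int m * k) * of_real pi * \<i>) / of_nat m)
        = exp (- \<zeta>1 / of_nat m + 2 * of_int (- k) * of_real pi * \<i>)"
      using p(1) by (intro arg_cong[of _ _ exp]) (simp add: field_simps)
    also have "\<dots> = exp (- \<zeta>1 / of_nat m)"
      using exp_plus_2pin[of "- \<zeta>1 / of_nat m" "- k"] by (simp add: mult_ac)
    finally show "G (\<zeta>1 + 2 * of_int (int m * k) * of_real pi * \<i>) = G \<zeta>1"
      using GH[OF 1] GH[OF \<zeta>1(1)] by simp
  qed
  \<comment> \<open>The jump of \<open>Ln\<close> at its cut is not seen by \<open>G\<close>,
    because of \<open>period\<close>.\<close>
  define \<Psi> where "\<Psi> u = (if u = 0 then a else G (- of_nat m * Ln u))" for u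
  have \<Psi>G: "\<Psi> (exp w) = G (- of_nat m * w)" if w: "- of_nat m * w \<in> halfplane" for w
  proof -
    have "exp (Ln (exp w)) = exp w" by simp
    then obtain k :: int where k: "Ln (exp w) = w + 2 * of_int k * of_real pi * \<i>" by (rule exp_diff_period)
    have "- of_nat m * Ln (exp w) = - of_nat m * w + 2 * of_int (int m * (- k)) * of_real pi * \<i>"
      by (simp add: k algebra_simps)
    then have "G (- of_nat m * Ln (exp w)) = G (- of_nat m * w)" using period[OF w, of "- k"] by simp
    then show ?thesis by (simp add: \<Psi>_def)
  qed
  have hp: "- of_nat m * Ln u \<in> halfplane" if "u \<in> ball 0 (rad m) - {0}" for u
    using minus_Ln_in_halfplane[OF p(1), of u] that by blast
  have \<Psi>_hol0: "\<Psi> holomorphic_on ball 0 (exp (- X / real m))"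
  proof (rule holomorphic_transform)
    have dd: "exp (- X / real m) \<le> d"
    proof -
      have "- X \<le> real m * ln d" by (simp add: X_def)
      then have "- X / real m \<le> ln d" using p(1) by (simp add: field_simps)
      then show ?thesis using p(3) by (metis exp_le_cancel_iff exp_ln)
    qed
    then show "\<psi> holomorphic_on ball 0 (exp (- X / real m))"
      by (intro holomorphic_on_subset[OF \<psi>_hol]) auto
    fix u :: complex assume u: "u \<in> ball 0 (exp (- X / real m))"
    show "\<psi> u = \<Psi> u"
    proof (cases "u = 0")
      case True then show ?thesis using p(5) by (simp add: \<psi>_def \<Psi>_def)
    next
      case False
      then have "ln (norm u) < - X / real m" using u by (metis dist_0_norm ln_exp ln_less_cancel_iff exp_gt_zero mem_ball zero_less_norm_iff)
      then have "real m * ln (norm u) < - X" using p(1) by (simp add: field_simps)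
      then have "- of_nat m * Ln u \<in> H" using False by (simp add: H_def)
      from GH[OF this] show ?thesis using False p(1) by (simp add: \<Psi>_def)
    qed
  qed
  have \<Psi>_hol: "\<Psi> holomorphic_on ball 0 (rad m)"
    unfolding holomorphic_on_def
  proof
    fix u0 :: complex assume u0: "u0 \<in> ball 0 (rad m)"
    show "\<Psi> field_differentiable at u0 within ball 0 (rad m)"
    proof (cases "u0 = 0")
      case True
      then show ?thesis
        using holomorphic_on_imp_differentiable_at[OF \<Psi>_hol0 open_ball, of u0]
        by (auto intro: field_differentiable_at_within)
    next
      case False
      define B where "B = ball u0 (norm u0) \<inter> ball 0 (rad m)"
      have re: "Re (u / u0) > 0" if "u \<in> ball u0 (norm u0)" for u
      proof -
        have "norm (u / u0 - 1) = norm (u - u0) / norm u0"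
          using False by (simp add: diff_divide_distrib flip: norm_divide)
        also have "\<dots> < 1" using that False by (simp add: dist_norm norm_minus_commute)
        finally have "\<bar>Re (u / u0 - 1)\<bar> < 1" using abs_Re_le_cmod le_less_trans by blast
        then show ?thesis by simp
      qed
      \<comment> \<open>A logarithm that is holomorphic around \<open>u0\<close> even if
        \<open>u0\<close> lies on the cut of \<open>Ln\<close>.\<close>
      define l where "l u = Ln (u / u0) + Ln u0" for u
      have el: "exp (l u) = u" if "u \<in> B" for u
      proof -
        have "u / u0 \<noteq> 0" using re[of u] that by (auto simp: B_def)
        then have "exp (Ln (u / u0)) = u / u0" by (rule exp_Ln)
        then show ?thesis using False by (simp add: l_def exp_add)
      qed
      have lh: "- of_nat m * l u \<in> halfplane" if "u \<in> B" for u
        using exp_in_ball_rad[OF p(1), of "- of_nat m * l u"] el[OF that] that p(1) by (simp add: B_def)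
      have l_hol: "l holomorphic_on B"
        unfolding l_def
      proof (intro holomorphic_intros)
        fix u assume "u \<in> B"
        then have "Re (u / u0) > 0" using re by (simp add: B_def)
        then show "u / u0 \<notin> \<real>\<^sub>\<le>\<^sub>0" by (auto simp: complex_nonpos_Reals_iff)
      qed (use False in auto)
      have "(\<lambda>u. G (- of_nat m * l u)) holomorphic_on B"
      proof (rule holomorphic_on_compose_into[of "\<lambda>u. - of_nat m * l u" _ G])
        show "(\<lambda>u. - of_nat m * l u) holomorphic_on B" by (intro holomorphic_intros l_hol)
        show "G holomorphic_on halfplane" using G(1) by (simp add: lifts_def)
      qed (rule lh)
      then have "\<Psi> holomorphic_on B"
        by (rule holomorphic_transform) (use \<Psi>G[OF lh] el in metis)
      then have "\<Psi> field_differentiable at u0"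
        by (rule holomorphic_on_imp_differentiable_at) (use u0 False in \<open>auto simp: B_def\<close>)
      then show ?thesis by (rule field_differentiable_at_within)
    qed
  qed
  have \<Psi>f: "\<not> is_pole f (\<Psi> u) \<and> f (\<Psi> u) * u ^ m = 1" if "u \<in> ball 0 (rad m) - {0}" for u
  proof -
    have "u ^ m = exp (of_nat m * Ln u)" using that by (simp add: exp_of_nat_mult)
    then show ?thesis using fG[OF hp[OF that]] that by (simp add: \<Psi>_def exp_minus)
  qed
  have \<Psi>_inj: "inj_on \<Psi> (ball 0 (rad m))"
  proof (rule inj_onI)
    fix x y assume xy: "x \<in> ball 0 (rad m)" "y \<in> ball 0 (rad m)" "\<Psi> x = \<Psi> y"
    show "x = y"
    proof (cases "x = 0 \<or> y = 0")
      case True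
      then have "is_pole f (\<Psi> x)" "is_pole f (\<Psi> y)" using a(2) xy(3) by (auto simp: \<Psi>_def)
      then show ?thesis using \<Psi>f[of x] \<Psi>f[of y] xy by auto
    next
      case False
      \<comment> \<open>If \<open>G\<close> agrees at \<open>\<xi>\<close> and
        \<open>\<eta>\<close>, then by uniqueness it is invariant under their difference
        \<open>s\<close>. In \<open>H\<close>, where \<open>\<psi>\<close> is injective, this forces
        exp(-s/m) = 1.\<close>
      define \<xi> where "\<xi> = - of_nat m * Ln x"
      define \<eta> where "\<eta> = - of_nat m * Ln y"
      have h: "\<xi> \<in> halfplane" "\<eta> \<in> halfplane" using hp xy False by (auto simp: \<xi>_def \<eta>_def)
      have eq: "G \<xi> = G \<eta>" using xy(3) False by (simp add: \<Psi>_def \<xi>_def \<eta>_def)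
      then have "exp \<eta> = exp \<xi>" using fG h by metis
      then obtain k :: int where k: "\<eta> = \<xi> + 2 * of_int k * of_real pi * \<i>" by (rule exp_diff_period)
      define s :: complex where "s = 2 * of_int k * of_real pi * \<i>"
      have "G \<zeta>1 = G (\<zeta>1 + s)"
        unfolding s_def by (rule lifts_exp_unique[OF G(1) lifts_exp_shift[OF G(1)] h(1) _ \<zeta>1(2)]) (use eq k in simp)
      moreover have "\<zeta>1 + s \<in> H" using \<zeta>1(1) by (simp add: H_def s_def)
      ultimately have "\<psi> (exp (- \<zeta>1 / of_nat m)) = \<psi> (exp (- (\<zeta>1 + s) / of_nat m))" using GH \<zeta>1(1) by metis
      then have "exp (- \<zeta>1 / of_nat m) = exp (- (\<zeta>1 + s) / of_nat m)"
        by (rule inj_onD[OF \<psi>_inj _ Hd[OF \<zeta>1(1)] Hd[OF \<open>\<zeta>1 + s \<in> H\<close>]])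
      also have "\<dots> = exp (- \<zeta>1 / of_nat m) * exp (- s / of_nat m)"
        by (simp add: diff_divide_distrib flip: exp_add)
      finally have "exp (- s / of_nat m) = 1" by simp
      moreover have "exp (- \<eta> / of_nat m) = exp (- \<xi> / of_nat m) * exp (- s / of_nat m)"
        by (simp add: k s_def diff_divide_distrib flip: exp_add)
      ultimately show ?thesis using exp_minus_Ln_div[OF p(1)] False by (simp add: \<xi>_def \<eta>_def)
    qed
  qed
  have "chart a \<Psi>"
    using a(2) p(1) \<Psi>_hol \<Psi>_inj \<Psi>f unfolding chart_def m_def by (simp add: \<Psi>_def)
  moreover have "z \<in> \<Psi> ` (ball 0 (rad m) - {0})"
  proof (rule image_eqI[of _ _ "exp (- \<zeta>0 / of_nat m)"])
    show "z = \<Psi> (exp (- \<zeta>0 / of_nat m))"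
      using \<Psi>G[of "- \<zeta>0 / of_nat m"] \<zeta>0 p(1) G(2) by simp
    show "exp (- \<zeta>0 / of_nat m) \<in> ball 0 (rad m) - {0}"
      using exp_in_ball_rad[OF p(1)] \<zeta>0 by auto
  qed
  ultimately show ?thesis unfolding m_def by blast
qed

lemma covering_by_charts:
  assumes "\<not> is_pole f z" "norm (f z) > R"
  obtains a where "\<exists>\<Psi>. chart a \<Psi>" "\<And>\<Psi>. chart a \<Psi> \<Longrightarrow> z \<in> \<Psi> ` (ball 0 (radius a) - {0})"
proof -
  obtain a \<Psi> where "chart a \<Psi>" "z \<in> \<Psi> ` (ball 0 (radius a) - {0})"
    using exists_chart[OF assms] by blast
  then show ?thesis using that[of a] charts_same_image[of a \<Psi>] by blast
qed

end

section \<open>Distortion in the tracts\<close>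

lemma sin_ge_half:
  fixes t :: real
  assumes "\<bar>t\<bar> \<le> 1"
  shows "\<bar>t\<bar> / 2 \<le> \<bar>sin t\<bar>"
proof -
  have pos: "t / 2 \<le> sin t" if "0 < t" "t \<le> 1" for t :: real
  proof -
    have "\<exists>z>0. z < t \<and> sin t - sin 0 = (t - 0) * cos z"
      by (rule MVT2) (use that in \<open>auto intro!: derivative_eq_intros\<close>)
    then obtain x where x: "0 < x" "x < t" "sin t - sin 0 = (t - 0) * cos x" by blast
    have "cos (pi / 3) \<le> cos x"
      using x that pi_gt3 by (intro cos_monotone_0_pi_le) auto
    then have "t * (1 / 2) \<le> t * cos x" using that by (intro mult_left_mono) (auto simp: cos_60)
    then show ?thesis using x(3) by simp
  qed
  consider "t = 0" | "t > 0" | "t < 0" by linarith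
  then show ?thesis
  proof cases
    case 2 then show ?thesis using pos[of t] assms by linarith
  next
    case 3 then show ?thesis using pos[of "- t"] assms by simp
  qed simp
qed

text \<open>For x = a + i b one has |e^x - 1|^2 = (e^a - 1)^2 + 4 e^a sin(b/2)^2, and the two terms
  dominate multiples of a^2 and b^2, respectively, when a >= 0 and |b| <= 1.\<close>

lemma norm_le_exp_minus_one:
  fixes x :: complex
  assumes "Re x \<ge> 0" "\<bar>Im x\<bar> \<le> 1"
  shows "norm x \<le> 2 * norm (exp x - 1)"
proof (rule power2_le_imp_le)
  define a b where "a = Re x" and "b = Im x"
  have "(norm (exp x - 1))\<^sup>2 = (exp a * cos b - 1)\<^sup>2 + (exp a * sin b)\<^sup>2"
    by (simp add: cmod_power2 Re_exp Im_exp a_def b_def)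
  also have "\<dots> = (exp a)\<^sup>2 * ((cos b)\<^sup>2 + (sin b)\<^sup>2) - 2 * exp a * cos b + 1"
    by algebra
  also have "(cos b)\<^sup>2 + (sin b)\<^sup>2 = 1" by simp
  also have "(exp a)\<^sup>2 * 1 - 2 * exp a * cos b + 1 = (exp a - 1)\<^sup>2 + 2 * exp a * (1 - cos b)"
    by (simp add: power2_eq_square algebra_simps)
  also have "1 - cos b = 2 * (sin (b / 2))\<^sup>2" using cos_double_sin[of "b / 2"] by simp
  finally have eq: "(norm (exp x - 1))\<^sup>2 = (exp a - 1)\<^sup>2 + 4 * (exp a * (sin (b / 2))\<^sup>2)" by simp
  have a: "a \<ge> 0" "exp a \<ge> 1" using assms by (auto simp: a_def)
  have "a \<le> exp a - 1" using exp_ge_add_one_self[of a] by linarith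
  then have "a\<^sup>2 \<le> (exp a - 1)\<^sup>2" using a by (intro power_mono)
  also have "\<dots> \<le> 4 * (exp a - 1)\<^sup>2"
    by (rule order_trans[of _ "1 * (exp a - 1)\<^sup>2"]) (simp, intro mult_right_mono, auto)
  finally have a4: "a\<^sup>2 \<le> 4 * (exp a - 1)\<^sup>2" .
  have "b\<^sup>2 / 16 \<le> (sin (b / 2))\<^sup>2"
  proof -
    have "\<bar>b / 4\<bar> \<le> \<bar>sin (b / 2)\<bar>" using sin_ge_half[of "b / 2"] assms by (simp add: b_def)
    then have "(b / 4)\<^sup>2 \<le> (sin (b / 2))\<^sup>2" by (simp only: abs_le_square_iff)
    then show ?thesis by (simp add: power_divide)
  qed
  moreover define E where "E = exp a * (sin (b / 2))\<^sup>2"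
  have "1 * (sin (b / 2))\<^sup>2 \<le> E"
    unfolding E_def using a by (intro mult_right_mono) auto
  ultimately have "b\<^sup>2 \<le> 16 * E" by auto
  with a4 have "a\<^sup>2 + b\<^sup>2 \<le> 4 * (norm (exp x - 1))\<^sup>2" unfolding eq E_def[symmetric] by simp
  then show "(norm x)\<^sup>2 \<le> (2 * norm (exp x - 1))\<^sup>2"
    by (simp add: cmod_power2 power_mult_distrib a_def b_def)
qed simp

text \<open>A logarithm has Lipschitz constant 2/\<mu> on |w| >= \<mu> as long as the imaginary
  parts differ by at most 1. This is the reason why code letters also record a unit strip.\<close>

lemma norm_diff_le_exp_diff:
  fixes x y :: complex
  assumes "\<bar>Im x - Im y\<bar> \<le> 1" "\<mu> \<le> norm (exp x)" "\<mu> \<le> norm (exp y)"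
  shows "norm (x - y) * \<mu> \<le> 2 * norm (exp x - exp y)"
proof -
  have *: "norm (x - y) * \<mu> \<le> 2 * norm (exp x - exp y)"
    if "Re y \<le> Re x" "\<bar>Im x - Im y\<bar> \<le> 1" "\<mu> \<le> norm (exp y)" for x y :: complex
  proof -
    have "norm (x - y) * \<mu> \<le> norm (x - y) * norm (exp y)" using that by (intro mult_left_mono) auto
    also have "\<dots> \<le> 2 * norm (exp (x - y) - 1) * norm (exp y)"
      using norm_le_exp_minus_one[of "x - y"] that by (intro mult_right_mono) auto
    also have "\<dots> = 2 * norm ((exp (x - y) - 1) * exp y)" by (simp only: norm_mult mult.assoc)
    also have "(exp (x - y) - 1) * exp y = exp x - exp y" by (simp add: algebra_simps flip: exp_add)
    finally show ?thesis .
  qed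
  show ?thesis
    using *[of y x] *[of x y] assms by (cases "Re y \<le> Re x") (auto simp: norm_minus_commute)
qed

text \<open>A logarithm of an injective zero-free function maps onto no two points differing by
  \<open>2 * pi * \<i>\<close>, so Bloch's theorem bounds its derivative.\<close>

lemma injective_zero_free_distortion:
  fixes \<Psi> :: "complex \<Rightarrow> complex"
  assumes hol: "\<Psi> holomorphic_on ball 0 r" and inj: "inj_on \<Psi> (ball 0 r)" and r: "r > 0"
    and nz: "\<And>u. u \<in> ball 0 r \<Longrightarrow> \<Psi> u \<noteq> 0" and u: "norm u \<le> r / 2"
  shows "norm (\<Psi> u) \<le> exp (12 * pi) * norm (\<Psi> 0)" "norm (\<Psi> 0) \<le> exp (12 * pi) * norm (\<Psi> u)"
proof -
  obtain L where L: "L holomorphic_on ball 0 r" "\<And>w. w \<in> ball 0 r \<Longrightarrow> \<Psi> w = exp (L w)"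
    using contractible_imp_holomorphic_log[OF hol convex_imp_contractible[OF convex_ball]] nz by blast
  have bound: "norm (deriv L v) \<le> 24 * pi / r" if v: "v \<in> cball 0 (r / 2)" for v
  proof (rule ccontr)
    assume "\<not> norm (deriv L v) \<le> 24 * pi / r"
    \<comment> \<open>The radius of the disc that Bloch's theorem, with constant 1/12, finds in the
      image of \<open>L\<close>. As it exceeds pi, the disc contains two points differing by 2 pi
      i.\<close>
    define \<sigma> where "\<sigma> = r / 2 * norm (deriv L v) / 12"
    have \<sigma>: "\<sigma> > pi" using \<open>\<not> _\<close> r by (simp add: \<sigma>_def field_simps)
    have sub: "ball v (r / 2) \<subseteq> ball 0 r" using v by (simp add: ball_subset_ball_iff)
    obtain b where b: "ball b \<sigma> \<subseteq> L ` ball v (r / 2)"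
      using Bloch[OF holomorphic_on_subset[OF L(1) sub], of \<sigma>] r unfolding \<sigma>_def by auto
    have "b + pi * \<i> \<in> ball b \<sigma>" "b - pi * \<i> \<in> ball b \<sigma>"
      using \<sigma> by (auto simp: dist_norm norm_mult)
    then have im: "b + pi * \<i> \<in> L ` ball v (r / 2)" "b - pi * \<i> \<in> L ` ball v (r / 2)"
      using b by (simp_all only: subset_iff)
    obtain x where x: "b + pi * \<i> = L x" "x \<in> ball v (r / 2)" using im(1) by (rule imageE)
    obtain y where y: "b - pi * \<i> = L y" "y \<in> ball v (r / 2)" using im(2) by (rule imageE)
    have "exp (L x) = exp (L y)" by (simp add: exp_add exp_diff flip: x(1) y(1))
    then have "\<Psi> x = \<Psi> y" using L(2)[OF subsetD[OF sub x(2)]] L(2)[OF subsetD[OF sub y(2)]] by simp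
    then have "x = y" by (rule inj_onD[OF inj _ subsetD[OF sub x(2)] subsetD[OF sub y(2)]])
    then have "b + pi * \<i> = b - pi * \<i>" using x(1) y(1) by simp
    then show False by (simp add: complex_eq_iff)
  qed
  have "norm (L u - L 0) \<le> 24 * pi / r * norm (u - 0)"
  proof (rule field_differentiable_bound[of "cball 0 (r / 2)" L "deriv L"])
    fix v :: complex assume "v \<in> cball 0 (r / 2)"
    then show "norm (deriv L v) \<le> 24 * pi / r" by (rule bound)
    have "v \<in> ball 0 r" using \<open>v \<in> _\<close> r by simp
    then show "(L has_field_derivative deriv L v) (at v within cball 0 (r / 2))"
      using holomorphic_derivI[OF L(1) open_ball] has_field_derivative_at_within by blast
  qed (use u r in auto)
  also have "\<dots> \<le> 24 * pi / r * (r / 2)" using u r by (intro mult_left_mono) auto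
  also have "\<dots> = 12 * pi" using r by simp
  finally have "\<bar>Re (L u - L 0)\<bar> \<le> 12 * pi" using abs_Re_le_cmod order_trans by blast
  then have *: "Re (L u) \<le> 12 * pi + Re (L 0)" "Re (L 0) \<le> 12 * pi + Re (L u)" by auto
  have n: "norm (\<Psi> u) = exp (Re (L u))" "norm (\<Psi> 0) = exp (Re (L 0))" using L(2) u r by auto
  show "norm (\<Psi> u) \<le> exp (12 * pi) * norm (\<Psi> 0)" "norm (\<Psi> 0) \<le> exp (12 * pi) * norm (\<Psi> u)"
    using * unfolding n by (simp_all flip: exp_add)
qed

lemma disjoint_discs_area:
  fixes b :: "'a \<Rightarrow> complex"
  assumes A: "finite A" "disjoint_family_on (\<lambda>a. ball (b a) (\<sigma> a)) A"
    and \<sigma>: "\<And>a. a \<in> A \<Longrightarrow> \<sigma> a \<ge> 0" and sub: "\<And>a. a \<in> A \<Longrightarrow> ball (b a) (\<sigma> a) \<subseteq> cball 0 S" and S: "S \<ge> 0"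
  shows "(\<Sum>a\<in>A. (\<sigma> a)\<^sup>2) \<le> S\<^sup>2"
proof -
  define V where "V = unit_ball_vol (real DIM(complex))"
  have V: "V > 0" by (simp add: V_def)
  have "(\<Sum>a\<in>A. V * (\<sigma> a)\<^sup>2) = (\<Sum>a\<in>A. measure lborel (ball (b a) (\<sigma> a)))"
    using \<sigma> by (intro sum.cong) (auto simp: content_ball V_def)
  also have "\<dots> = measure lborel (\<Union>a\<in>A. ball (b a) (\<sigma> a))"
  proof (rule measure_finite_Union[symmetric])
    show "emeasure lborel (ball (b a) (\<sigma> a)) \<noteq> \<infinity>" for a
      using emeasure_lborel_ball_finite[of "b a" "\<sigma> a"] by simp
  qed (use A in auto)
  also have "\<dots> \<le> measure lborel (cball (0::complex) S)"
    by (rule measure_mono_fmeasurable) (use sub A in \<open>auto intro!: fmeasurableI emeasure_lborel_cball_finite sets.finite_UN\<close>)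
  also have "\<dots> = V * S\<^sup>2" using S by (simp add: content_cball V_def)
  finally have "V * (\<Sum>a\<in>A. (\<sigma> a)\<^sup>2) \<le> V * S\<^sup>2" by (simp add: sum_distrib_left)
  then show ?thesis using V by simp
qed

section \<open>Sizes of tracts\<close>

context tracts begin

definition tract_pole :: "complex \<Rightarrow> bool" where
  "tract_pole a \<longleftrightarrow> (\<exists>\<Psi>. chart a \<Psi>)"

definition tract_map :: "complex \<Rightarrow> complex \<Rightarrow> complex" where
  "tract_map a = (SOME \<Psi>. chart a \<Psi>)"

text \<open>Taking the maximum over the quarter disc, rather than the derivative at 0, makes the
  upper bound for the derivative true by definition, while Bloch's theorem at a maximum point still
  yields a disc of comparable radius. The factor \<open>radius a\<close> makes the quantity
  independent of the scale of \<open>u\<close>.\<close>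

definition tract_size :: "complex \<Rightarrow> real" where
  "tract_size a = radius a *
     (SUP u\<in>cball 0 (radius a / 4). norm (deriv (tract_map a) u))"

lemma chart_tract_map: "tract_pole a \<Longrightarrow> chart a (tract_map a)"
  unfolding tract_pole_def tract_map_def by (rule someI_ex[of "chart a"])

lemma norm_exp_le_rad_quarter:
  assumes "m \<ge> 1" "m \<le> M" "Re \<zeta> \<ge> ln R + real M * ln 4"
  shows "norm (exp (- \<zeta> / of_nat m)) \<le> rad m / 4"
proof -
  have "real m * ln 4 \<le> real M * ln 4" using assms by (intro mult_right_mono) auto
  then have "Re \<zeta> - ln R \<ge> real m * ln 4" using assms by linarith
  then have "- (Re \<zeta> / real m) \<le> - ln R / real m - ln 4" using assms(1) by (simp add: field_simps)
  then have "exp (- (Re \<zeta> / real m)) \<le> exp (- ln R / real m - ln 4)" by (simp only: exp_le_cancel_iff)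
  then show ?thesis by (simp add: rad_def exp_diff)
qed

context
  fixes a :: complex
  assumes a: "tract_pole a"
begin

lemma tract_map_holomorphic: "tract_map a holomorphic_on ball 0 (radius a)"
  using chart_tract_map[OF a] by (simp add: chart_def)

lemma deriv_attained:
  "\<exists>u\<in>cball 0 (radius a / 4). tract_size a = radius a * norm (deriv (tract_map a) u) \<and>
     (\<forall>v\<in>cball 0 (radius a / 4). norm (deriv (tract_map a) v) \<le> norm (deriv (tract_map a) u))"
proof -
  define r where "r = radius a"
  have r: "r > 0" by (simp add: r_def)
  have "continuous_on (ball 0 r) (deriv (tract_map a))"
    using tract_map_holomorphic unfolding r_def
    by (intro holomorphic_on_imp_continuous_on holomorphic_deriv) auto
  then have "continuous_on (cball 0 (r / 4)) (\<lambda>u. norm (deriv (tract_map a) u))"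
    by (intro continuous_on_norm) (rule continuous_on_subset, use r in auto)
  from continuous_attains_sup[OF compact_cball _ this] r obtain u where
    u: "u \<in> cball 0 (r / 4)" "\<And>v. v \<in> cball 0 (r / 4) \<Longrightarrow> norm (deriv (tract_map a) v) \<le> norm (deriv (tract_map a) u)"
    by auto
  have "(SUP u\<in>cball 0 (r / 4). norm (deriv (tract_map a) u)) = norm (deriv (tract_map a) u)"
    by (rule cSup_eq_maximum) (use u in auto)
  then show ?thesis using u unfolding tract_size_def r_def by (intro bexI[of _ u] conjI ballI) simp_all
qed

lemma tract_size_nonneg: "tract_size a \<ge> 0"
  using deriv_attained by (auto intro!: mult_nonneg_nonneg less_imp_le[OF rad_pos])

lemma deriv_tract_map_le:
  assumes "u \<in> cball 0 (radius a / 4)"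
  shows "radius a * norm (deriv (tract_map a) u) \<le> tract_size a"
  using deriv_attained assms by (metis mult_left_mono rad_pos less_imp_le)

text \<open>Bloch's theorem, with constant 1/12, is applied to the disc of radius r/4 about a point
  where the derivative is maximal on the quarter disc; 48 is the product of 4 and 12. That disc lies
  in the half disc, where \<open>tract_map_distortion\<close> holds.\<close>

lemma tract_contains_disc:
  "\<exists>b. ball b (tract_size a / 48) \<subseteq> tract_map a ` ball 0 (radius a / 2)"
proof -
  define r where "r = radius a"
  have r: "r > 0" by (simp add: r_def)
  obtain u where u: "u \<in> cball 0 (r / 4)" "tract_size a = r * norm (deriv (tract_map a) u)"
    using deriv_attained unfolding r_def by blast
  have sub: "ball u (r / 4) \<subseteq> ball 0 (r / 2)" using u(1) by (simp add: ball_subset_ball_iff)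
  have "ball 0 (r / 2) \<subseteq> ball (0::complex) r" using r by auto
  then have "tract_map a holomorphic_on ball u (r / 4)"
    using tract_map_holomorphic sub unfolding r_def by (meson holomorphic_on_subset order_trans)
  then obtain b where "ball b (tract_size a / 48) \<subseteq> tract_map a ` ball u (r / 4)"
    by (rule Bloch[where r' = "tract_size a / 48"]) (use r u in auto)
  then show ?thesis using sub unfolding r_def by blast
qed

lemma tract_map_diff_le:
  assumes "u \<in> cball 0 (radius a / 4)" "v \<in> cball 0 (radius a / 4)"
  shows "norm (tract_map a u - tract_map a v) \<le> tract_size a"
proof -
  define r where "r = radius a"
  have r: "r > 0" by (simp add: r_def)
  have uv: "u \<in> cball 0 (r / 4)" "v \<in> cball 0 (r / 4)" using assms by (auto simp: r_def)
  have "norm (tract_map a u - tract_map a v) \<le> tract_size a / r * norm (u - v)"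
  proof (rule field_differentiable_bound[of "cball 0 (r / 4)" _ "deriv (tract_map a)"])
    fix w :: complex assume w: "w \<in> cball 0 (r / 4)"
    then have "w \<in> ball 0 r" using r by simp
    then show "(tract_map a has_field_derivative deriv (tract_map a) w) (at w within cball 0 (r / 4))"
      using holomorphic_derivI[OF tract_map_holomorphic open_ball] has_field_derivative_at_within
      unfolding r_def by blast
    show "norm (deriv (tract_map a) w) \<le> tract_size a / r"
      using deriv_tract_map_le w r by (simp add: r_def field_simps)
  qed (use uv in auto)
  also have "\<dots> \<le> tract_size a / r * r"
  proof (rule mult_left_mono)
    show "norm (u - v) \<le> r" using norm_triangle_ineq4[of u v] uv r by simp
  qed (use tract_size_nonneg r in auto)
  finally show ?thesis using r by simp
qed

text \<open>Off its pole a tract consists of points with |f| > R, whereas |f 0| <= R.\<close>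

lemma tract_map_nonzero:
  assumes "a \<noteq> 0" "u \<in> ball 0 (radius a)"
  shows "tract_map a u \<noteq> 0"
proof
  assume z: "tract_map a u = 0"
  have c: "chart a (tract_map a)" by (rule chart_tract_map[OF a])
  show False
  proof (cases "u = 0")
    case True then show False using c z assms by (simp add: chart_def)
  next
    case False
    define m where "m = pole_mult f a"
    have m: "m \<ge> 1" using c by (simp add: chart_def m_def)
    have "f 0 * u ^ m = 1" using c z assms False unfolding chart_def m_def by force
    then have "norm (f 0) * norm u ^ m = 1" by (metis norm_mult norm_one norm_power)
    moreover have "norm u ^ m < rad m ^ m"
      using assms m False by (intro power_strict_mono) (auto simp: m_def)
    moreover have "rad m ^ m = exp (- ln R)" using m by (simp add: rad_def flip: exp_of_nat_mult)
    then have "rad m ^ m = 1 / R" using R_pos by (simp add: exp_minus inverse_eq_divide)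
    moreover have "norm (f 0) * norm u ^ m \<le> R * norm u ^ m" using f_0 by (intro mult_right_mono) auto
    ultimately have "1 < R * (1 / R)" using R_pos by (smt (verit) mult_strict_left_mono)
    then show False using R_pos by simp
  qed
qed

lemma tract_map_distortion:
  assumes "a \<noteq> 0" "norm u \<le> radius a / 2"
  shows "norm (tract_map a u) \<le> exp (12 * pi) * norm a" "norm a \<le> exp (12 * pi) * norm (tract_map a u)"
  using injective_zero_free_distortion[OF tract_map_holomorphic _ rad_pos tract_map_nonzero[OF assms(1)] assms(2)]
    chart_tract_map[OF a] by (auto simp: chart_def)

text \<open>In the coordinate \<zeta> the derivative is at most |\<Psi>'(u)| |u| with |u| = exp(-Re
  \<zeta>/m), relative to the radius of the chart this decays slowest for m = M, and the bound on
  \<open>x0\<close> keeps u in the quarter disc. For x0 = ln \<mu> the constant is the size times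
  (R/\<mu>)^(1/M).\<close>

lemma tract_map_exp_Lipschitz:
  assumes m: "pole_mult f a \<le> M" and x0: "x0 \<ge> ln R + M * ln 4"
    and \<zeta>: "Re \<zeta> \<ge> x0" "Re \<zeta>' \<ge> x0"
  shows "norm (tract_map a (exp (- \<zeta> / of_nat (pole_mult f a))) - tract_map a (exp (- \<zeta>' / of_nat (pole_mult f a))))
    \<le> tract_size a * exp (- (x0 - ln R) / M) * norm (\<zeta> - \<zeta>')"
proof -
  define m where "m = pole_mult f a"
  have m1: "m \<ge> 1" using chart_tract_map[OF a] by (simp add: chart_def m_def)
  have mM: "m \<le> M" using m by (simp add: m_def)
  have "norm (tract_map a (exp (- \<zeta> / of_nat m)) - tract_map a (exp (- \<zeta>' / of_nat m)))
    \<le> tract_size a * exp (- (x0 - ln R) / M) * norm (\<zeta> - \<zeta>')"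
  proof (rule field_differentiable_bound[of "{v. Re v \<ge> x0}" "\<lambda>v. tract_map a (exp (- v / of_nat m))"
      "\<lambda>v. deriv (tract_map a) (exp (- v / of_nat m)) * (exp (- v / of_nat m) * (- 1 / of_nat m))"])
    fix v :: complex assume "v \<in> {v. Re v \<ge> x0}"
    then have v: "Re v \<ge> x0" by simp
    define u where "u = exp (- v / of_nat m)"
    have u4: "norm u \<le> rad m / 4"
      unfolding u_def using m1 mM v x0 by (intro norm_exp_le_rad_quarter) auto
    then have u: "u \<in> ball 0 (rad m)" using rad_pos[of m] by (simp only: mem_ball dist_0_norm)
    show "((\<lambda>v. tract_map a (exp (- v / of_nat m))) has_field_derivative
        deriv (tract_map a) (exp (- v / of_nat m)) * (exp (- v / of_nat m) * (- 1 / of_nat m))) (at v within {v. Re v \<ge> x0})"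
    proof (rule DERIV_chain2[of "tract_map a" _ "\<lambda>v. exp (- v / of_nat m)"])
      show "(tract_map a has_field_derivative deriv (tract_map a) (exp (- v / of_nat m))) (at (exp (- v / of_nat m)))"
        using holomorphic_derivI[OF tract_map_holomorphic open_ball] u unfolding u_def m_def by blast
      show "((\<lambda>v. exp (- v / of_nat m)) has_field_derivative exp (- v / of_nat m) * (- 1 / of_nat m)) (at v within {v. Re v \<ge> x0})"
        using m1 by (auto intro!: derivative_eq_intros)
    qed
    have "norm (deriv (tract_map a) u * (u * (- 1 / of_nat m))) = norm (deriv (tract_map a) u) * (norm u / real m)"
      by (simp add: norm_mult norm_divide)
    also have "\<dots> \<le> tract_size a / rad m * (norm u / 1)"
    proof (rule mult_mono)
      show "norm (deriv (tract_map a) u) \<le> tract_size a / rad m"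
        using deriv_tract_map_le[of u] u4 by (simp add: m_def field_simps)
      show "norm u / real m \<le> norm u / 1" using m1 by (intro divide_left_mono) auto
    qed (use tract_size_nonneg rad_pos[of m] in \<open>auto intro!: divide_nonneg_pos\<close>)
    also have "\<dots> = tract_size a * exp (- (Re v - ln R) / real m)"
    proof -
      have "norm u = exp (- (Re v / real m))" by (simp add: u_def)
      then show ?thesis by (simp add: rad_def diff_divide_distrib exp_diff exp_minus field_simps)
    qed
    also have "\<dots> \<le> tract_size a * exp (- (x0 - ln R) / M)"
    proof (rule mult_left_mono[OF _ tract_size_nonneg])
      have "0 \<le> real M * ln 4" by simp
      then have x: "0 \<le> x0 - ln R" using x0 by linarith
      have "(x0 - ln R) / real M \<le> (x0 - ln R) / real m"
        using m1 mM x by (intro divide_left_mono) auto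
      also have "\<dots> \<le> (Re v - ln R) / real m" using v m1 by (intro divide_right_mono) auto
      finally show "exp (- (Re v - ln R) / real m) \<le> exp (- (x0 - ln R) / real M)"
        by (simp only: exp_le_cancel_iff minus_divide_left[symmetric] neg_le_iff_le)
    qed
    finally show "norm (deriv (tract_map a) (exp (- v / of_nat m)) * (exp (- v / of_nat m) * (- 1 / of_nat m)))
        \<le> tract_size a * exp (- (x0 - ln R) / M)"
      by (simp only: u_def)
  qed (use \<zeta> in \<open>auto simp: convex_halfspace_Re_ge\<close>)
  then show ?thesis by (simp add: m_def)
qed

end

lemma tract_size_square_sum:
  assumes A: "finite A" "\<And>a. a \<in> A \<Longrightarrow> tract_pole a \<and> a \<noteq> 0 \<and> norm a \<le> s" and s: "s \<ge> 0"
  shows "(\<Sum>a\<in>A. (tract_size a)\<^sup>2) \<le> (48 * exp (12 * pi) * s)\<^sup>2"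
proof -
  have "\<forall>a. \<exists>b. tract_pole a \<longrightarrow> ball b (tract_size a / 48) \<subseteq> tract_map a ` ball 0 (radius a / 2)"
    using tract_contains_disc by blast
  then obtain b where b: "\<And>a. tract_pole a \<Longrightarrow> ball (b a) (tract_size a / 48) \<subseteq> tract_map a ` ball 0 (radius a / 2)"
    by metis
  have "(\<Sum>a\<in>A. (tract_size a / 48)\<^sup>2) \<le> (exp (12 * pi) * s)\<^sup>2"
  proof (rule disjoint_discs_area[OF A(1)])
    show "disjoint_family_on (\<lambda>a. ball (b a) (tract_size a / 48)) A"
      unfolding disjoint_family_on_def
    proof (intro ballI impI)
      fix x y assume xy: "x \<in> A" "y \<in> A" "x \<noteq> y"
      show "ball (b x) (tract_size x / 48) \<inter> ball (b y) (tract_size y / 48) = {}"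
      proof (rule ccontr)
        assume "\<not> ?thesis"
        then obtain w where w: "w \<in> ball (b x) (tract_size x / 48)" "w \<in> ball (b y) (tract_size y / 48)" by blast
        have t: "tract_pole x" "tract_pole y" using A(2) xy by auto
        obtain u v where uv: "w = tract_map x u" "u \<in> ball 0 (radius x / 2)"
          "w = tract_map y v" "v \<in> ball 0 (radius y / 2)"
          using b[OF t(1)] b[OF t(2)] w by blast
        have "u \<in> ball 0 (radius x)" "v \<in> ball 0 (radius y)"
          using uv rad_pos[of "pole_mult f x"] rad_pos[of "pole_mult f y"] by (auto simp del: rad_pos)
        then have "x = y" using charts_disjoint[OF chart_tract_map[OF t(1)] chart_tract_map[OF t(2)]] uv by metis
        then show False using xy by simp
      qed
    qed
    fix x assume x: "x \<in> A"
    then have t: "tract_pole x" "x \<noteq> 0" "norm x \<le> s" using A(2) by auto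
    show "0 \<le> tract_size x / 48" using tract_size_nonneg[OF t(1)] by simp
    show "ball (b x) (tract_size x / 48) \<subseteq> cball 0 (exp (12 * pi) * s)"
    proof
      fix w assume "w \<in> ball (b x) (tract_size x / 48)"
      then obtain u where u: "w = tract_map x u" "u \<in> ball 0 (radius x / 2)" using b[OF t(1)] by blast
      then have "norm w \<le> exp (12 * pi) * norm x" using tract_map_distortion(1)[OF t(1,2), of u] by simp
      also have "\<dots> \<le> exp (12 * pi) * s" using t by simp
      finally show "w \<in> cball 0 (exp (12 * pi) * s)" by simp
    qed
  qed (use s in auto)
  then have "(\<Sum>a\<in>A. (tract_size a)\<^sup>2) / 48\<^sup>2 \<le> (exp (12 * pi) * s)\<^sup>2"
    by (simp add: power_divide sum_divide_distrib)
  then show ?thesis by (simp add: power_mult_distrib field_simps)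
qed

end

section \<open>Gauge functions and null sets\<close>

abbreviation iexp :: "nat \<Rightarrow> real \<Rightarrow> real" where "iexp n \<equiv> exp ^^ n"

lemma iexp_mono: "x \<le> y \<Longrightarrow> iexp n x \<le> iexp n y"
  by (induction n) auto

lemma iexp_ge: "x \<le> iexp n x"
proof (induction n)
  case (Suc n)
  have "iexp n x \<le> exp (iexp n x)" using exp_ge_add_one_self[of "iexp n x"] by linarith
  then show ?case using Suc by simp
qed simp

text \<open>By induction: the outer exponential turns the product into a sum, and x + y <= x y for
  x, y >= 2.\<close>

lemma iexp_mult:
  assumes "x \<ge> 2" "y \<ge> 2"
  shows "iexp n x * iexp n y \<le> iexp n (x * y)"
proof (induction n)
  case (Suc n)
  have ge: "iexp n x \<ge> 2" "iexp n y \<ge> 2" using iexp_ge[of x n] iexp_ge[of y n] assms by auto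
  have "0 \<le> (iexp n x - 1) * (iexp n y - 1) - 1"
    using mult_mono[of 1 "iexp n x - 1" 1 "iexp n y - 1"] ge by simp
  then have "iexp n x + iexp n y \<le> iexp n x * iexp n y" by (simp add: algebra_simps)
  also have "\<dots> \<le> iexp n (x * y)" by (rule Suc)
  finally show ?case by (simp flip: exp_add)
qed simp

text \<open>The lower bound by an iterated exponential keeps the argument of each successive
  logarithm positive, away from the default values of \<open>ln\<close>.\<close>

lemma iexp_le_imp_le_iln:
  assumes "iexp n a \<le> t"
  shows "a \<le> (ln ^^ n) t"
  using assms
proof (induction n arbitrary: t)
  case (Suc n)
  then have t: "exp (iexp n a) \<le> t" by simp
  then have "t > 0" using exp_gt_zero less_le_trans by blast
  then have "iexp n a \<le> ln t" using t by (simp add: ln_ge_iff)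
  then show ?case using Suc.IH by (simp add: funpow_swap1)
qed simp

lemma iln_mono:
  assumes "iexp n a \<le> s" "s \<le> t"
  shows "(ln ^^ n) s \<le> (ln ^^ n) t"
  using assms
proof (induction n arbitrary: s t)
  case (Suc n)
  then have s: "exp (iexp n a) \<le> s" by simp
  then have "s > 0" using exp_gt_zero less_le_trans by blast
  then have "iexp n a \<le> ln s" "ln s \<le> ln t" using s Suc.prems(2) by (auto simp: ln_ge_iff)
  then show ?case using Suc.IH by (simp add: funpow_swap1)
qed simp

lemma iln_iexp: "(ln ^^ n) (iexp n x) = x"
proof (induction n)
  case (Suc n)
  have "(ln ^^ Suc n) (iexp (Suc n) x) = (ln ^^ n) (ln (exp (iexp n x)))" by (simp add: funpow_swap1[of ln])
  then show ?case using Suc by simp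
qed simp

lemma iln_le:
  assumes "iexp n a \<le> t" "t \<le> iexp n b"
  shows "(ln ^^ n) t \<le> b"
  using iln_mono[OF assms] by (simp add: iln_iexp)

text \<open>Measure zero expressed through covers alone, so that countable unions and Lipschitz maps
  can be treated without the limit in \<open>hausdorff_measure\<close>.\<close>

definition h_null :: "(real \<Rightarrow> real) \<Rightarrow> complex set \<Rightarrow> bool" where
  "h_null h A \<longleftrightarrow> (\<forall>\<delta>>0. \<forall>\<epsilon>>0. \<exists>B. delta_cover \<delta> A B \<and> (\<Sum>j. ennreal (h (diameter (B j)))) \<le> ennreal \<epsilon>)"

lemma hausdorff_measure_eq_0:
  assumes "h_null h A"
  shows "hausdorff_measure h A = 0"
proof -
  have "(INF B \<in> {B. delta_cover \<delta> A B}. \<Sum>j. ennreal (h (diameter (B j)))) = 0" if "\<delta> > 0" for \<delta>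
  proof -
    have "(INF B \<in> {B. delta_cover \<delta> A B}. \<Sum>j. ennreal (h (diameter (B j)))) \<le> 0 + ennreal \<epsilon>" if "\<epsilon> > 0" for \<epsilon>
    proof -
      obtain B where "delta_cover \<delta> A B" "(\<Sum>j. ennreal (h (diameter (B j)))) \<le> ennreal \<epsilon>"
        using assms \<open>\<delta> > 0\<close> \<open>\<epsilon> > 0\<close> unfolding h_null_def by blast
      then show ?thesis by (intro INF_lower2[of B]) auto
    qed
    then have "(INF B \<in> {B. delta_cover \<delta> A B}. \<Sum>j. ennreal (h (diameter (B j)))) \<le> 0"
      by (rule ennreal_le_epsilon)
    then show ?thesis by simp
  qed
  then have "\<forall>\<^sub>F \<delta> in at_right 0. (INF B \<in> {B. delta_cover \<delta> A B}. \<Sum>j. ennreal (h (diameter (B j)))) = 0"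
    by (auto simp: eventually_at_right_field intro!: exI[of _ 1])
  then have "((\<lambda>\<delta>. INF B \<in> {B. delta_cover \<delta> A B}. \<Sum>j. ennreal (h (diameter (B j)))) \<longlongrightarrow> 0) (at_right 0)"
    by (rule tendsto_eventually)
  then show ?thesis unfolding hausdorff_measure_def by (intro tendsto_Lim) auto
qed

lemma h_null_mono: "h_null h A \<Longrightarrow> A' \<subseteq> A \<Longrightarrow> h_null h A'"
  unfolding h_null_def delta_cover_def by (meson subset_trans)

lemma h_null_UN_nat:
  fixes A :: "nat \<Rightarrow> complex set"
  assumes "\<And>i. h_null h (A i)"
  shows "h_null h (\<Union>i. A i)"
  unfolding h_null_def
proof (intro allI impI)
  fix \<delta> \<epsilon> :: real assume "\<delta> > 0" "\<epsilon> > 0"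
  have "\<forall>i. \<exists>B. delta_cover \<delta> (A i) B \<and> (\<Sum>j. ennreal (h (diameter (B j)))) \<le> ennreal (\<epsilon> * (1/2)^Suc i)"
    using assms \<open>\<delta> > 0\<close> \<open>\<epsilon> > 0\<close> unfolding h_null_def by auto
  then obtain B where B: "\<And>i. delta_cover \<delta> (A i) (B i)"
    "\<And>i. (\<Sum>j. ennreal (h (diameter (B i j)))) \<le> ennreal (\<epsilon> * (1/2)^Suc i)" by metis
  define C where "C k = (case prod_decode k of (i, j) \<Rightarrow> B i j)" for k
  have "(\<Union>i. A i) \<subseteq> (\<Union>k. C k)"
  proof safe
    fix z i assume "z \<in> A i"
    then obtain j where "z \<in> B i j" using B(1)[of i] by (auto simp: delta_cover_def)
    then show "z \<in> (\<Union>k. C k)" by (intro UN_I[of "prod_encode (i, j)"]) (auto simp: C_def)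
  qed
  moreover have "bounded (C k) \<and> diameter (C k) \<le> \<delta>" for k
    using B(1) by (auto simp: C_def delta_cover_def split: prod.split)
  ultimately have "delta_cover \<delta> (\<Union>i. A i) C" by (simp add: delta_cover_def)
  moreover have "(\<Sum>k. ennreal (h (diameter (C k)))) \<le> ennreal \<epsilon>"
  proof -
    have "(\<Sum>k. ennreal (h (diameter (C k)))) = (\<Sum>k. (\<lambda>(i, j). ennreal (h (diameter (B i j)))) (prod_decode k))"
      by (intro suminf_cong) (auto simp: C_def split: prod.split)
    also have "\<dots> = (\<Sum>i. \<Sum>j. ennreal (h (diameter (B i j))))"
      by (rule suminf_ennreal_2dimen) simp
    also have "\<dots> \<le> (\<Sum>i. ennreal (\<epsilon> * (1/2)^Suc i))" by (intro suminf_le B(2)) auto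
    also have "\<dots> = ennreal \<epsilon>"
    proof (rule suminf_ennreal_eq)
      show "(\<lambda>i. \<epsilon> * (1/2)^Suc i) sums \<epsilon>"
        using sums_mult[OF power_half_series, of \<epsilon>] by simp
    qed (use \<open>\<epsilon> > 0\<close> in auto)
    finally show ?thesis .
  qed
  ultimately show "\<exists>B. delta_cover \<delta> (\<Union>i. A i) B \<and> (\<Sum>j. ennreal (h (diameter (B j)))) \<le> ennreal \<epsilon>" by blast
qed

lemma sum_prod_list_lists:
  fixes \<phi> :: "'x \<Rightarrow> real"
  assumes "finite F"
  shows "(\<Sum>xs | set xs \<subseteq> F \<and> length xs = l. prod_list (map \<phi> xs)) = (sum \<phi> F) ^ l"
proof (induction l)
  case 0
  have "{xs. set xs \<subseteq> F \<and> length xs = 0} = {[]}" by auto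
  then show ?case by simp
next
  case (Suc l)
  let ?L = "\<lambda>l. {xs. set xs \<subseteq> F \<and> length xs = l}"
  have "(\<Sum>xs\<in>?L (Suc l). prod_list (map \<phi> xs)) = (\<Sum>p\<in>F \<times> ?L l. \<phi> (fst p) * prod_list (map \<phi> (snd p)))"
  proof (rule sum.reindex_bij_witness[of _ "\<lambda>p. fst p # snd p" "\<lambda>xs. (hd xs, tl xs)"])
    fix xs assume "xs \<in> ?L (Suc l)"
    then obtain x ys where "xs = x # ys" by (cases xs) auto
    then show "fst (hd xs, tl xs) # snd (hd xs, tl xs) = xs" "(hd xs, tl xs) \<in> F \<times> ?L l"
      "\<phi> (fst (hd xs, tl xs)) * prod_list (map \<phi> (snd (hd xs, tl xs))) = prod_list (map \<phi> xs)"
      using \<open>xs \<in> _\<close> by auto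
  qed auto
  also have "\<dots> = sum \<phi> F * (\<Sum>xs\<in>?L l. prod_list (map \<phi> xs))"
    by (simp add: sum_product sum.cartesian_product split_def)
  finally show ?case using Suc by simp
qed

section \<open>Gauges of the form t^2 (log^n 1/t)^\<gamma>\<close>

locale log_gauge =
  fixes n :: nat and \<gamma> :: real and h :: "real \<Rightarrow> real"
  assumes \<gamma>_pos: "\<gamma> > 0"
    and h_0: "h 0 = 0"
    and h_eq: "\<And>t. 0 < t \<Longrightarrow> t \<le> 1 / iexp n \<gamma> \<Longrightarrow> h t = t\<^sup>2 * ((ln ^^ n) (1 / t)) powr \<gamma>"
begin

definition t0 :: real where "t0 = 1 / iexp n \<gamma>"

lemma iexp_\<gamma>_pos: "iexp n \<gamma> > 0"
  using iexp_ge[of \<gamma> n] \<gamma>_pos by linarith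

lemma t0_pos: "t0 > 0"
  using iexp_\<gamma>_pos by (simp add: t0_def)

lemma iexp_\<gamma>_le: "0 < t \<Longrightarrow> t \<le> t0 \<Longrightarrow> iexp n \<gamma> \<le> 1 / t"
  using iexp_\<gamma>_pos by (simp add: t0_def field_simps)

lemma h_eq': "0 < t \<Longrightarrow> t \<le> t0 \<Longrightarrow> h t = t\<^sup>2 * ((ln ^^ n) (1 / t)) powr \<gamma>"
  using h_eq by (simp add: t0_def)

text \<open>The logarithmic factor decreases as its argument t grows. Since covers are always
  replaced by discs of exactly known diameter, this scaling takes the place of monotonicity of
  \<open>h\<close>.\<close>

lemma h_scale:
  assumes "0 \<le> t" "c \<ge> 1" "c * t \<le> t0"
  shows "h (c * t) \<le> c\<^sup>2 * h t"
proof (cases "t = 0")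
  case False
  then have t: "t > 0" "c * t > 0" using assms by auto
  have "1 * t \<le> c * t" using assms by (intro mult_right_mono) auto
  then have t': "t \<le> t0" using assms(3) by linarith
  have le: "1 / (c * t) \<le> 1 / t" using \<open>1 * t \<le> c * t\<close> t by (intro divide_left_mono) auto
  have "\<gamma> \<le> (ln ^^ n) (1 / (c * t))"
    by (rule iexp_le_imp_le_iln[OF iexp_\<gamma>_le[OF t(2) assms(3)]])
  then have "((ln ^^ n) (1 / (c * t))) powr \<gamma> \<le> ((ln ^^ n) (1 / t)) powr \<gamma>"
    using iln_mono[OF iexp_\<gamma>_le[OF t(2) assms(3)] le] \<gamma>_pos by (intro powr_mono2) auto
  then have "(c * t)\<^sup>2 * ((ln ^^ n) (1 / (c * t))) powr \<gamma> \<le> (c * t)\<^sup>2 * ((ln ^^ n) (1 / t)) powr \<gamma>"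
    by (rule mult_left_mono) simp
  then show ?thesis using h_eq'[OF t(2) assms(3)] h_eq'[OF t(1) t'] by (simp add: power_mult_distrib mult.assoc)
qed (simp add: h_0)

lemma h_null_countable:
  assumes "countable A"
  shows "h_null h A"
  unfolding h_null_def
proof (intro allI impI)
  fix \<delta> \<epsilon> :: real assume "\<delta> > 0" "\<epsilon> > 0"
  define B where "B j = (if A = {} then {} else {from_nat_into A j})" for j
  have "A \<subseteq> (\<Union>j. B j)"
  proof
    fix x assume "x \<in> A"
    then obtain j where "x = from_nat_into A j" using from_nat_into_surj[OF assms] by metis
    then show "x \<in> (\<Union>j. B j)" using \<open>x \<in> A\<close> by (auto simp: B_def)
  qed
  then have "delta_cover \<delta> A B" using \<open>\<delta> > 0\<close> by (auto simp: delta_cover_def B_def)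
  moreover have "diameter (B j) = 0" for j by (simp add: B_def)
  then have "(\<Sum>j. ennreal (h (diameter (B j)))) \<le> ennreal \<epsilon>" by (simp add: h_0)
  ultimately show "\<exists>B. delta_cover \<delta> A B \<and> (\<Sum>j. ennreal (h (diameter (B j)))) \<le> ennreal \<epsilon>" by blast
qed

lemma h_null_UN:
  assumes "countable I" "\<And>i. i \<in> I \<Longrightarrow> h_null h (A i)"
  shows "h_null h (\<Union>i\<in>I. A i)"
proof (cases "I = {}")
  case True then show ?thesis using h_null_countable[of "{}"] by simp
next
  case False
  have "h_null h (\<Union>j. A (from_nat_into I j))"
    by (intro h_null_UN_nat assms(2) from_nat_into False)
  moreover have "(\<Union>i\<in>I. A i) \<subseteq> (\<Union>j. A (from_nat_into I j))"
    using from_nat_into_surj[OF assms(1)] by blast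
  ultimately show ?thesis using h_null_mono by blast
qed

lemma h_null_Un:
  assumes "h_null h A" "h_null h B"
  shows "h_null h (A \<union> B)"
  using h_null_UN[of "UNIV :: bool set" "\<lambda>i. if i then A else B"] assms
  by (simp add: UNIV_bool Un_commute)

text \<open>Each covering set that meets the image of \<open>S\<close> is replaced by a disc about a
  point of \<open>S\<close>, with radius \<open>L\<close> times the diameter of the covering
  set.\<close>

lemma h_null_Lipschitz:
  assumes A: "h_null h A" and F: "F ` S \<subseteq> A" and L: "L \<ge> 1"
    and lip: "\<And>x y. x \<in> S \<Longrightarrow> y \<in> S \<Longrightarrow> norm (x - y) \<le> L * norm (F x - F y)"
  shows "h_null h S"
  unfolding h_null_def
proof (intro allI impI)
  fix \<delta> \<epsilon> :: real assume de: "\<delta> > 0" "\<epsilon> > 0"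
  \<comment> \<open>Keeps the new discs, of diameter \<open>2 * L * d j\<close>, below
    \<open>\<delta>\<close> and within the domain of the gauge.\<close>
  define \<delta>' where "\<delta>' = min \<delta> t0 / (2 * L)"
  have \<delta>': "\<delta>' > 0" using de t0_pos L by (simp add: \<delta>'_def)
  define \<epsilon>' where "\<epsilon>' = \<epsilon> / (2 * L)\<^sup>2"
  have "\<epsilon>' > 0" using de L by (simp add: \<epsilon>'_def)
  then obtain B where B: "delta_cover \<delta>' A B" "(\<Sum>j. ennreal (h (diameter (B j)))) \<le> ennreal \<epsilon>'"
    using A \<delta>' unfolding h_null_def by blast
  define d where "d j = diameter (B j)" for j
  have bB: "bounded (B j)" "d j \<le> \<delta>'" "0 \<le> d j" for j
    using B(1) by (auto simp: delta_cover_def d_def diameter_ge_0)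
  have d2: "2 * L * d j \<le> min \<delta> t0" for j
  proof -
    have "2 * L * d j \<le> 2 * L * \<delta>'" using L bB(2)[of j] by (intro mult_left_mono) auto
    also have "\<dots> = min \<delta> t0" using L by (simp add: \<delta>'_def)
    finally show ?thesis .
  qed
  define hit where "hit j \<longleftrightarrow> (\<exists>z. z \<in> S \<and> F z \<in> B j)" for j
  define c where "c j = (SOME z. z \<in> S \<and> F z \<in> B j)" for j
  have c: "c j \<in> S \<and> F (c j) \<in> B j" if "hit j" for j
    using that unfolding hit_def c_def by (rule someI_ex)
  define C where "C j = (if hit j then cball (c j) (L * d j) else {})" for j
  have dC: "diameter (C j) = (if hit j then 2 * L * d j else 0)" for j
  proof -
    have "L * d j \<ge> 0" using L bB(3)[of j] by simp
    then show ?thesis by (simp add: C_def)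
  qed
  have "S \<subseteq> (\<Union>j. C j)"
  proof
    fix x assume x: "x \<in> S"
    then obtain j where j: "F x \<in> B j" using F B(1) unfolding delta_cover_def by blast
    then have hj: "hit j" using x by (auto simp: hit_def)
    have "norm (c j - x) \<le> L * norm (F (c j) - F x)" using lip c[OF hj] x by blast
    also have "\<dots> \<le> L * d j"
      using diameter_bounded_bound[OF bB(1), of "F (c j)" j "F x"] c[OF hj] j L
      by (intro mult_left_mono) (auto simp: d_def dist_norm)
    finally show "x \<in> (\<Union>j. C j)" using hj by (intro UN_I[of j]) (auto simp: C_def dist_norm)
  qed
  moreover have "bounded (C j) \<and> diameter (C j) \<le> \<delta>" for j
    unfolding dC using d2[of j] de by (auto simp: C_def)
  ultimately have "delta_cover \<delta> S C" by (simp add: delta_cover_def)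
  moreover have "(\<Sum>j. ennreal (h (diameter (C j)))) \<le> ennreal \<epsilon>"
  proof -
    have "(\<Sum>j. ennreal (h (diameter (C j)))) \<le> (\<Sum>j. ennreal ((2 * L)\<^sup>2) * ennreal (h (d j)))"
    proof (intro suminf_le)
      fix j
      show "ennreal (h (diameter (C j))) \<le> ennreal ((2 * L)\<^sup>2) * ennreal (h (d j))"
      proof (cases "hit j")
        case True
        have "h (2 * L * d j) \<le> (2 * L)\<^sup>2 * h (d j)"
          using h_scale[of "d j" "2 * L"] L bB(3) d2[of j] by simp
        then show ?thesis using True by (simp add: dC ennreal_leI flip: ennreal_mult')
      qed (simp add: dC h_0)
    qed auto
    also have "\<dots> = ennreal ((2 * L)\<^sup>2) * (\<Sum>j. ennreal (h (d j)))" by (rule ennreal_suminf_cmult)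
    also have "\<dots> \<le> ennreal ((2 * L)\<^sup>2) * ennreal \<epsilon>'" using B(2) unfolding d_def by (rule mult_left_mono) simp
    also have "\<dots> = ennreal \<epsilon>" using L by (simp add: \<epsilon>'_def flip: ennreal_mult')
    finally show ?thesis .
  qed
  ultimately show "\<exists>B. delta_cover \<delta> S B \<and> (\<Sum>j. ennreal (h (diameter (B j)))) \<le> ennreal \<epsilon>" by blast
qed

lemma iexp_prod_list:
  assumes "y0 \<ge> 2" "\<And>x. x \<in> set xs \<Longrightarrow> r x > 0 \<and> y x \<ge> 2 \<and> 1 / r x \<le> iexp n (y x)"
  shows "iexp n y0 * prod_list (map (\<lambda>x. 1 / r x) xs) \<le> iexp n (y0 * prod_list (map y xs))"
  using assms
proof (induction xs arbitrary: y0)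
  case (Cons x xs)
  have x: "r x > 0" "y x \<ge> 2" "1 / r x \<le> iexp n (y x)" using Cons.prems by auto
  have y: "y0 * y x \<ge> 2" using mult_mono[of 2 y0 1 "y x"] Cons.prems(1) x(2) by simp
  have pos: "prod_list (map (\<lambda>x. 1 / r x) xs) \<ge> 0"
    using Cons.prems(2) by (intro prod_list_nonneg) (auto simp: less_imp_le)
  have e0: "iexp n y0 \<ge> 0" using iexp_ge[of y0 n] Cons.prems(1) by linarith
  have "iexp n y0 * (1 / r x) \<le> iexp n y0 * iexp n (y x)" using x e0 by (intro mult_left_mono) auto
  also have "\<dots> \<le> iexp n (y0 * y x)" using iexp_mult Cons.prems x by blast
  finally have "iexp n y0 * (1 / r x) * prod_list (map (\<lambda>x. 1 / r x) xs) \<le> iexp n (y0 * y x) * prod_list (map (\<lambda>x. 1 / r x) xs)"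
    using pos by (rule mult_right_mono)
  also have "\<dots> \<le> iexp n (y0 * y x * prod_list (map y xs))"
    by (rule Cons.IH) (use y Cons.prems in auto)
  finally show ?case by (simp add: mult.assoc)
qed simp

end

lemma suminf_ennreal_le:
  fixes g :: "nat \<Rightarrow> ennreal"
  assumes "\<And>N. (\<Sum>j<N. g j) \<le> c"
  shows "(\<Sum>j. g j) \<le> c"
  unfolding suminf_eq_SUP by (rule SUP_least) (rule assms)

context log_gauge begin

text \<open>By \<open>iexp_prod_list\<close> the n-fold logarithm of 1/(2D) is at most
  \<open>y0\<close> times the product of the \<open>y x\<close>. Hence the gauge of the diameter 2D
  splits into one factor per letter.\<close>

lemma h_word_bound:
  assumes B: "B > 0" "1 / B \<le> iexp n y0" "y0 \<ge> 2" and \<kappa>: "\<kappa> \<ge> 1"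
    and xs: "\<And>x. x \<in> set xs \<Longrightarrow> r x > 0 \<and> y x \<ge> 2 \<and> 1 / r x \<le> iexp n (y x)"
    and D: "D = B * \<kappa> ^ length xs * prod_list (map r xs)" "2 * D \<le> t0"
  shows "h (2 * D) \<le> 4 * B\<^sup>2 * y0 powr \<gamma> * prod_list (map (\<lambda>x. \<kappa>\<^sup>2 * (r x)\<^sup>2 * y x powr \<gamma>) xs)"
proof -
  have rp: "prod_list (map r xs) > 0"
    using xs by (induction xs) (auto intro!: mult_pos_pos)
  have yp: "prod_list (map y xs) > 0"
    using xs by (induction xs) (force intro!: mult_pos_pos)+
  have "B * \<kappa> ^ length xs > 0" using B \<kappa> by simp
  then have Dp: "D > 0" using rp by (simp add: D(1))
  have inv: "1 / prod_list (map r xs) = prod_list (map (\<lambda>x. 1 / r x) xs)"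
  proof (induction xs)
    case (Cons x xs)
    have "1 / prod_list (map r (x # xs)) = 1 / r x * (1 / prod_list (map r xs))" by simp
    then show ?case using Cons by simp
  qed simp
  \<comment> \<open>Since \<open>\<kappa>\<close> >= 1, its power may be dropped when 1/(2D) is
    bounded from above.\<close>
  have "B * prod_list (map r xs) * 1 \<le> B * prod_list (map r xs) * (2 * \<kappa> ^ length xs)"
    using B rp one_le_power[OF \<kappa>, of "length xs"] by (intro mult_left_mono) auto
  then have "B * prod_list (map r xs) \<le> 2 * D" by (simp add: D(1) mult_ac)
  then have "1 / (2 * D) \<le> 1 / (B * prod_list (map r xs))"
    using B rp by (intro divide_left_mono) (auto intro!: mult_pos_pos Dp)
  also have "\<dots> = 1 / B * prod_list (map (\<lambda>x. 1 / r x) xs)" by (simp flip: inv)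
  also have "\<dots> \<le> iexp n y0 * prod_list (map (\<lambda>x. 1 / r x) xs)"
    using B rp by (intro mult_right_mono) (auto simp flip: inv)
  also have "\<dots> \<le> iexp n (y0 * prod_list (map y xs))"
    by (rule iexp_prod_list[OF B(3) xs])
  finally have up: "1 / (2 * D) \<le> iexp n (y0 * prod_list (map y xs))" .
  have lo: "iexp n \<gamma> \<le> 1 / (2 * D)" using iexp_\<gamma>_le[OF _ D(2)] Dp by simp
  have "((ln ^^ n) (1 / (2 * D))) powr \<gamma> \<le> (y0 * prod_list (map y xs)) powr \<gamma>"
    using iln_le[OF lo up] iexp_le_imp_le_iln[OF lo] \<gamma>_pos by (intro powr_mono2) auto
  then have "h (2 * D) \<le> (2 * D)\<^sup>2 * (y0 * prod_list (map y xs)) powr \<gamma>"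
    using h_eq'[OF _ D(2)] Dp by (simp add: mult_left_mono)
  also have "(y0 * prod_list (map y xs)) powr \<gamma> = y0 powr \<gamma> * prod_list (map y xs) powr \<gamma>"
    by (simp add: powr_mult)
  also have "(2 * D)\<^sup>2 * (y0 powr \<gamma> * prod_list (map y xs) powr \<gamma>)
      = 4 * B\<^sup>2 * y0 powr \<gamma> * ((\<kappa>\<^sup>2) ^ length xs * (prod_list (map r xs))\<^sup>2 * prod_list (map y xs) powr \<gamma>)"
    by (simp add: D(1) power_mult_distrib mult_ac flip: power_mult)
  also have "(\<kappa>\<^sup>2) ^ length xs * (prod_list (map r xs))\<^sup>2 * prod_list (map y xs) powr \<gamma>
      = prod_list (map (\<lambda>x. \<kappa>\<^sup>2 * (r x)\<^sup>2 * y x powr \<gamma>) xs)"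
    by (induction xs) (simp_all add: power_mult_distrib powr_mult mult_ac)
  finally show ?thesis .
qed

text \<open>The sets of points sharing a word of length \<open>l\<close> are covered by discs whose gauges factor
  through the letters (\<open>h_word_bound\<close>), so they sum to at most a constant times \<open>2 ^ -l\<close>.\<close>

lemma tree_null:
  fixes word :: "nat \<Rightarrow> complex \<Rightarrow> 'x list" and r y :: "'x \<Rightarrow> real"
  assumes B: "B > 0" and \<kappa>: "\<kappa> \<ge> 1" and X: "countable X"
    and word: "\<And>z l. z \<in> E \<Longrightarrow> length (word l z) = l \<and> set (word l z) \<subseteq> X"
    and dist: "\<And>z z' l. z \<in> E \<Longrightarrow> z' \<in> E \<Longrightarrow> word l z = word l z' \<Longrightarrow>
      norm (z - z') \<le> B * \<kappa> ^ l * prod_list (map r (word l z))"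
    and r: "\<And>x. x \<in> X \<Longrightarrow> r x > 0 \<and> y x \<ge> 2 \<and> 1 / r x \<le> iexp n (y x)"
    and sum: "\<And>F. finite F \<Longrightarrow> F \<subseteq> X \<Longrightarrow> (\<Sum>x\<in>F. \<kappa>\<^sup>2 * (r x)\<^sup>2 * y x powr \<gamma>) \<le> 1 / 2"
  shows "h_null h E"
  unfolding h_null_def
proof (intro allI impI)
  fix \<delta> \<epsilon> :: real assume \<delta>: "\<delta> > 0" and \<epsilon>: "\<epsilon> > 0"
  define \<phi> where "\<phi> x = \<kappa>\<^sup>2 * (r x)\<^sup>2 * y x powr \<gamma>" for x
  \<comment> \<open>Absorbs \<open>B\<close> into the n-fold exponential; the lower bound 2 is the
    one required by \<open>iexp_mult\<close>.\<close>
  define y0 where "y0 = max 2 (1 / B)"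
  have y0: "y0 \<ge> 2" "1 / B \<le> iexp n y0" using iexp_ge[of y0 n] by (auto simp: y0_def)
  define c where "c = 4 * B\<^sup>2 * y0 powr \<gamma>"
  have c: "c > 0" using B y0 by (simp add: c_def)
  define \<delta>' where "\<delta>' = min \<delta> t0 / 2"
  have \<delta>': "\<delta>' > 0" using \<delta> t0_pos by (simp add: \<delta>'_def)
  have "(\<lambda>l. c * (1/2) ^ l) \<longlonglongrightarrow> c * 0" "(\<lambda>l. B\<^sup>2 * (1/2) ^ l) \<longlonglongrightarrow> B\<^sup>2 * 0"
    by (intro tendsto_intros LIMSEQ_realpow_zero; simp)+
  then have "\<forall>\<^sub>F l in sequentially. c * (1/2) ^ l < \<epsilon> \<and> B\<^sup>2 * (1/2) ^ l < \<delta>'\<^sup>2"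
    using \<epsilon> \<delta>' by (intro eventually_conj order_tendstoD(2)) auto
  then obtain l where l: "c * (1/2) ^ l < \<epsilon>" "B\<^sup>2 * (1/2) ^ l < \<delta>'\<^sup>2"
    using eventually_happens'[OF sequentially_bot] by blast
  define D where "D xs = B * \<kappa> ^ l * prod_list (map r xs)" for xs
  define W where "W = word l ` E"
  have W: "length xs = l" "set xs \<subseteq> X" if "xs \<in> W" for xs using word that by (auto simp: W_def)
  have "W \<subseteq> lists X" using W by blast
  then have cW: "countable W" using X by (meson countable_lists countable_subset)
  have \<phi>_half: "\<phi> x \<le> 1 / 2" if "x \<in> X" for x using sum[of "{x}"] that by (simp add: \<phi>_def)
  \<comment> \<open>Since \<open>y x powr \<gamma>\<close> >= 1, the bound 1/2 for the weight of a
    letter also bounds its squared contraction factor. So the squared radii are at most B^2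
    2^-l.\<close>
  have \<kappa>r: "0 \<le> \<kappa>\<^sup>2 * (r x)\<^sup>2 \<and> \<kappa>\<^sup>2 * (r x)\<^sup>2 \<le> 1 / 2" if "x \<in> X" for x
  proof -
    have "1 \<le> y x powr \<gamma>" using r[OF that] \<gamma>_pos by (simp add: ge_one_powr_ge_zero)
    then have "\<kappa>\<^sup>2 * (r x)\<^sup>2 * 1 \<le> \<phi> x" unfolding \<phi>_def by (intro mult_left_mono) auto
    then show ?thesis using \<phi>_half[OF that] by simp
  qed
  have \<phi>_nonneg: "\<phi> x \<ge> 0" for x by (simp add: \<phi>_def)
  have D_pos: "D xs > 0" if "xs \<in> W" for xs
  proof -
    have "prod_list (map r xs) > 0" using r W(2)[OF that] by (induction xs) (auto intro!: mult_pos_pos)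
    moreover have "\<kappa> ^ l > 0" using \<kappa> by simp
    ultimately show ?thesis using B by (simp add: D_def)
  qed
  have D_small: "D xs \<le> \<delta>'" if "xs \<in> W" for xs
  proof -
    have "(D xs)\<^sup>2 = B\<^sup>2 * ((\<kappa>\<^sup>2) ^ length xs * (prod_list (map r xs))\<^sup>2)"
      using W(1)[OF that] by (simp add: D_def power_mult_distrib flip: power_mult) (simp add: mult.commute)
    also have "(\<kappa>\<^sup>2) ^ length xs * (prod_list (map r xs))\<^sup>2 = prod_list (map (\<lambda>x. \<kappa>\<^sup>2 * (r x)\<^sup>2) xs)"
      by (induction xs) (simp_all add: power_mult_distrib mult_ac)
    also have "\<dots> \<le> (1/2) ^ length xs"
      using W(2)[OF that]
    proof (induction xs)
      case (Cons x xs)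
      then show ?case using \<kappa>r[of x] \<kappa>r unfolding list.map prod_list.Cons length_Cons power_Suc
        by (intro mult_mono prod_list_nonneg) auto
    qed simp
    finally have "(D xs)\<^sup>2 \<le> B\<^sup>2 * (1/2) ^ l" using W(1)[OF that] by (simp add: mult_left_mono)
    then have "(D xs)\<^sup>2 \<le> \<delta>'\<^sup>2" using l by simp
    then show ?thesis by (rule power2_le_imp_le) (use \<delta>' in simp)
  qed
  have h_D: "h (2 * D xs) \<le> c * prod_list (map \<phi> xs)" if "xs \<in> W" for xs
  proof -
    have "h (2 * D xs) \<le> 4 * B\<^sup>2 * y0 powr \<gamma> * prod_list (map (\<lambda>x. \<kappa>\<^sup>2 * (r x)\<^sup>2 * y x powr \<gamma>) xs)"
    proof (rule h_word_bound[OF B y0(2,1) \<kappa>])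
      show "D xs = B * \<kappa> ^ length xs * prod_list (map r xs)" by (simp add: D_def W(1)[OF that])
      show "2 * D xs \<le> t0" using D_small[OF that] by (simp add: \<delta>'_def)
      show "r x > 0 \<and> y x \<ge> 2 \<and> 1 / r x \<le> iexp n (y x)" if "x \<in> set xs" for x
        using r W(2)[OF \<open>xs \<in> W\<close>] that by (simp only: subset_iff)
    qed
    then show ?thesis by (simp only: c_def \<phi>_def[abs_def])
  qed
  have "\<forall>xs\<in>W. \<exists>z\<in>E. word l z = xs" by (auto simp: W_def)
  then obtain p where p: "\<And>xs. xs \<in> W \<Longrightarrow> p xs \<in> E \<and> word l (p xs) = xs" by metis
  define num where "num = to_nat_on W"
  have num: "inj_on num W" unfolding num_def by (rule inj_on_to_nat_on[OF cW])
  \<comment> \<open>Indices that number no word get the empty set, which contributes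
    \<open>h 0\<close> = 0.\<close>
  define C where "C j = (if j \<in> num ` W then cball (p (inv_into W num j)) (D (inv_into W num j)) else {})" for j
  have C_num: "C (num xs) = cball (p xs) (D xs)" if "xs \<in> W" for xs
    using that num by (simp add: C_def)
  have C_cases: "C j = {} \<or> (\<exists>xs\<in>W. j = num xs)" for j by (auto simp: C_def)
  have diam: "diameter (C (num xs)) = 2 * D xs" if "xs \<in> W" for xs
    using D_pos[OF that] by (simp add: C_num[OF that])
  have "E \<subseteq> (\<Union>j. C j)"
  proof
    fix z assume z: "z \<in> E"
    define xs where "xs = word l z"
    have xs: "xs \<in> W" using z by (simp add: W_def xs_def)
    have "norm (p xs - z) \<le> D xs" using dist[of "p xs" z l] p[OF xs] z by (simp add: D_def xs_def)
    then show "z \<in> (\<Union>j. C j)" by (intro UN_I[of "num xs"]) (auto simp: C_num[OF xs] dist_norm)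
  qed
  moreover have "bounded (C j) \<and> diameter (C j) \<le> \<delta>" for j
  proof (cases "C j = {}")
    case False
    then obtain xs where "xs \<in> W" "j = num xs" using C_cases by blast
    then show ?thesis using D_small[of xs] by (simp add: diam) (simp add: C_num \<delta>'_def)
  qed (use \<delta> in simp)
  ultimately have "delta_cover \<delta> E C" by (simp add: delta_cover_def)
  moreover have "(\<Sum>j. ennreal (h (diameter (C j)))) \<le> ennreal \<epsilon>"
  proof (rule suminf_ennreal_le)
    fix N :: nat
    define J where "J = {xs\<in>W. num xs < N}"
    have "num ` J \<subseteq> {..<N}" by (auto simp: J_def)
    moreover have injJ: "inj_on num J" using num by (rule inj_on_subset) (auto simp: J_def)
    ultimately have finJ: "finite J" using finite_imageD finite_subset by blast
    \<comment> \<open>A partial sum involves finitely many words and hence a finite alphabet, to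
      which the assumption on sums over letters applies.\<close>
    define F where "F = (\<Union>xs\<in>J. set xs)"
    have F: "finite F" "F \<subseteq> X" using finJ W(2) by (auto simp: F_def J_def)
    have "(\<Sum>j<N. ennreal (h (diameter (C j)))) = (\<Sum>j\<in>num ` J. ennreal (h (diameter (C j))))"
    proof (rule sum.mono_neutral_right)
      show "\<forall>j\<in>{..<N} - num ` J. ennreal (h (diameter (C j))) = 0"
      proof
        fix j assume "j \<in> {..<N} - num ` J"
        then have "j \<notin> num ` W" by (auto simp: J_def)
        then show "ennreal (h (diameter (C j))) = 0" by (simp add: C_def h_0)
      qed
    qed (auto simp: J_def)
    also have "\<dots> = (\<Sum>xs\<in>J. ennreal (h (2 * D xs)))"
      unfolding sum.reindex[OF injJ] by (intro sum.cong) (auto simp: diam J_def)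
    also have "\<dots> \<le> (\<Sum>xs\<in>J. ennreal (c * prod_list (map \<phi> xs)))"
      using h_D by (intro sum_mono ennreal_leI) (auto simp: J_def)
    also have "\<dots> = ennreal (\<Sum>xs\<in>J. c * prod_list (map \<phi> xs))"
      using c \<phi>_nonneg by (intro sum_ennreal mult_nonneg_nonneg prod_list_nonneg) auto
    also have "\<dots> \<le> ennreal \<epsilon>"
    proof (rule ennreal_leI)
      have "(\<Sum>xs\<in>J. c * prod_list (map \<phi> xs)) = c * (\<Sum>xs\<in>J. prod_list (map \<phi> xs))"
        by (rule sum_distrib_left[symmetric])
      also have "\<dots> \<le> c * (\<Sum>xs | set xs \<subseteq> F \<and> length xs = l. prod_list (map \<phi> xs))"
      proof (intro mult_left_mono sum_mono2)
        show "finite {xs. set xs \<subseteq> F \<and> length xs = l}" by (rule finite_lists_length_eq[OF F(1)])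
        show "J \<subseteq> {xs. set xs \<subseteq> F \<and> length xs = l}" using W(1) by (auto simp: F_def J_def)
        show "0 \<le> prod_list (map \<phi> xs)" for xs using \<phi>_nonneg by (intro prod_list_nonneg) auto
      qed (use c in auto)
      also have "\<dots> = c * (sum \<phi> F) ^ l" by (simp add: sum_prod_list_lists[OF F(1)])
      also have "\<dots> \<le> c * (1/2) ^ l"
        using sum[OF F] c \<phi>_nonneg by (intro mult_left_mono power_mono sum_nonneg) (auto simp: \<phi>_def)
      finally show "(\<Sum>xs\<in>J. c * prod_list (map \<phi> xs)) \<le> \<epsilon>" using l by simp
    qed
    finally show "(\<Sum>j<N. ennreal (h (diameter (C j)))) \<le> ennreal \<epsilon>" .
  qed
  ultimately show "\<exists>B. delta_cover \<delta> E B \<and> (\<Sum>j. ennreal (h (diameter (B j)))) \<le> ennreal \<epsilon>" by blast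
qed

end

section \<open>Preimages of null sets\<close>

context tracts begin

lemma locally_expanding:
  assumes z: "\<not> is_pole f z" "deriv f z \<noteq> 0"
  obtains e L where "e > 0" "L \<ge> 1" "\<And>x. x \<in> ball z e \<Longrightarrow> \<not> is_pole f x"
    "\<And>x y. x \<in> ball z e \<Longrightarrow> y \<in> ball z e \<Longrightarrow> norm (x - y) \<le> L * norm (f x - f y)"
proof -
  obtain e where e: "e > 0" "ball z e \<subseteq> {z. \<not> is_pole f z}" "open (f ` ball z e)" "inj_on f (ball z e)"
    using has_complex_derivative_locally_invertible[OF holomorphic _ open_nonpoles z(2)] z(1) by auto
  obtain k where k: "k holomorphic_on f ` ball z e" "\<And>x. x \<in> ball z e \<Longrightarrow> k (f x) = x"
    using holomorphic_has_inverse[OF holomorphic_on_subset[OF holomorphic e(2)] open_ball e(4)] by metis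
  have "f z \<in> f ` ball z e" using e(1) by simp
  then obtain \<eta> where \<eta>: "\<eta> > 0" "cball (f z) \<eta> \<subseteq> f ` ball z e"
    using e(3) open_contains_cball by metis
  have "continuous_on (cball (f z) \<eta>) (deriv k)"
    using continuous_on_subset[OF holomorphic_on_imp_continuous_on[OF holomorphic_deriv[OF k(1) e(3)]] \<eta>(2)] .
  then have "bounded (deriv k ` cball (f z) \<eta>)"
    by (intro compact_imp_bounded compact_continuous_image) auto
  then obtain L where L: "\<And>w. w \<in> cball (f z) \<eta> \<Longrightarrow> norm (deriv k w) \<le> L"
    unfolding bounded_iff by blast
  obtain e' where e': "e' > 0" "\<And>x. dist x z < e' \<Longrightarrow> dist (f x) (f z) < \<eta>"
    using isCont_f[OF z(1)] \<eta>(1) unfolding continuous_at_eps_delta by metis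
  show ?thesis
  proof (rule that[of "min e e'" "max 1 L"])
    fix x assume "x \<in> ball z (min e e')"
    then show "\<not> is_pole f x" using e(2) by auto
  next
    fix x y assume xy: "x \<in> ball z (min e e')" "y \<in> ball z (min e e')"
    then have fxy: "f x \<in> cball (f z) \<eta>" "f y \<in> cball (f z) \<eta>"
      using e'(2)[of x] e'(2)[of y] by (auto simp: dist_commute less_imp_le)
    have "norm (k (f x) - k (f y)) \<le> max 1 L * norm (f x - f y)"
    proof (rule field_differentiable_bound[of "cball (f z) \<eta>" k "deriv k"])
      fix w assume w: "w \<in> cball (f z) \<eta>"
      then show "(k has_field_derivative deriv k w) (at w within cball (f z) \<eta>)"
        by (intro has_field_derivative_at_within[OF holomorphic_derivI[OF k(1) e(3)]] subsetD[OF \<eta>(2)])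
      show "norm (deriv k w) \<le> max 1 L" using L[OF w] by simp
    qed (use fxy in auto)
    then show "norm (x - y) \<le> max 1 L * norm (f x - f y)" using k(2) xy by simp
  qed (use e e' in auto)
qed

text \<open>The complement of the poles is connected. Either the derivative is constant there, and
  nonzero because of \<open>p\<close>, or its zeros are countable.\<close>

lemma countable_critical_points:
  assumes "\<not> is_pole f p" "deriv f p \<noteq> 0"
  shows "countable {z. \<not> is_pole f z \<and> deriv f z = 0}"
proof (cases "deriv f constant_on {z. \<not> is_pole f z}")
  case True
  then have "{z. \<not> is_pole f z \<and> deriv f z = 0} = {}" using assms unfolding constant_on_def by auto
  then show ?thesis by (metis countable_empty)
next
  case False
  have "connected (UNIV - {z. is_pole f z})"
    using sparse_imp_connected[OF _ connected_UNIV open_UNIV sparse_poles] by simp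
  moreover have "UNIV - {z. is_pole f z} = {z. \<not> is_pole f z}" by auto
  ultimately have "connected {z. \<not> is_pole f z}" by simp
  moreover have "fsigma {z. \<not> is_pole f z}"
    unfolding fsigma_Union_compact using open_Union_compact_subsets[OF open_nonpoles]
    by (metis (no_types, lifting) image_subsetI mem_Collect_eq)
  ultimately have "countable {z \<in> {z. \<not> is_pole f z}. deriv f z = 0}"
    using holomorphic_countable_zeros[OF holomorphic_deriv[OF holomorphic open_nonpoles] open_nonpoles] False
    by blast
  then show ?thesis by simp
qed

text \<open>Off the countably many critical points \<open>locally_expanding\<close> gives balls on
  which \<open>h_null_Lipschitz\<close> applies, and by Lindelof's theorem countably many of them
  suffice.\<close>

lemma h_null_preimage:
  assumes gauge: "log_gauge n \<gamma> h" and A: "h_null h A" and p: "\<not> is_pole f p" "deriv f p \<noteq> 0"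
  shows "h_null h {z. \<not> is_pole f z \<and> f z \<in> A}"
proof -
  interpret log_gauge n \<gamma> h by (rule gauge)
  define Reg where "Reg = {z. \<not> is_pole f z \<and> deriv f z \<noteq> 0}"
  have "\<forall>z\<in>Reg. \<exists>e L. e > 0 \<and> L \<ge> 1 \<and>
      (\<forall>x\<in>ball z e. \<forall>y\<in>ball z e. norm (x - y) \<le> L * norm (f x - f y))"
    using locally_expanding unfolding Reg_def by (metis (mono_tags, lifting) mem_Collect_eq)
  then obtain e L where e: "\<And>z. z \<in> Reg \<Longrightarrow> e z > 0" "\<And>z. z \<in> Reg \<Longrightarrow> L z \<ge> 1"
    "\<And>z x y. z \<in> Reg \<Longrightarrow> x \<in> ball z (e z) \<Longrightarrow> y \<in> ball z (e z) \<Longrightarrow> norm (x - y) \<le> L z * norm (f x - f y)"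
    by metis
  obtain F where F: "F \<subseteq> (\<lambda>z. ball z (e z)) ` Reg" "countable F" "\<Union>F = (\<Union>z\<in>Reg. ball z (e z))"
    using Lindelof[of "(\<lambda>z. ball z (e z)) ` Reg"] by auto
  obtain Z where Z: "Z \<subseteq> Reg" "countable Z" "F = (\<lambda>z. ball z (e z)) ` Z"
    using countable_subset_image[of F] F(1,2) by metis
  have "h_null h {x \<in> ball z (e z). f x \<in> A}" if "z \<in> Z" for z
    by (rule h_null_Lipschitz[OF A, of f _ "L z"]) (use e Z that in blast)+
  then have "h_null h (\<Union>z\<in>Z. {x \<in> ball z (e z). f x \<in> A})" by (rule h_null_UN[OF Z(2)])
  moreover have "h_null h {z. \<not> is_pole f z \<and> deriv f z = 0}"
    by (rule h_null_countable[OF countable_critical_points[OF p]])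
  ultimately have "h_null h ((\<Union>z\<in>Z. {x \<in> ball z (e z). f x \<in> A}) \<union> {z. \<not> is_pole f z \<and> deriv f z = 0})"
    by (rule h_null_Un)
  then show ?thesis
  proof (rule h_null_mono, intro subsetI)
    fix x assume x: "x \<in> {z. \<not> is_pole f z \<and> f z \<in> A}"
    show "x \<in> (\<Union>z\<in>Z. {x \<in> ball z (e z). f x \<in> A}) \<union> {z. \<not> is_pole f z \<and> deriv f z = 0}"
    proof (cases "x \<in> Reg")
      case True
      then have "x \<in> \<Union>F" unfolding F(3) using e(1) by (intro UN_I[of x]) auto
      then show ?thesis using x Z(3) by auto
    qed (use x in \<open>auto simp: Reg_def\<close>)
  qed
qed

end

section \<open>Counting poles\<close>

lemma sum_geometric_tail_le:
  fixes \<theta> :: real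
  assumes "0 \<le> \<theta>" "\<theta> < 1" "finite K" "\<And>k. k \<in> K \<Longrightarrow> k \<ge> k0"
  shows "(\<Sum>k\<in>K. \<theta> ^ k) \<le> \<theta> ^ k0 / (1 - \<theta>)"
proof -
  have "(\<Sum>k\<in>K. \<theta> ^ k) = (\<Sum>k\<in>K. \<theta> ^ k0 * \<theta> ^ (k - k0))"
    using assms(4) by (intro sum.cong) (auto simp flip: power_add)
  also have "\<dots> = \<theta> ^ k0 * (\<Sum>j\<in>(\<lambda>k. k - k0) ` K. \<theta> ^ j)"
  proof -
    have "inj_on (\<lambda>k. k - k0) K"
    proof (rule inj_onI)
      fix x y assume "x \<in> K" "y \<in> K" "x - k0 = y - k0"
      then show "x = y" using assms(4)[of x] assms(4)[of y] by linarith
    qed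
    then show ?thesis by (simp add: sum.reindex sum_distrib_left)
  qed
  also have "(\<Sum>j\<in>(\<lambda>k. k - k0) ` K. \<theta> ^ j) \<le> (\<Sum>j. \<theta> ^ j)"
    using assms by (intro sum_le_suminf summable_geometric) auto
  also have "(\<Sum>j. \<theta> ^ j) = 1 / (1 - \<theta>)" using assms by (intro suminf_geometric) auto
  finally show ?thesis using assms(1) by (simp add: mult_left_mono)
qed

lemma iexp_ge_exp:
  assumes "n \<ge> 1"
  shows "exp x \<le> iexp n x"
proof -
  obtain m where "n = Suc m" using assms by (cases n) auto
  then show ?thesis using iexp_ge[of x m] by simp
qed

lemma two_iexp_le:
  assumes "n \<ge> 1" "x \<ge> 0"
  shows "2 * iexp n x \<le> iexp n (x + 1)"
proof -
  have add1: "iexp m x + 1 \<le> iexp m (x + 1)" for m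
  proof (induction m)
    case (Suc m)
    have "iexp m x \<ge> 0" using iexp_ge[of x m] assms by linarith
    then have "exp (iexp m x) \<ge> 1" by simp
    moreover have "exp (iexp m x) * 2 \<le> exp (iexp m x) * exp 1"
      using exp_ge_add_one_self[of 1] by (intro mult_left_mono) auto
    ultimately have "exp (iexp m x) + 1 \<le> exp (iexp m x + 1)" unfolding exp_add by linarith
    also have "\<dots> \<le> exp (iexp m (x + 1))" using Suc by simp
    finally show ?case by simp
  qed simp
  obtain m where m: "n = Suc m" using assms by (cases n) auto
  have "2 * iexp n x = exp (iexp m x) * 2" by (simp add: m)
  also have "\<dots> \<le> exp (iexp m x) * exp 1"
    using exp_ge_add_one_self[of 1] by (intro mult_left_mono) auto
  also have "\<dots> = exp (iexp m x + 1)" by (simp add: exp_add)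
  also have "\<dots> \<le> iexp n (x + 1)" using add1[of m] by (simp add: m)
  finally show ?thesis .
qed

lemma log_plus_iterate_le:
  assumes "(log_plus ^^ k) x \<le> y"
  shows "x \<le> iexp k y"
  using assms
proof (induction k arbitrary: x)
  case (Suc k)
  then have "log_plus x \<le> iexp k y" by (simp add: funpow_swap1)
  then have "x > 0 \<Longrightarrow> ln x \<le> iexp k y" by (simp add: log_plus_def)
  then have pos: "x > 0 \<Longrightarrow> x \<le> exp (iexp k y)" by (metis exp_le_cancel_iff exp_ln)
  have "x \<le> exp (iexp k y)"
  proof (cases "x > 0")
    case False
    then show ?thesis using exp_gt_zero[of "iexp k y"] by linarith
  qed (rule pos)
  then show ?case by simp
qed simp

text \<open>On each dyadic annulus the weights \<open>r\<close> are enlarged so that they are not smaller than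
  the reciprocal of the admissible number of poles; this bounds the iterated logarithm of
  \<open>1 / r\<close> and costs no more than the squared sizes already do.\<close>

lemma dyadic_weights:
  fixes P :: "complex set" and sz :: "complex \<Rightarrow> real" and \<tau> \<gamma> C c :: real and M n :: nat
  assumes n: "n \<ge> 1" and \<tau>: "\<tau> > 0" and \<gamma>: "\<gamma> > 0" and M: "M \<ge> 1" and \<tau>\<gamma>: "\<tau> * \<gamma> < 2 / M"
    and c: "c \<ge> 0" and sz0: "\<And>a. a \<in> P \<Longrightarrow> sz a \<ge> 0"
    and sizes: "\<And>A s. finite A \<Longrightarrow> A \<subseteq> P \<Longrightarrow> (\<And>a. a \<in> A \<Longrightarrow> norm a \<le> s) \<Longrightarrow> s \<ge> 0 \<Longrightarrow>
      (\<Sum>a\<in>A. (sz a)\<^sup>2) \<le> (C * s)\<^sup>2"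
    and count: "\<forall>\<^sub>F k in sequentially. \<forall>A. finite A \<longrightarrow> A \<subseteq> P \<longrightarrow> (\<forall>a\<in>A. norm a \<le> 2 ^ (k + 1)) \<longrightarrow>
      real (card A) \<le> iexp n ((2 ^ k) powr \<tau>)"
  obtains R2 :: real and r y :: "complex \<Rightarrow> real" where "R2 > 0"
    "\<And>a. a \<in> P \<Longrightarrow> norm a \<ge> R2 \<Longrightarrow> r a > 0 \<and> y a \<ge> 2 \<and> 1 / r a \<le> iexp n (y a)"
    "\<And>a. a \<in> P \<Longrightarrow> norm a \<ge> R2 \<Longrightarrow> sz a * norm a powr (- 1 - 1 / M) \<le> r a"
    "\<And>F. finite F \<Longrightarrow> F \<subseteq> P \<Longrightarrow> (\<And>a. a \<in> F \<Longrightarrow> norm a \<ge> R2) \<Longrightarrow>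
       c * (\<Sum>a\<in>F. (r a)\<^sup>2 * y a powr \<gamma>) \<le> 1 / 2"
proof -
  \<comment> \<open>The ratio of the bounds for consecutive annuli: t^(\<tau> \<gamma> - 2/M) at t =
    2^k is \<open>\<theta> ^ k\<close>.\<close>
  define \<theta> where "\<theta> = 2 powr (\<tau> * \<gamma> - 2 / M)"
  have "2 powr (\<tau> * \<gamma> - 2 / M) < 2 powr (0::real)"
    using \<tau>\<gamma> by (subst powr_less_cancel_iff) auto
  then have \<theta>: "0 \<le> \<theta>" "\<theta> < 1" by (auto simp: \<theta>_def)
  \<comment> \<open>(2C)^2 comes from the squared sizes of the poles with |a| <= 2^(k+1), and 1 from
    the enlargement of the weights.\<close>
  define C' where "C' = (2 * C)\<^sup>2 + 1"
  have C': "C' > 0" unfolding C'_def by (smt (verit) zero_le_power2)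
  have lim2: "filterlim (\<lambda>k::nat. (2::real) ^ k) at_top sequentially"
    by real_asymp
  have "\<forall>\<^sub>F s::real in at_top. s powr 2 \<le> exp (s powr \<tau>)" using \<tau> by real_asymp
  then have e1: "\<forall>\<^sub>F k in sequentially. ((2::real) ^ k) powr 2 \<le> exp ((2 ^ k) powr \<tau>)"
    by (rule eventually_compose_filterlim[OF _ lim2])
  have "\<forall>\<^sub>F s::real in at_top. s powr \<tau> \<ge> 2" using \<tau> by real_asymp
  then have e2: "\<forall>\<^sub>F k in sequentially. ((2::real) ^ k) powr \<tau> \<ge> 2"
    by (rule eventually_compose_filterlim[OF _ lim2])
  have "(\<lambda>k. c * C' / (1 - \<theta>) * \<theta> ^ k) \<longlonglongrightarrow> c * C' / (1 - \<theta>) * 0"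
    by (intro tendsto_intros LIMSEQ_realpow_zero \<theta>)
  then have e3: "\<forall>\<^sub>F k in sequentially. c * C' / (1 - \<theta>) * \<theta> ^ k < 1 / 2"
    by (intro order_tendstoD(2)) auto
  define good where "good k \<longleftrightarrow> ((2::real) ^ k) powr 2 \<le> exp ((2 ^ k) powr \<tau>) \<and>
      ((2::real) ^ k) powr \<tau> \<ge> 2 \<and> c * C' / (1 - \<theta>) * \<theta> ^ k < 1 / 2 \<and>
      (\<forall>A. finite A \<longrightarrow> A \<subseteq> P \<longrightarrow> (\<forall>a\<in>A. norm a \<le> 2 ^ (k + 1)) \<longrightarrow>
        real (card A) \<le> iexp n ((2 ^ k) powr \<tau>))" for k
  have "eventually good sequentially"
    using e1 e2 e3 count unfolding good_def by (intro eventually_conj)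
  then obtain k0 where good: "\<And>k. k \<ge> k0 \<Longrightarrow> good k" by (auto simp: eventually_sequentially)
  have k0: "((2::real) ^ k) powr 2 \<le> exp ((2 ^ k) powr \<tau>)" "((2::real) ^ k) powr \<tau> \<ge> 2"
    "c * C' / (1 - \<theta>) * \<theta> ^ k < 1 / 2"
    "\<And>A. finite A \<Longrightarrow> A \<subseteq> P \<Longrightarrow> (\<And>a. a \<in> A \<Longrightarrow> norm a \<le> 2 ^ (k + 1)) \<Longrightarrow>
      real (card A) \<le> iexp n ((2 ^ k) powr \<tau>)" if "k \<ge> k0" for k
    using good[OF that] unfolding good_def by blast+
  define s :: "nat \<Rightarrow> real" where "s k = 2 ^ k" for k
  define X where "X k = iexp n (s k powr \<tau>)" for k
  define kk where "kk a = nat \<lfloor>log 2 (norm a)\<rfloor>" for a :: complex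
  define y where "y a = s (kk a) powr \<tau>" for a
  \<comment> \<open>The first term is the squared contraction factor up to constants. The second,
    summed over the at most \<open>X k\<close> poles of an annulus, gives at most s^(-2/M), the
    order of the bound for the first.\<close>
  define r2 where "r2 a = (sz a)\<^sup>2 * s (kk a) powr (- 2 - 2 / M) + s (kk a) powr (- 2 / M) / X (kk a)" for a
  define r where "r a = sqrt (r2 a)" for a
  have s: "s k > 0" "s k \<ge> 1" for k by (auto simp: s_def)
  have X_pos: "X k > 0" for k
    using iexp_ge[of "s k powr \<tau>" n] s(1)[of k] by (smt (verit) X_def powr_gt_zero)
  have kk: "kk a \<ge> k0" "s (kk a) \<le> norm a" "norm a \<le> 2 * s (kk a)" if "norm a \<ge> 2 ^ k0" for a
  proof -
    have na: "norm a \<ge> 1" using that one_le_power[of "2::real" k0] by linarith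
    then have na0: "norm a > 0" by linarith
    then have l0: "log 2 (norm a) \<ge> 0" using na zero_le_log_cancel_iff[of 2 "norm a"] by linarith
    have "log 2 (2 ^ k0) \<le> log 2 (norm a)" using that by (intro log_mono) auto
    then have "real k0 \<le> log 2 (norm a)" by (simp add: log_nat_power)
    then show "kk a \<ge> k0" unfolding kk_def by (simp add: le_nat_iff le_floor_iff l0)
    have fl: "real (kk a) \<le> log 2 (norm a)" "log 2 (norm a) < real (kk a) + 1"
      using l0 unfolding kk_def by linarith+
    have "s (kk a) = 2 powr real (kk a)" by (simp add: s_def powr_realpow)
    also have "\<dots> \<le> 2 powr (log 2 (norm a))" using fl by (intro powr_mono) auto
    also have "\<dots> = norm a" using na0 by (intro powr_log_cancel) auto
    finally show "s (kk a) \<le> norm a" .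
    have "norm a = 2 powr (log 2 (norm a))" using na0 by (intro powr_log_cancel[symmetric]) auto
    also have "\<dots> \<le> 2 powr (real (kk a) + 1)" using fl by (intro powr_mono) auto
    finally show "norm a \<le> 2 * s (kk a)" by (simp add: s_def powr_add powr_realpow)
  qed
  have r2_ge: "s (kk a) powr (- 2 / M) / X (kk a) \<le> r2 a" "(sz a)\<^sup>2 * s (kk a) powr (- 2 - 2 / M) \<le> r2 a" for a
    using X_pos[of "kk a"] by (auto simp: r2_def intro!: divide_nonneg_pos)
  have r2_pos: "r2 a > 0" for a
  proof -
    have "0 < s (kk a) powr (- 2 / M) / X (kk a)" using X_pos[of "kk a"] s(1)[of "kk a"] by simp
    then show ?thesis using r2_ge(1)[of a] by linarith
  qed
  show ?thesis
  proof (rule that[of "2 ^ k0" r y])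
    fix a assume a: "a \<in> P" "norm a \<ge> 2 ^ k0"
    note k = kk[OF a(2)]
    have y2: "y a \<ge> 2" using k0(2)[OF k(1)] by (simp add: y_def s_def)
    have r0: "r a > 0" using r2_pos by (simp add: r_def)
    \<comment> \<open>The aim is s^(2/M) <= X. It makes the second term of \<open>r2\<close> at
      least X^-2, so that 1/r <= X.\<close>
    have "s (kk a) powr (2 / M) \<le> s (kk a) powr 2"
      using M s(2) by (intro powr_mono) (auto simp: field_simps)
    also have "\<dots> \<le> exp (s (kk a) powr \<tau>)" using k0(1)[OF k(1)] by (simp add: s_def)
    also have "\<dots> \<le> X (kk a)" unfolding X_def by (rule iexp_ge_exp[OF n])
    finally have sX: "s (kk a) powr (2 / M) \<le> X (kk a)" .
    have "1 \<le> s (kk a) powr (- 2 / M) * X (kk a)"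
    proof -
      have "s (kk a) powr (- 2 / M) * s (kk a) powr (2 / M) \<le> s (kk a) powr (- 2 / M) * X (kk a)"
        using sX by (rule mult_left_mono) simp
      moreover have "s (kk a) powr (- 2 / M) * s (kk a) powr (2 / M) = 1"
        using s(1)[of "kk a"] by (simp flip: powr_add)
      ultimately show ?thesis by simp
    qed
    then have "1 / (X (kk a))\<^sup>2 \<le> s (kk a) powr (- 2 / M) / X (kk a)"
      using X_pos[of "kk a"] by (simp add: field_simps power2_eq_square)
    also have "\<dots> \<le> (r a)\<^sup>2" using r2_ge(1) r2_pos[of a] by (simp add: r_def)
    finally have "(1 / X (kk a))\<^sup>2 \<le> (r a)\<^sup>2" by (simp add: power_divide)
    then have "1 / X (kk a) \<le> r a" by (rule power2_le_imp_le) (use r0 in simp)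
    then have "1 / r a \<le> X (kk a)" using r0 X_pos[of "kk a"] by (simp add: field_simps)
    then show "r a > 0 \<and> y a \<ge> 2 \<and> 1 / r a \<le> iexp n (y a)" using r0 y2 by (simp add: X_def y_def)
    have "norm a powr (- 1 - 1 / M) \<le> s (kk a) powr (- 1 - 1 / M)"
    proof (rule powr_mono2'[OF _ s(1) k(2)])
      have "0 \<le> 1 / real M" by simp
      then show "- 1 - 1 / real M \<le> 0" by linarith
    qed
    then have "sz a * norm a powr (- 1 - 1 / M) \<le> sz a * s (kk a) powr (- 1 - 1 / M)"
      using sz0[OF a(1)] by (rule mult_left_mono)
    also have "\<dots> \<le> r a" unfolding r_def
    proof (rule real_le_rsqrt)
      have "(s (kk a) powr (- 1 - 1 / M))\<^sup>2 = s (kk a) powr (- 2 - 2 / M)"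
        by (simp add: power2_eq_square field_simps flip: powr_add)
      then show "(sz a * s (kk a) powr (- 1 - 1 / M))\<^sup>2 \<le> r2 a"
        using r2_ge(2)[of a] by (simp add: power_mult_distrib)
    qed
    finally show "sz a * norm a powr (- 1 - 1 / M) \<le> r a" .
  next
    fix F assume F: "finite F" "F \<subseteq> P" "\<And>a. a \<in> F \<Longrightarrow> norm a \<ge> 2 ^ k0"
    have annulus: "(\<Sum>a | a \<in> F \<and> kk a = k. (r a)\<^sup>2 * y a powr \<gamma>) \<le> C' * \<theta> ^ k" if k: "k \<ge> k0" for k
    proof -
      define A where "A = {a \<in> F. kk a = k}"
      have A: "finite A" "A \<subseteq> P" using F by (auto simp: A_def)
      have nA: "norm a \<le> 2 * s k" if "a \<in> A" for a using kk(3)[OF F(3)] that by (auto simp: A_def)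
      have "(\<Sum>a\<in>A. (r a)\<^sup>2 * y a powr \<gamma>) = (\<Sum>a\<in>A. r2 a) * s k powr (\<tau> * \<gamma>)"
        using r2_pos unfolding sum_distrib_right
        by (intro sum.cong) (auto simp: A_def r_def y_def powr_powr less_imp_le)
      also have "(\<Sum>a\<in>A. r2 a) = (\<Sum>a\<in>A. (sz a)\<^sup>2) * s k powr (- 2 - 2 / M) + real (card A) * (s k powr (- 2 / M) / X k)"
        unfolding r2_def sum.distrib by (simp add: A_def sum_distrib_right)
      also have "\<dots> \<le> (C * (2 * s k))\<^sup>2 * s k powr (- 2 - 2 / M) + X k * (s k powr (- 2 / M) / X k)"
      proof (intro add_mono mult_right_mono)
        show "(\<Sum>a\<in>A. (sz a)\<^sup>2) \<le> (C * (2 * s k))\<^sup>2"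
          using s(1)[of k] by (intro sizes[OF A nA]) auto
        have "norm a \<le> 2 ^ (k + 1)" if "a \<in> A" for a using nA[OF that] by (simp add: s_def)
        then show "real (card A) \<le> X k" using k0(4)[OF k A] by (simp add: X_def s_def)
      qed (use X_pos[of k] in auto)
      also have "(C * (2 * s k))\<^sup>2 * s k powr (- 2 - 2 / M) = (2 * C)\<^sup>2 * s k powr (- 2 / M)"
      proof -
        have "(s k)\<^sup>2 = s k powr 2" using s(1)[of k] by (simp add: powr_numeral)
        then have "(s k)\<^sup>2 * s k powr (- 2 - 2 / M) = s k powr (- 2 / M)" by (simp flip: powr_add)
        then show ?thesis by (simp add: power_mult_distrib mult_ac)
      qed
      also have "X k * (s k powr (- 2 / M) / X k) = s k powr (- 2 / M)" using X_pos[of k] by simp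
      finally have "(\<Sum>a\<in>A. (r a)\<^sup>2 * y a powr \<gamma>)
          \<le> ((2 * C)\<^sup>2 * s k powr (- 2 / M) + s k powr (- 2 / M)) * s k powr (\<tau> * \<gamma>)"
        by (simp add: mult_right_mono)
      also have "\<dots> = C' * (s k powr (- 2 / M) * s k powr (\<tau> * \<gamma>))" by (simp add: C'_def algebra_simps)
      also have "s k powr (- 2 / M) * s k powr (\<tau> * \<gamma>) = s k powr (\<tau> * \<gamma> - 2 / M)"
        by (simp flip: powr_add)
      also have "\<dots> = \<theta> ^ k"
        by (simp add: s_def \<theta>_def powr_power powr_powr mult.commute flip: powr_realpow)
      finally show ?thesis by (simp add: A_def)
    qed
    have "(\<Sum>a\<in>F. (r a)\<^sup>2 * y a powr \<gamma>) = (\<Sum>k\<in>kk ` F. \<Sum>a | a \<in> F \<and> kk a = k. (r a)\<^sup>2 * y a powr \<gamma>)"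
      by (rule sum.image_gen[OF F(1)])
    also have "\<dots> \<le> (\<Sum>k\<in>kk ` F. C' * \<theta> ^ k)"
      using F(3) kk(1) by (intro sum_mono annulus) auto
    also have "\<dots> = C' * (\<Sum>k\<in>kk ` F. \<theta> ^ k)" by (rule sum_distrib_left[symmetric])
    also have "\<dots> \<le> C' * (\<theta> ^ k0 / (1 - \<theta>))"
      using F kk(1) C' \<theta> by (intro mult_left_mono sum_geometric_tail_le) auto
    finally have "c * (\<Sum>a\<in>F. (r a)\<^sup>2 * y a powr \<gamma>) \<le> c * (C' * (\<theta> ^ k0 / (1 - \<theta>)))"
      using c by (rule mult_left_mono)
    also have "\<dots> = c * C' / (1 - \<theta>) * \<theta> ^ k0" by simp
    also have "\<dots> \<le> 1 / 2" using k0(3)[OF order_refl] by simp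
    finally show "c * (\<Sum>a\<in>F. (r a)\<^sup>2 * y a powr \<gamma>) \<le> 1 / 2" .
  qed auto
qed

section \<open>The number of poles and the Nevanlinna characteristic\<close>

context tracts begin

lemma finite_poles_cball: "finite {z \<in> cball 0 r. is_pole f z}"
proof -
  have "finite (cball 0 r \<inter> {z. is_pole f z})"
    using sparse_in_compact_finite[OF sparse_in_subset[OF sparse_poles subset_UNIV] compact_cball] .
  moreover have "cball 0 r \<inter> {z. is_pole f z} = {z \<in> cball 0 r. is_pole f z}" by auto
  ultimately show ?thesis by simp
qed

lemma pole_count_mono: "s \<le> t \<Longrightarrow> pole_count f s \<le> pole_count f t"
  unfolding pole_count_def using finite_poles_cball[of t] by (intro sum_mono2) auto

lemma card_le_pole_count:
  assumes "A \<subseteq> {z \<in> cball 0 r. is_pole f z}"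
  shows "card A \<le> pole_count f r"
proof -
  have "card A = (\<Sum>z\<in>A. 1)" by simp
  also have "\<dots> \<le> (\<Sum>z\<in>A. pole_mult f z)"
    using pole_coordinate assms by (intro sum_mono) (metis (no_types, lifting) mem_Collect_eq subsetD)
  also have "\<dots> \<le> pole_count f r"
    unfolding pole_count_def using finite_poles_cball[of r] assms by (intro sum_mono2) auto
  finally show ?thesis .
qed

lemma pole_count_near_0:
  obtains \<epsilon> where "\<epsilon> > 0" "\<And>t. 0 \<le> t \<Longrightarrow> t \<le> \<epsilon> \<Longrightarrow> pole_count f t = pole_count f 0"
proof -
  obtain e where e: "e > 0" "\<And>z. z \<in> ball 0 e \<Longrightarrow> z \<noteq> 0 \<Longrightarrow> \<not> is_pole f z"
  proof (cases "is_pole f 0")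
    case True
    obtain e where "e > 0" "\<And>z. z \<in> cball 0 e \<Longrightarrow> z \<noteq> 0 \<Longrightarrow> \<not> is_pole f z"
      using isolated_pole[OF True] by blast
    then show ?thesis by (intro that[of e]) auto
  next
    case False
    then obtain e where "e > 0" "ball 0 e \<subseteq> {z. \<not> is_pole f z}"
      using open_nonpoles open_contains_ball by (metis mem_Collect_eq)
    then show ?thesis by (intro that[of e]) auto
  qed
  show ?thesis
  proof (rule that[of "e / 2"])
    fix t assume t: "0 \<le> t" "t \<le> e / 2"
    have "z = 0" if "is_pole f z" "norm z \<le> t" for z using e(2)[of z] that t e(1) by auto
    then have "{z \<in> cball 0 t. is_pole f z} = {z \<in> cball 0 0. is_pole f z}" using t by auto
    then show "pole_count f t = pole_count f 0" by (simp only: pole_count_def)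
  qed (use e in simp)
qed

text \<open>On [s, 2s] the counting function is at least its value at s, and dt/t integrates to ln
  2. The poles at 0, which are counted apart, contribute at least as much because s >= 1.\<close>

lemma nevanlinna_N_ge:
  assumes s: "s \<ge> 1"
  shows "real (pole_count f s) * ln 2 \<le> nevanlinna_N f (2 * s)"
proof -
  define n0 where "n0 = real (pole_count f 0)"
  define g where "g t = (real (pole_count f t) - n0) / t" for t
  obtain \<epsilon>' where \<epsilon>': "\<epsilon>' > 0" "\<And>t. 0 \<le> t \<Longrightarrow> t \<le> \<epsilon>' \<Longrightarrow> pole_count f t = pole_count f 0"
    using pole_count_near_0 by blast
  define \<epsilon> where "\<epsilon> = min \<epsilon>' 1"
  have \<epsilon>: "0 < \<epsilon>" "\<epsilon> \<le> 1" using \<epsilon>' by (auto simp: \<epsilon>_def)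
  \<comment> \<open>Near 0 the integrand vanishes, so the singularity of 1/t does not
    matter.\<close>
  have g0: "g integrable_on {0..\<epsilon>}"
  proof (rule integrable_eq[OF integrable_0])
    fix t assume "t \<in> {0..\<epsilon>}"
    then have "pole_count f t = pole_count f 0" using \<epsilon>'(2)[of t] by (simp add: \<epsilon>_def)
    then show "0 = g t" unfolding g_def n0_def by simp
  qed
  have inv: "(\<lambda>t. 1 / t) integrable_on {\<epsilon>..2 * s}"
    using \<epsilon> by (intro integrable_continuous_interval continuous_intros) auto
  have "\<epsilon> \<le> 2 * s" using \<epsilon> s by simp
  \<comment> \<open>The counting function is monotone and 1/t integrable; the second mean value
    theorem includes the integrability of the product.\<close>
  then have "(\<lambda>t. (real (pole_count f t) - n0) * (1 / t)) integrable_on {\<epsilon>..2 * s}"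
    by (rule second_mean_value_theorem_full[of "\<lambda>t. 1 / t" \<epsilon> "2 * s" "\<lambda>t. real (pole_count f t) - n0", OF inv])
      (use pole_count_mono in auto)
  then have g1: "g integrable_on {\<epsilon>..2 * s}" by (simp add: g_def[abs_def])
  have gint: "g integrable_on {0..2 * s}"
    using Henstock_Kurzweil_Integration.integrable_combine[OF _ _ g0 g1] \<epsilon> s by simp
  have g_nonneg: "g t \<ge> 0" if "t \<ge> 0" for t
    using pole_count_mono[OF that] that by (simp add: g_def n0_def)
  have i1: "g integrable_on {0..s}" "g integrable_on {s..2 * s}"
    using s by (auto intro!: integrable_subinterval_real[OF gint])
  have "((\<lambda>t. (real (pole_count f s) - n0) * (1 / t)) has_integral
      (real (pole_count f s) - n0) * (ln (2 * s) - ln s)) {s..2 * s}"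
    using s by (intro has_integral_mult_right fundamental_theorem_of_calculus)
      (auto intro!: derivative_eq_intros simp flip: has_real_derivative_iff_has_vector_derivative)
  then have lower: "(real (pole_count f s) - n0) * ln 2 \<le> integral {s..2 * s} g"
  proof (rule has_integral_le[OF _ integrable_integral[OF i1(2)], THEN order_trans[rotated]])
    show "(real (pole_count f s) - n0) * (1 / t) \<le> g t" if "t \<in> {s..2 * s}" for t
      using that s pole_count_mono[of s t] by (auto simp: g_def intro!: divide_right_mono)
  qed (use s in \<open>simp add: ln_mult\<close>)
  have "integral {0..2 * s} g = integral {0..s} g + integral {s..2 * s} g"
    using s by (intro Henstock_Kurzweil_Integration.integral_combine[symmetric] gint) auto
  moreover have "integral {0..s} g \<ge> 0" using g_nonneg by (intro integral_nonneg i1) auto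
  moreover have "n0 * ln 2 \<le> n0 * ln (2 * s)" using s by (intro mult_left_mono) (auto simp: n0_def)
  ultimately show ?thesis
    using lower unfolding nevanlinna_N_def n0_def[symmetric] g_def[abs_def, symmetric]
    by (simp add: algebra_simps)
qed

lemma nevanlinna_m_nonneg: "nevanlinna_m f r \<ge> 0"
proof -
  define g where "g \<theta> = log_plus (norm (f (rcis r \<theta>)))" for \<theta>
  \<comment> \<open>A non-integrable \<open>g\<close> would have integral 0 by default.\<close>
  have "integral {0..2 * pi} g \<ge> 0"
  proof (cases "g integrable_on {0..2 * pi}")
    case True
    then show ?thesis by (rule integral_nonneg) (auto simp: g_def log_plus_def)
  qed (simp add: not_integrable_integral)
  then show ?thesis by (simp add: nevanlinna_m_def g_def[abs_def])
qed

lemma eventually_pole_count_le: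
  assumes n: "n \<ge> 1" and ord: "nth_order n f = ereal \<rho>" and \<tau>: "0 < \<rho>" "\<rho> < \<tau>"
  shows "\<forall>\<^sub>F k in sequentially. real (pole_count f (2 ^ (k + 1))) \<le> iexp n ((2 ^ k) powr \<tau>)"
proof -
  \<comment> \<open>The room between \<open>\<tau>'\<close> and \<open>\<tau>\<close> absorbs the
    factor 4 inside the power and the factor 2 in front of the iterated exponential.\<close>
  define \<tau>' where "\<tau>' = (\<rho> + \<tau>) / 2"
  have \<tau>': "0 < \<tau>'" "\<rho> < \<tau>'" "\<tau>' < \<tau>" using \<tau> by (auto simp: \<tau>'_def)
  have "Limsup at_top (\<lambda>r::real. ereal ((log_plus ^^ (n + 1)) (nevanlinna_T f r) / ln r)) < ereal \<tau>'"
    using ord \<tau>' unfolding nth_order_def by simp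
  then have "\<forall>\<^sub>F r in at_top. ereal ((log_plus ^^ (n + 1)) (nevanlinna_T f r) / ln r) < ereal \<tau>'"
    by (rule Limsup_lessD)
  then have T: "\<forall>\<^sub>F r in at_top. nevanlinna_T f r \<le> iexp n (r powr \<tau>')"
    using eventually_gt_at_top[of 1]
  proof eventually_elim
    case (elim r)
    then have "(log_plus ^^ (n + 1)) (nevanlinna_T f r) \<le> \<tau>' * ln r" by (simp add: field_simps)
    then have "nevanlinna_T f r \<le> iexp (n + 1) (\<tau>' * ln r)" by (rule log_plus_iterate_le)
    also have "iexp (n + 1) (\<tau>' * ln r) = iexp n (r powr \<tau>')"
      using elim by (simp add: powr_def funpow_swap1)
    finally show ?case .
  qed
  have lim2: "filterlim (\<lambda>k::nat. (2::real) ^ k) at_top sequentially"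
    by real_asymp
  have "filterlim (\<lambda>s::real. 4 * s) at_top at_top" by real_asymp
  from filterlim_compose[OF this lim2]
  have T2: "\<forall>\<^sub>F k in sequentially. nevanlinna_T f (4 * 2 ^ k) \<le> iexp n ((4 * 2 ^ k) powr \<tau>')"
    by (rule eventually_compose_filterlim[OF T])
  have "\<forall>\<^sub>F s::real in at_top. (4 * s) powr \<tau>' + 1 \<le> s powr \<tau>" using \<tau>' by real_asymp
  then have P2: "\<forall>\<^sub>F k in sequentially. (4 * 2 ^ k) powr \<tau>' + 1 \<le> (2 ^ k) powr \<tau>"
    by (rule eventually_compose_filterlim[OF _ lim2])
  show ?thesis
    using T2 P2
  proof eventually_elim
    case (elim k)
    have "real (pole_count f (2 ^ (k + 1))) * (1 / 2) \<le> real (pole_count f (2 ^ (k + 1))) * ln 2"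
      using ln2_ge_two_thirds by (intro mult_left_mono) auto
    also have "\<dots> \<le> nevanlinna_N f (2 * 2 ^ (k + 1))"
      by (rule nevanlinna_N_ge) (rule one_le_power, simp)
    also have "\<dots> \<le> nevanlinna_T f (4 * 2 ^ k)"
      using nevanlinna_m_nonneg by (simp add: nevanlinna_T_def)
    also have "\<dots> \<le> iexp n ((4 * 2 ^ k) powr \<tau>')" by (rule elim)
    finally have "real (pole_count f (2 ^ (k + 1))) \<le> 2 * iexp n ((4 * 2 ^ k) powr \<tau>')" by simp
    also have "\<dots> \<le> iexp n ((4 * 2 ^ k) powr \<tau>' + 1)" by (rule two_iexp_le[OF n]) simp
    also have "\<dots> \<le> iexp n ((2 ^ k) powr \<tau>)" by (rule iexp_mono[OF elim(2)])
    finally show ?case .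
  qed
qed

end

section \<open>Coding of escaping points\<close>

lemma floor_eq_imp_diff_le:
  fixes x y :: real
  assumes "\<lfloor>x\<rfloor> = \<lfloor>y\<rfloor>"
  shows "\<bar>x - y\<bar> \<le> 1"
  using assms by linarith

context tracts begin

text \<open>Above \<open>R1\<close> an orbit only visits quarter tracts of poles in \<open>P\<close>
  of modulus at least \<open>R2'\<close>. There one backward step contracts by a factor that depends
  on the next letter, and the products of these factors are what \<open>tree_null\<close>
  needs.\<close>

lemma h_null_large_orbits:
  assumes gauge: "log_gauge n \<gamma> h" and n: "n \<ge> 1" and ord: "nth_order n f = ereal \<rho>" "\<rho> > 0"
    and M: "M \<ge> 1" and fin: "finite {z. is_pole f z \<and> pole_mult f z > M}"
    and \<gamma>: "\<gamma> > 0" "\<gamma> < 2 / (real M * \<rho>)"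
  obtains R1 where "R1 \<ge> R" "h_null h {z. \<forall>k. \<not> is_pole f ((f ^^ k) z) \<and> norm ((f ^^ k) z) > R1}"
proof -
  interpret log_gauge n \<gamma> h by (rule gauge)
  define K where "K = exp (12 * pi)"
  have K: "K > 0" "K \<ge> 1" by (auto simp: K_def)
  \<comment> \<open>The 2 comes from the logarithm (\<open>norm_diff_le_exp_diff\<close>), K and
    K^(1/M) from the lower bound |b|/K for |f z|, and R^(1/M) from the chart.\<close>
  define \<kappa> where "\<kappa> = max 1 (2 * K * (R * K) powr (1 / M))"
  have \<kappa>: "\<kappa> \<ge> 1" by (simp add: \<kappa>_def)
  define P where "P = {a. tract_pole a \<and> a \<noteq> 0 \<and> pole_mult f a \<le> M}"
  have P_pole: "is_pole f a" if "tract_pole a" for a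
    using chart_tract_map[OF that] by (simp add: chart_def)
  have "\<rho> < 2 / (real M * \<gamma>)" using \<gamma> M ord(2) by (simp add: field_simps)
  then obtain \<tau> where \<tau>: "\<rho> < \<tau>" "\<tau> < 2 / (real M * \<gamma>)" using dense by blast
  then have \<tau>0: "\<tau> > 0" using ord(2) by linarith
  have \<tau>\<gamma>: "\<tau> * \<gamma> < 2 / M" using \<tau>(2) \<gamma> M by (simp add: field_simps)
  \<comment> \<open>|Im \<zeta>| = m |arg u| <= pi M < 4M, so these are the possible unit
    strips.\<close>
  define Q where "Q = {- int (4 * M)..int (4 * M)}"
  have cardQ: "card Q = 8 * M + 1" by (simp add: Q_def)
  have count: "\<forall>\<^sub>F k in sequentially. \<forall>A. finite A \<longrightarrow> A \<subseteq> P \<longrightarrow> (\<forall>a\<in>A. norm a \<le> 2 ^ (k + 1)) \<longrightarrow>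
      real (card A) \<le> iexp n ((2 ^ k) powr \<tau>)"
    using eventually_pole_count_le[OF n ord \<tau>(1)]
  proof eventually_elim
    case (elim k)
    show ?case
    proof (intro allI impI)
      fix A assume A: "A \<subseteq> P" "\<forall>a\<in>A. norm a \<le> 2 ^ (k + 1)"
      have "A \<subseteq> {z \<in> cball 0 (2 ^ (k + 1)). is_pole f z}"
      proof
        fix a assume "a \<in> A"
        then have "tract_pole a" "norm a \<le> 2 ^ (k + 1)" using A by (auto simp: P_def)
        then show "a \<in> {z \<in> cball 0 (2 ^ (k + 1)). is_pole f z}" using P_pole by simp
      qed
      then have "real (card A) \<le> real (pole_count f (2 ^ (k + 1)))" using card_le_pole_count of_nat_mono by blast
      then show "real (card A) \<le> iexp n ((2 ^ k) powr \<tau>)" using elim by linarith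
    qed
  qed
  have sizes: "(\<Sum>a\<in>A. (tract_size a)\<^sup>2) \<le> (48 * K * s)\<^sup>2"
    if "finite A" "A \<subseteq> P" "\<And>a. a \<in> A \<Longrightarrow> norm a \<le> s" "s \<ge> 0" for A s
    unfolding K_def
  proof (rule tract_size_square_sum[OF that(1) _ that(4)])
    show "tract_pole a \<and> a \<noteq> 0 \<and> norm a \<le> s" if "a \<in> A" for a
      using \<open>A \<subseteq> P\<close> \<open>\<And>a. a \<in> A \<Longrightarrow> norm a \<le> s\<close> that by (auto simp: P_def)
  qed
  have sz0: "tract_size a \<ge> 0" if "a \<in> P" for a using tract_size_nonneg that by (simp add: P_def)
  obtain R2 r y where R2: "R2 > 0"
    and ry: "\<And>a. a \<in> P \<Longrightarrow> norm a \<ge> R2 \<Longrightarrow> r a > 0 \<and> y a \<ge> 2 \<and> 1 / r a \<le> iexp n (y a)"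
    and rsz: "\<And>a. a \<in> P \<Longrightarrow> norm a \<ge> R2 \<Longrightarrow> tract_size a * norm a powr (- 1 - 1 / M) \<le> r a"
    and rsum: "\<And>F. finite F \<Longrightarrow> F \<subseteq> P \<Longrightarrow> (\<And>a. a \<in> F \<Longrightarrow> norm a \<ge> R2) \<Longrightarrow>
       \<kappa>\<^sup>2 * real (8 * M + 1) * (\<Sum>a\<in>F. (r a)\<^sup>2 * y a powr \<gamma>) \<le> 1 / 2"
  proof (rule dyadic_weights[OF n \<tau>0 \<gamma>(1) M \<tau>\<gamma>])
    show "0 \<le> \<kappa>\<^sup>2 * real (8 * M + 1)" by simp
    show "0 \<le> tract_size a" if "a \<in> P" for a by (rule sz0[OF that])
    show "(\<Sum>a\<in>A. (tract_size a)\<^sup>2) \<le> (48 * K * s)\<^sup>2"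
      if "finite A" "A \<subseteq> P" "\<And>a. a \<in> A \<Longrightarrow> norm a \<le> s" "s \<ge> 0" for A s
      by (rule sizes[OF that])
    fix R2 :: real and r y :: "complex \<Rightarrow> real"
    assume 1: "R2 > 0"
      and 2: "\<And>a. a \<in> P \<Longrightarrow> norm a \<ge> R2 \<Longrightarrow> r a > 0 \<and> y a \<ge> 2 \<and> 1 / r a \<le> iexp n (y a)"
      and 3: "\<And>a. a \<in> P \<Longrightarrow> norm a \<ge> R2 \<Longrightarrow> tract_size a * norm a powr (- 1 - 1 / M) \<le> r a"
      and 4: "\<And>F. finite F \<Longrightarrow> F \<subseteq> P \<Longrightarrow> (\<And>a. a \<in> F \<Longrightarrow> norm a \<ge> R2) \<Longrightarrow>
        \<kappa>\<^sup>2 * real (8 * M + 1) * (\<Sum>a\<in>F. (r a)\<^sup>2 * y a powr \<gamma>) \<le> 1 / 2"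
    show thesis by (rule that[OF 1 2 3 4])
  qed (rule count)
  \<comment> \<open>The second entry ensures |b|/K >= R 4^M, which puts the logarithms into the
    half-plane of \<open>tract_map_exp_Lipschitz\<close>.\<close>
  define R2' where "R2' = max R2 (K * R * 4 ^ M)"
  \<comment> \<open>Only 0 and the poles of multiplicity above \<open>M\<close> can be exceptional.
    The quarter tracts of these finitely many poles are bounded, and \<open>B1\<close> below keeps
    large orbits out of them.\<close>
  define Ex where "Ex = {a. tract_pole a \<and> a \<notin> P}"
  have "Ex \<subseteq> insert 0 {z. is_pole f z \<and> pole_mult f z > M}" using P_pole by (auto simp: Ex_def P_def)
  then have Ex: "finite Ex" using fin by (meson finite_insert finite_subset)
  define M' where "M' = Max (insert M (pole_mult f ` Ex))"
  have M': "M \<le> M'" "\<And>a. a \<in> Ex \<Longrightarrow> pole_mult f a \<le> M'" using Ex by (auto simp: M'_def)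
  have mM': "pole_mult f a \<le> M'" if "tract_pole a" for a
    using M' that by (cases "a \<in> P") (auto simp: P_def Ex_def)
  have "bounded (\<Union>a\<in>Ex. tract_map a ` cball 0 (radius a / 4))"
  proof (intro bounded_UN Ex ballI compact_imp_bounded compact_continuous_image compact_cball)
    fix a assume "a \<in> Ex"
    then have "tract_map a holomorphic_on ball 0 (radius a)"
      using tract_map_holomorphic by (simp add: Ex_def)
    then have "continuous_on (ball 0 (radius a)) (tract_map a)"
      by (rule holomorphic_on_imp_continuous_on)
    then show "continuous_on (cball 0 (radius a / 4)) (tract_map a)"
      by (rule continuous_on_subset)
        (simp add: cball_subset_ball_iff)
  qed
  then obtain B1 where B1: "\<And>a u. a \<in> Ex \<Longrightarrow> u \<in> cball 0 (radius a / 4) \<Longrightarrow> norm (tract_map a u) \<le> B1"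
    unfolding bounded_iff by blast
  \<comment> \<open>In this order the entries put the chart coordinate of every orbit point into the
    quarter disc, exclude the tracts in \<open>Ex\<close>, and force the poles to have modulus at
    least \<open>R2'\<close>.\<close>
  define R1 where "R1 = max (max (R * 4 ^ M') B1) (K * R2')"
  have R1: "R1 \<ge> R * 4 ^ M'" "R1 \<ge> B1" "R1 \<ge> K * R2'" by (auto simp: R1_def)
  have "R * 1 \<le> R * 4 ^ M'" using R_pos by (intro mult_left_mono) auto
  then have R1R: "R1 \<ge> R" using R1 by simp
  define E where "E = {z. \<forall>k. \<not> is_pole f ((f ^^ k) z) \<and> norm ((f ^^ k) z) > R1}"
  have E1: "\<not> is_pole f z" "norm z > R1" if "z \<in> E" for z
    using that unfolding E_def by (auto dest: spec[of _ 0])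
  have Ef: "f z \<in> E" if "z \<in> E" for z
    unfolding E_def
  proof (intro CollectI allI)
    fix k
    have "\<not> is_pole f ((f ^^ Suc k) z) \<and> norm ((f ^^ Suc k) z) > R1" using that unfolding E_def by blast
    then show "\<not> is_pole f ((f ^^ k) (f z)) \<and> norm ((f ^^ k) (f z)) > R1" by (simp add: funpow_swap1)
  qed
  define m where "m a = pole_mult f a" for a
  define X where "X = {a \<in> P. norm a \<ge> R2'} \<times> Q"
  \<comment> \<open>A letter is a pole together with the unit strip that contains a logarithm
    \<zeta> of f z. Without the strip, two points in the same tract could have logarithms far apart
    for nearby images, and \<open>norm_diff_le_exp_diff\<close> would not apply.\<close>
  define coded where "coded z x \<longleftrightarrow> x \<in> X \<and> (\<exists>\<zeta>. z = tract_map (fst x) (exp (- \<zeta> / of_nat (m (fst x)))) \<and>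
      exp (- \<zeta> / of_nat (m (fst x))) \<in> cball 0 (rad (m (fst x)) / 4) \<and> exp \<zeta> = f z \<and>
      snd x = \<lfloor>Im \<zeta>\<rfloor> \<and> norm (fst x) \<le> K * norm z)" for z x
  have coded_ex: "\<exists>x. coded z x" if z: "z \<in> E" for z
  proof -
    have np: "\<not> is_pole f z" "norm z > R1" "norm (f z) > R1" using E1[OF z] E1[OF Ef[OF z]] by auto
    then have "norm (f z) > R" using R1R by linarith
    then obtain a where a0: "\<exists>\<Psi>. chart a \<Psi>"
      and "\<And>\<Psi>. chart a \<Psi> \<Longrightarrow> z \<in> \<Psi> ` (ball 0 (radius a) - {0})"
      using covering_by_charts[OF np(1)] by blast
    then have a: "tract_pole a" by (simp add: tract_pole_def)
    have ch: "chart a (tract_map a)" by (rule chart_tract_map[OF a])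
    then have "z \<in> tract_map a ` (ball 0 (rad (m a)) - {0})"
      using \<open>\<And>\<Psi>. chart a \<Psi> \<Longrightarrow> _\<close> by (simp add: m_def)
    then obtain u where u: "z = tract_map a u" "u \<in> ball 0 (rad (m a)) - {0}" by blast
    have m1: "m a \<ge> 1" using ch by (simp add: chart_def m_def)
    define \<zeta> where "\<zeta> = - of_nat (m a) * Ln u"
    have u\<zeta>: "exp (- \<zeta> / of_nat (m a)) = u" using exp_minus_Ln_div[OF m1, of u] u(2) by (simp add: \<zeta>_def)
    have "f z * u ^ m a = 1" using ch u unfolding chart_def m_def by blast
    moreover have "exp \<zeta> * u ^ m a = 1"
      unfolding u\<zeta>[symmetric] using m1 by (simp flip: exp_of_nat_mult exp_add)
    ultimately have f\<zeta>: "exp \<zeta> = f z" using u(2) by (metis DiffD2 insertI1 mult_cancel_right power_not_zero)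
    have "R * 4 ^ M' < exp (Re \<zeta>)" using np(3) R1(1) by (simp flip: f\<zeta>)
    then have "ln (R * 4 ^ M') < Re \<zeta>" using R_pos by (metis exp_less_cancel_iff exp_ln mult_pos_pos zero_less_numeral zero_less_power)
    then have Re: "Re \<zeta> > ln R + real M' * ln 4" using R_pos by (simp add: ln_mult ln_realpow)
    have u4: "norm u \<le> rad (m a) / 4"
      unfolding u\<zeta>[symmetric] using m1 mM'[OF a] Re by (intro norm_exp_le_rad_quarter) (auto simp: m_def)
    have aP: "a \<in> P"
    proof (rule ccontr)
      assume "a \<notin> P"
      then have "norm z \<le> B1" using B1[of a u] a u u4 by (simp add: Ex_def m_def)
      then show False using np(2) R1(2) by linarith
    qed
    then have a': "a \<noteq> 0" "pole_mult f a \<le> M" by (auto simp: P_def)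
    have u2: "norm u \<le> radius a / 2" using u4 rad_pos[of "m a"] unfolding m_def by linarith
    have dis: "norm z \<le> K * norm a" "norm a \<le> K * norm z"
      using tract_map_distortion[OF a a'(1) u2] by (auto simp: K_def u(1))
    have "K * R2' < K * norm a" using dis(1) np(2) R1(3) by linarith
    then have aR: "norm a \<ge> R2'" using K by simp
    have "Im \<zeta> = - real (m a) * Im (Ln u)" by (simp add: \<zeta>_def)
    then have "\<bar>Im \<zeta>\<bar> = real (m a) * \<bar>Im (Ln u)\<bar>" by (simp add: abs_mult)
    also have "\<dots> \<le> real M * 4"
    proof (rule mult_mono)
      have "\<bar>Im (Ln u)\<bar> \<le> pi" using mpi_less_Im_Ln[of u] Im_Ln_le_pi[of u] u(2) by (intro abs_leI) auto
      then show "\<bar>Im (Ln u)\<bar> \<le> 4" using pi_less_4 by linarith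
    qed (use a'(2) in \<open>auto simp: m_def\<close>)
    finally have "\<bar>Im \<zeta>\<bar> \<le> real (4 * M)" by simp
    then have "\<lfloor>Im \<zeta>\<rfloor> \<in> Q" unfolding Q_def by (simp add: abs_le_iff le_floor_iff floor_le_iff)
    then have "coded z (a, \<lfloor>Im \<zeta>\<rfloor>)"
      unfolding coded_def X_def using aP aR u4 u(1) u\<zeta> f\<zeta> dis(2) by (auto intro!: exI[of _ \<zeta>])
    then show ?thesis ..
  qed
  define code where "code z = (SOME x. coded z x)" for z
  have code: "coded z (code z)" if "z \<in> E" for z
    unfolding code_def by (rule someI_ex[OF coded_ex[OF that]])
  have codeX: "code z \<in> X" if "z \<in> E" for z using code[OF that] by (simp add: coded_def)
  have X1: "tract_pole (fst x)" "fst x \<in> P" "norm (fst x) \<ge> R2'" "pole_mult f (fst x) \<le> M" "norm (fst x) \<ge> R2"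
    if "x \<in> X" for x
    using that by (auto simp: X_def P_def R2'_def)
  have base: "norm (z - z') \<le> tract_size (fst (code z))"
    if z: "z \<in> E" "z' \<in> E" and c0: "code z = code z'" for z z'
  proof -
    define a where "a = fst (code z)"
    have a: "tract_pole a" using X1 codeX[OF z(1)] by (simp add: a_def)
    obtain u where u: "z = tract_map a u" "u \<in> cball 0 (rad (m a) / 4)"
      using code[OF z(1)] unfolding coded_def a_def by blast
    obtain u' where u': "z' = tract_map a u'" "u' \<in> cball 0 (rad (m a) / 4)"
      using code[OF z(2)] unfolding coded_def a_def c0 by blast
    have "norm (z - z') \<le> tract_size a"
      unfolding u(1) u'(1) using tract_map_diff_le[OF a] u(2) u'(2) by (simp only: m_def)
    then show ?thesis by (simp only: a_def)
  qed
  \<comment> \<open>One step backwards: the logarithm has Lipschitz constant 2/\<mu> and the chart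
    the size times (R/\<mu>)^(1/M), where \<mu> = |b|/K bounds |f z| and |f z'| from below.\<close>
  have step: "norm (z - z') \<le> tract_size (fst (code z)) *
      (\<kappa> * norm (fst (code (f z))) powr (- 1 - 1 / M)) * norm (f z - f z')"
    if z: "z \<in> E" "z' \<in> E" and c0: "code z = code z'" and c1: "code (f z) = code (f z')" for z z'
  proof -
    define a where "a = fst (code z)"
    define b where "b = fst (code (f z))"
    have a: "tract_pole a" "pole_mult f a \<le> M" using X1 codeX[OF z(1)] by (auto simp: a_def)
    have b: "norm b \<ge> R2'" using X1 codeX[OF Ef[OF z(1)]] by (auto simp: b_def)
    have bz: "norm b \<le> K * norm (f z)" "norm b \<le> K * norm (f z')"
      using code[OF Ef[OF z(1)]] code[OF Ef[OF z(2)]] unfolding coded_def b_def c1 by blast+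
    obtain \<zeta> where \<zeta>: "z = tract_map a (exp (- \<zeta> / of_nat (m a)))" "exp \<zeta> = f z" "snd (code z) = \<lfloor>Im \<zeta>\<rfloor>"
      using code[OF z(1)] unfolding coded_def a_def by blast
    obtain \<zeta>' where \<zeta>': "z' = tract_map a (exp (- \<zeta>' / of_nat (m a)))" "exp \<zeta>' = f z'" "snd (code z) = \<lfloor>Im \<zeta>'\<rfloor>"
      using code[OF z(2)] unfolding coded_def a_def c0 by blast
    have im: "\<bar>Im \<zeta> - Im \<zeta>'\<bar> \<le> 1" by (rule floor_eq_imp_diff_le) (use \<zeta>(3) \<zeta>'(3) in simp)
    define \<mu> where "\<mu> = norm b / K"
    have \<mu>R: "\<mu> \<ge> R * 4 ^ M" using b K by (simp add: \<mu>_def R2'_def field_simps)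
    have R4: "R * 4 ^ M > 0" using R_pos by simp
    then have \<mu>0: "\<mu> > 0" using \<mu>R by linarith
    then have b0: "norm b > 0" using K by (simp add: \<mu>_def zero_less_divide_iff)
    have \<mu>f: "\<mu> \<le> norm (exp \<zeta>)" "\<mu> \<le> norm (exp \<zeta>')"
      using bz K unfolding \<zeta>(2) \<zeta>'(2) by (auto simp: \<mu>_def field_simps)
    have x0: "ln \<mu> \<ge> ln R + M * ln 4"
    proof -
      have "ln (R * 4 ^ M) \<le> ln \<mu>" using \<mu>R R4 \<mu>0 by (simp only: ln_le_cancel_iff)
      then show ?thesis using R_pos by (simp add: ln_mult ln_realpow)
    qed
    have "ln \<mu> \<le> Re v" if "\<mu> \<le> norm (exp v)" for v
    proof -
      have "exp (ln \<mu>) \<le> exp (Re v)" using that \<mu>0 by simp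
      then show ?thesis by (simp only: exp_le_cancel_iff)
    qed
    then have re: "Re \<zeta> \<ge> ln \<mu>" "Re \<zeta>' \<ge> ln \<mu>" using \<mu>f by blast+
    have "norm (z - z') \<le> tract_size a * exp (- (ln \<mu> - ln R) / M) * norm (\<zeta> - \<zeta>')"
      using tract_map_exp_Lipschitz[OF a x0 re] unfolding m_def[symmetric] \<zeta>(1)[symmetric] \<zeta>'(1)[symmetric] .
    also have "\<dots> \<le> tract_size a * exp (- (ln \<mu> - ln R) / M) * (2 * norm (f z - f z') / \<mu>)"
    proof (rule mult_left_mono)
      show "norm (\<zeta> - \<zeta>') \<le> 2 * norm (f z - f z') / \<mu>"
        using norm_diff_le_exp_diff[OF im \<mu>f] \<mu>0 unfolding \<zeta>(2) \<zeta>'(2) by (simp add: field_simps)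
    qed (use tract_size_nonneg[OF a(1)] in simp)
    also have "\<dots> = tract_size a * (2 * exp (- (ln \<mu> - ln R) / M) / \<mu>) * norm (f z - f z')" by simp
    also have "2 * exp (- (ln \<mu> - ln R) / M) / \<mu> = 2 * K * (R * K) powr (1 / M) * norm b powr (- 1 - 1 / M)"
    proof -
      have "exp (- (ln \<mu> - ln R) / M) = exp (1 / M * (ln (R * K) - ln (norm b)))"
        using b0 K R_pos by (intro arg_cong[of _ _ exp]) (simp add: \<mu>_def ln_div ln_mult field_simps)
      also have "\<dots> = (R * K) powr (1 / M) * norm b powr (- (1 / M))"
        using b0 K R_pos by (simp add: powr_def right_diff_distrib exp_diff exp_minus divide_inverse flip: exp_add)
      also have "norm b powr (- (1 / M)) = norm b powr (- 1 - 1 / M) * norm b powr 1"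
        unfolding powr_add[symmetric] by simp
      finally show ?thesis using b0 K by (simp add: \<mu>_def)
    qed
    also have "tract_size a * (2 * K * (R * K) powr (1 / M) * norm b powr (- 1 - 1 / M)) * norm (f z - f z')
        \<le> tract_size a * (\<kappa> * norm b powr (- 1 - 1 / M)) * norm (f z - f z')"
      using tract_size_nonneg[OF a(1)] by (intro mult_right_mono mult_left_mono) (auto simp: \<kappa>_def)
    finally show ?thesis by (simp add: a_def b_def)
  qed
  \<comment> \<open>The word begins at f z. The letter of z itself contributes only its size and is
    held fixed in \<open>null_x\<close>.\<close>
  define word where "word l z = map (\<lambda>k. code ((f ^^ k) z)) [1..<Suc l]" for l z
  have word_Suc: "word (Suc l) z = code (f z) # word l (f z)" for l z
  proof -
    have "[1..<Suc (Suc l)] = 1 # map Suc [1..<Suc l]" unfolding map_Suc_upt by (simp add: upt_conv_Cons)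
    then show ?thesis by (simp add: word_def o_def funpow_swap1 del: upt_Suc)
  qed
  have word_X: "length (word l z) = l \<and> set (word l z) \<subseteq> X" if "z \<in> E" for l z
    using that
  proof (induction l arbitrary: z)
    case 0 then show ?case by (simp add: word_def)
  next
    case (Suc l) then show ?case using Ef codeX by (simp add: word_Suc)
  qed
  have word_nonneg: "prod_list (map (\<lambda>x. r (fst x)) (word l z)) \<ge> 0" if z: "z \<in> E" for l z
  proof (rule prod_list_nonneg)
    fix v assume "v \<in> set (map (\<lambda>x. r (fst x)) (word l z))"
    then obtain x where "x \<in> X" "v = r (fst x)" using word_X[OF z, of l] by auto
    then show "0 \<le> v" using ry[OF X1(2) X1(5)] by (simp add: less_imp_le)
  qed
  \<comment> \<open>A step produces the size of one pole and the power of the modulus of the next.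
    Regrouped, a size and a power belong to the same pole \<open>b\<close> and are together at most
    \<open>r b\<close>.\<close>
  have word_dist: "norm (z - z') \<le> tract_size (fst (code z)) * \<kappa> ^ l * prod_list (map (\<lambda>x. r (fst x)) (word l z))"
    if "z \<in> E" "z' \<in> E" "code z = code z'" "word l z = word l z'" for z z' l
    using that
  proof (induction l arbitrary: z z')
    case 0
    then show ?case using base by (simp add: word_def)
  next
    case (Suc l)
    define b where "b = fst (code (f z))"
    have c1: "code (f z) = code (f z')" and w: "word l (f z) = word l (f z')"
      using Suc.prems(4) by (auto simp: word_Suc)
    have bX: "b \<in> P" "norm b \<ge> R2" "tract_pole b" using X1 codeX[OF Ef[OF Suc.prems(1)]] by (auto simp: b_def)
    define p where "p = prod_list (map (\<lambda>x. r (fst x)) (word l (f z)))"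
    have p0: "p \<ge> 0" unfolding p_def by (rule word_nonneg[OF Ef[OF Suc.prems(1)]])
    have s0: "tract_size (fst (code z)) \<ge> 0" using tract_size_nonneg X1(1)[OF codeX[OF Suc.prems(1)]] by blast
    have "norm (z - z') \<le> tract_size (fst (code z)) * (\<kappa> * norm b powr (- 1 - 1 / M)) * norm (f z - f z')"
      using step[OF Suc.prems(1-3) c1] by (simp add: b_def)
    also have "\<dots> \<le> tract_size (fst (code z)) * (\<kappa> * norm b powr (- 1 - 1 / M)) * (tract_size b * \<kappa> ^ l * p)"
      using Suc.IH[OF Ef[OF Suc.prems(1)] Ef[OF Suc.prems(2)] c1 w] s0 \<kappa>
      by (intro mult_left_mono) (auto simp: b_def p_def)
    also have "\<dots> = tract_size (fst (code z)) * \<kappa> ^ Suc l * p * (tract_size b * norm b powr (- 1 - 1 / M))"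
      by (simp add: mult_ac)
    also have "\<dots> \<le> tract_size (fst (code z)) * \<kappa> ^ Suc l * p * r b"
      using rsz[OF bX(1,2)] s0 p0 \<kappa> by (intro mult_left_mono) auto
    finally show ?case by (simp add: word_Suc p_def b_def mult_ac)
  qed
  have cP: "countable P"
    using sparse_imp_countable[OF open_UNIV sparse_poles] P_pole
    by (elim countable_subset[rotated]) (auto simp: P_def)
  have "countable {a \<in> P. norm a \<ge> R2'}" by (rule countable_subset[OF _ cP]) auto
  then have cX: "countable X"
    unfolding X_def by (rule countable_SIGMA) (simp add: Q_def countable_finite)
  have null_x: "h_null h {z \<in> E. code z = x}" if x: "x \<in> X" for x
  \<comment> \<open>The summand 1 makes the constant positive, as \<open>tree_null\<close> requires;
    the size is only known to be nonnegative.\<close>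
  proof (rule tree_null[of "tract_size (fst x) + 1" \<kappa> X _ word "\<lambda>x. r (fst x)" "\<lambda>x. y (fst x)"])
    have s0: "tract_size (fst x) \<ge> 0" using tract_size_nonneg X1(1)[OF x] by blast
    then show "tract_size (fst x) + 1 > 0" by linarith
    fix z z' l assume z: "z \<in> {z \<in> E. code z = x}" "z' \<in> {z \<in> E. code z = x}" "word l z = word l z'"
    have p0: "prod_list (map (\<lambda>x. r (fst x)) (word l z)) \<ge> 0" using z by (intro word_nonneg) auto
    have "norm (z - z') \<le> tract_size (fst x) * \<kappa> ^ l * prod_list (map (\<lambda>x. r (fst x)) (word l z))"
      using word_dist[of z z' l] z by auto
    also have "\<dots> \<le> (tract_size (fst x) + 1) * \<kappa> ^ l * prod_list (map (\<lambda>x. r (fst x)) (word l z))"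
      using p0 \<kappa> by (intro mult_right_mono) auto
    finally show "norm (z - z') \<le> (tract_size (fst x) + 1) * \<kappa> ^ l * prod_list (map (\<lambda>x. r (fst x)) (word l z))" .
  next
    fix F assume F: "finite F" "F \<subseteq> X"
    have sub: "F \<subseteq> fst ` F \<times> Q" using F by (force simp: X_def)
    have finQ: "finite Q" by (simp add: Q_def)
    have "(\<Sum>x\<in>F. \<kappa>\<^sup>2 * (r (fst x))\<^sup>2 * y (fst x) powr \<gamma>) \<le> (\<Sum>x\<in>fst ` F \<times> Q. \<kappa>\<^sup>2 * (r (fst x))\<^sup>2 * y (fst x) powr \<gamma>)"
      using F finQ sub by (intro sum_mono2) auto
    also have "\<dots> = (\<Sum>a\<in>fst ` F. \<Sum>q\<in>Q. \<kappa>\<^sup>2 * (r a)\<^sup>2 * y a powr \<gamma>)"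
      unfolding sum.cartesian_product by (simp only: split_def)
    also have "\<dots> = \<kappa>\<^sup>2 * real (8 * M + 1) * (\<Sum>a\<in>fst ` F. (r a)\<^sup>2 * y a powr \<gamma>)"
      unfolding sum_constant cardQ sum_distrib_left by (intro sum.cong) (simp_all add: mult_ac)
    also have "\<dots> \<le> 1 / 2"
      using F X1 by (intro rsum) auto
    finally show "(\<Sum>x\<in>F. \<kappa>\<^sup>2 * (r (fst x))\<^sup>2 * y (fst x) powr \<gamma>) \<le> 1 / 2" .
  qed (use \<kappa> cX word_X ry X1 in auto)
  have "h_null h (\<Union>x\<in>X. {z \<in> E. code z = x})" by (rule h_null_UN[OF cX null_x])
  then have "h_null h E" by (rule h_null_mono) (use codeX in blast)
  then show ?thesis using that R1R unfolding E_def by blast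
qed

text \<open>An escaping orbit eventually stays above \<open>R1\<close>, so the escaping set lies in
  a countable union of iterated preimages of one null set.\<close>

lemma h_null_escaping_set:
  assumes gauge: "log_gauge n \<gamma> h" and n: "n \<ge> 1" and ord: "nth_order n f = ereal \<rho>" "\<rho> > 0"
    and M: "M \<ge> 1" and fin: "finite {z. is_pole f z \<and> pole_mult f z > M}"
    and \<gamma>: "\<gamma> > 0" "\<gamma> < 2 / (real M * \<rho>)"
  shows "h_null h (escaping_set f)"
proof -
  interpret log_gauge n \<gamma> h by (rule gauge)
  obtain R1 where R1: "R1 \<ge> R" and null: "h_null h {z. \<forall>k. \<not> is_pole f ((f ^^ k) z) \<and> norm ((f ^^ k) z) > R1}"
    by (rule h_null_large_orbits[OF assms])
  define E where "E = {z. \<forall>k. \<not> is_pole f ((f ^^ k) z) \<and> norm ((f ^^ k) z) > R1}"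
  define pre where "pre k = {z. (\<forall>j<k. \<not> is_pole f ((f ^^ j) z)) \<and> (f ^^ k) z \<in> E}" for k
  have "escaping_set f \<subseteq> (\<Union>k. pre k)"
  proof
    fix z assume z: "z \<in> escaping_set f"
    then have np: "\<not> is_pole f ((f ^^ k) z)" for k by (simp add: escaping_set_def)
    have "filterlim (\<lambda>k. norm ((f ^^ k) z)) at_top sequentially"
      using z unfolding escaping_set_def by (auto intro: filterlim_at_infinity_imp_norm_at_top)
    then have "\<forall>\<^sub>F k in sequentially. norm ((f ^^ k) z) > R1" by (simp add: filterlim_at_top_dense)
    then obtain k where k: "\<And>j. j \<ge> k \<Longrightarrow> norm ((f ^^ j) z) > R1" by (auto simp: eventually_sequentially)
    have "(f ^^ k) z \<in> E" unfolding E_def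
    proof (intro CollectI allI)
      fix j
      show "\<not> is_pole f ((f ^^ j) ((f ^^ k) z)) \<and> norm ((f ^^ j) ((f ^^ k) z)) > R1"
        using np[of "j + k"] k[of "j + k"] by (simp add: funpow_add)
    qed
    then show "z \<in> (\<Union>k. pre k)" using np by (auto simp: pre_def)
  qed
  moreover have "h_null h (pre k)" for k
  proof (cases "E = {}")
    case True
    then have "pre k = {}" by (auto simp: pre_def)
    then show ?thesis using h_null_countable[of "{}"] by simp
  next
    case False
    then obtain p where "p \<in> E" by blast
    then have "\<not> is_pole f ((f ^^ 0) p)" "norm ((f ^^ 1) p) > R1"
      unfolding E_def by blast+
    \<comment> \<open>Since |f p| > R1 >= R, the point \<open>p\<close> is not critical; it is the
      regular point that \<open>h_null_preimage\<close> asks for.\<close>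
    then have p: "\<not> is_pole f p" "deriv f p \<noteq> 0" using critical[of p] R1 by auto
    show ?thesis
    proof (induction k)
      case 0
      then show ?case using null by (simp add: pre_def E_def)
    next
      case (Suc k)
      have "pre (Suc k) \<subseteq> {z. \<not> is_pole f z \<and> f z \<in> pre k}"
      proof
        fix z assume z: "z \<in> pre (Suc k)"
        have "\<not> is_pole f ((f ^^ Suc j) z)" if "j < k" for j using z that by (auto simp: pre_def simp del: funpow.simps)
        moreover have "\<not> is_pole f ((f ^^ 0) z)" using z by (auto simp: pre_def simp del: funpow.simps)
        ultimately show "z \<in> {z. \<not> is_pole f z \<and> f z \<in> pre k}" using z by (simp add: pre_def funpow_swap1)
      qed
      then show ?case using h_null_mono[OF h_null_preimage[OF gauge Suc p]] by blast
    qed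
  qed
  then have "h_null h (\<Union>k. pre k)" by (rule h_null_UN_nat)
  ultimately show ?thesis using h_null_mono by blast
qed

end

theorem theorem1p1:
  fixes n M :: nat and f :: "complex \<Rightarrow> complex" and \<rho> \<gamma> :: real and h :: "real \<Rightarrow> real"
  assumes "n \<ge> 1"
    and "f \<in> class_B"
    and "nth_order n f = ereal \<rho>" and "\<rho> > 0"
    and "\<not> infinite_asymptotic_value f"
    and "M \<ge> 1" and "finite {z. is_pole f z \<and> pole_mult f z > M}"
    and "\<gamma> > 0"
    and "h 0 = 0"
    and "\<And>t. 0 < t \<Longrightarrow> t \<le> 1 / (exp ^^ n) \<gamma> \<Longrightarrow> h t = t\<^sup>2 * ((ln ^^ n) (1 / t)) powr \<gamma>"
    and "\<gamma> < 2 / (real M * \<rho>)"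
  shows "hausdorff_measure h (escaping_set f) = 0"
proof -
  have "bounded (finite_inverse_singularities f)" using assms(2) by (simp add: class_B_def)
  then obtain S where S: "\<And>w. w \<in> finite_inverse_singularities f \<Longrightarrow> norm w \<le> S"
    unfolding bounded_iff by blast
  \<comment> \<open>The entry |f 0| provides \<open>f_0\<close>, and 1 makes \<open>R\<close>
    positive.\<close>
  define R where "R = max (max S (norm (f 0))) 1"
  have sing: "norm w \<le> R" if "finite_critical_value f w \<or> finite_asymptotic_value f w" for w
  proof -
    have "w \<in> {w. finite_critical_value f w \<or> finite_asymptotic_value f w}" using that by simp
    then have "w \<in> finite_inverse_singularities f"
      unfolding finite_inverse_singularities_def by (rule subsetD[OF closure_subset])
    then have "norm w \<le> S" by (rule S)
    then show ?thesis by (simp add: R_def)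
  qed
  interpret tracts f R
  proof
    show "f nicely_meromorphic_on UNIV" using assms(2) by (simp add: class_B_def)
    show "norm (f z) \<le> R" if "\<not> is_pole f z" "deriv f z = 0" for z
      by (rule sing) (use that in \<open>auto simp: finite_critical_value_def\<close>)
    show "norm w \<le> R" if "finite_asymptotic_value f w" for w
      by (rule sing) (use that in simp)
  qed (use assms(5) in \<open>auto simp: R_def\<close>)
  have "log_gauge n \<gamma> h" by unfold_locales (use assms in auto)
  then show ?thesis
    by (intro hausdorff_measure_eq_0 h_null_escaping_set[OF _ assms(1,3,4,6,7,8,11)])
qed

end
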